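(* Let $m$ be a positive integer. For integers $n,\nu$ with $0\le n<2m$, $0\le \nu\le 2m$ and $a\in\mathbb{Z}/2m\mathbb{Z}$, consider the holomorphic functions $F^{[m](a,0)}_{n,\nu}(\tau,0)$ on the upper half plane. Then the $\mathbb{C}$-linear span $V$ of the set $$\{F^{[m](a,0)}_{n,\nu}(\tau,0)\ ;\ n,\nu\in\mathbb{Z}_{\ge0},\ a\in\mathbb{Z}/2m\mathbb{Z},\ n<2m,\ \nu\le 2m\}$$ is $SL_2(\mathbb{Z})$-invariant; that is, for every $f\in V$, both $f(\tau+1)$ and $(-i\tau)^{-3/2}f(-1/\tau)$ belong to $V$.
   Context: Throughout, $\tau$ lies in the upper half plane, $q=e^{2\pi i\tau}$, and $(-i\tau)^{1/2}$ denotes the principal branch. For $m\in\frac12\mathbb{Z}_{>0}$ and $j\in\frac12\mathbb{Z}$ define the theta functions $\theta_{j,m}(\tau,z)=\sum_{k\in\frac{j}{2m}+\mathbb{Z}}e^{2\pi i m k z}q^{mk^2}$ and $\theta^{(-)}_{j,m}(\tau,z)=\sum_{k\in\mathbb{Z}}(-1)^k e^{2\pi i m(k+\frac{j}{2m})z}q^{m(k+\frac{j}{2m})^2}$. For integers $n,\nu$ with $0\le n<2m$, $0\le\nu\le 2m$ define $g^{[m]}_{n,\nu}(\tau)=\sum_{j,p\in\mathbb{Z},\,0<p\le j}(-1)^j q^{Q_{j,p}}-\sum_{j,p\in\mathbb{Z},\,j<p\le 0}(-1)^j q^{Q_{j,p}}$ with $Q_{j,p}=(m+\frac12)\big(j+\nu-\frac{\nu+\frac12}{2m+1}\big)^2-m\big(p+\nu-\frac{n}{2m}\big)^2$;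 $h^{[m]}_{n,\nu}(\tau,z)=\sum_{j\in\mathbb{Z}}\frac{e^{2\pi i mjz+\pi i nz}q^{mj^2+n(j+\nu)}}{1-e^{2\pi i mz}q^{2m(j+\nu)}}$; $G^{[m]}_{n,\nu}(\tau,z)=g^{[m]}_{n,\nu}(\tau)\theta_{n,m}(\tau,z)+(-1)^\nu q^{-m\nu^2}\theta^{(-)}_{\nu+\frac12,m+\frac12}(\tau,0)\,h^{[m]}_{n,\nu}(\tau,z)$; and for $a,b\in\mathbb{Z}$, $F^{[m](a,b)}_{n,\nu}(\tau,z)=e^{\pi i a z}q^{\frac{a^2}{4m}}G^{[m]}_{n,\nu}\big(\tau,z+\frac{a\tau}{m}+\frac{b}{m}\big)$. (The function $F^{[m](a,b)}_{n,\nu}$ depends only on $a,b$ modulo $2m$.)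
   Formalization: For a ≡ 0 mod 2m the function F^{[m](a,0)}_{n,ν}(τ,z) has in general a simple pole at z=0 (unless ν=m), so its value F(τ,0) is undefined; there it is read as the constant term of the Laurent expansion in z at 0. *)

theory Defs
  imports
    "HOL-Complex_Analysis.Complex_Analysis"
    "HOL-Library.Function_Algebras"
begin

text \<open>The power $q^x$ with $q = e^{2\pi i\tau}$.\<close>

definition qpow :: "complex \<Rightarrow> real \<Rightarrow> complex" where
  "qpow \<tau> x = exp (2 * pi * \<i> * \<tau> * x)"

text \<open>
  The indices of the two theta functions are half-integers; they are taken as reals here.
\<close>

definition theta :: "real \<Rightarrow> real \<Rightarrow> complex \<Rightarrow> complex \<Rightarrow> complex" where
  "theta j m \<tau> z =
     (\<Sum>\<^sub>\<infinity>k\<in>range (\<lambda>l::int. j / (2 * m) + l). exp (2 * pi * \<i> * m * k * z) * qpow \<tau> (m * k\<^sup>2))"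

definition theta_minus :: "real \<Rightarrow> real \<Rightarrow> complex \<Rightarrow> complex \<Rightarrow> complex" where
  "theta_minus j m \<tau> z =
     (\<Sum>\<^sub>\<infinity>k::int. (-1) powi k * exp (2 * pi * \<i> * m * (k + j / (2 * m)) * z)
                 * qpow \<tau> (m * (k + j / (2 * m))\<^sup>2))"

definition Q_form :: "int \<Rightarrow> int \<Rightarrow> int \<Rightarrow> int \<Rightarrow> int \<Rightarrow> real" where
  "Q_form m n \<nu> j p =
     (m + 1 / 2) * (j + \<nu> - (\<nu> + 1 / 2) / (2 * m + 1))\<^sup>2 - m * (p + \<nu> - n / (2 * m))\<^sup>2"

definition g_fun :: "int \<Rightarrow> int \<Rightarrow> int \<Rightarrow> complex \<Rightarrow> complex" where
  "g_fun m n \<nu> \<tau> =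
     (\<Sum>\<^sub>\<infinity>(j, p)\<in>{(j, p). 0 < p \<and> p \<le> j}. (-1) powi j * qpow \<tau> (Q_form m n \<nu> j p))
   - (\<Sum>\<^sub>\<infinity>(j, p)\<in>{(j, p). j < p \<and> p \<le> 0}. (-1) powi j * qpow \<tau> (Q_form m n \<nu> j p))"

definition h_fun :: "int \<Rightarrow> int \<Rightarrow> int \<Rightarrow> complex \<Rightarrow> complex \<Rightarrow> complex" where
  "h_fun m n \<nu> \<tau> z =
     (\<Sum>\<^sub>\<infinity>j::int. exp (2 * pi * \<i> * m * j * z + pi * \<i> * n * z) * qpow \<tau> (m * j\<^sup>2 + n * (j + \<nu>))
                 / (1 - exp (2 * pi * \<i> * m * z) * qpow \<tau> (2 * m * (j + \<nu>))))"

definition G_fun :: "int \<Rightarrow> int \<Rightarrow> int \<Rightarrow> complex \<Rightarrow> complex \<Rightarrow> complex" where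
  "G_fun m n \<nu> \<tau> z =
     g_fun m n \<nu> \<tau> * theta n m \<tau> z
   + (-1) powi \<nu> * qpow \<tau> (- (m * \<nu>\<^sup>2)) * theta_minus (\<nu> + 1 / 2) (m + 1 / 2) \<tau> 0 * h_fun m n \<nu> \<tau> z"

definition F_fun :: "int \<Rightarrow> int \<Rightarrow> int \<Rightarrow> int \<Rightarrow> int \<Rightarrow> complex \<Rightarrow> complex \<Rightarrow> complex" where
  "F_fun m a b n \<nu> \<tau> z =
     exp (pi * \<i> * a * z) * qpow \<tau> (a\<^sup>2 / (4 * m)) * G_fun m n \<nu> \<tau> (z + a * \<tau> / m + b / m)"

text \<open>
  Evaluation of a meromorphic function: the ordinary value at a regular point, and the
  constant term of the Laurent expansion at a pole.
\<close>

definition value_at :: "(complex \<Rightarrow> complex) \<Rightarrow> complex \<Rightarrow> complex" where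
  "value_at f z\<^sub>0 =
     (if f analytic_on {z\<^sub>0} then f z\<^sub>0 else fls_nth (laurent_expansion f z\<^sub>0) 0)"

text \<open>
  The function $F^{[m](a,0)}_{n,\nu}(\tau,0)$ on the upper half plane, extended by $0$ so that
  equality of functions is equality on the upper half plane.  For $a \not\equiv 0$ modulo $2m$
  the function $z \mapsto F^{[m](a,0)}_{n,\nu}(\tau,z)$ is regular at $z = 0$.  For
  $a \equiv 0$ one summand of $h^{[m]}_{n,\nu}$ has a simple pole there; in
  $F^{[m](a,0)}_{n,\nu}$ its residue is a nonzero constant times
  $\theta^{(-)}_{\nu+1/2,m+1/2}(\tau,0)$, which vanishes identically only for $\nu = m$.
  Evaluation at such a pole means taking the constant term.  The literal expression would instead
  discard the whole singular summand, because of the convention $x / 0 = 0$.  The constant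
  term is compatible with the modular action: substituting $z/\tau$ for $z$ and multiplying by
  a Gaussian factor $e^{c z^2}$ does not mix it with the residue at a simple pole.
\<close>

definition F_null :: "int \<Rightarrow> int \<Rightarrow> int \<Rightarrow> int \<Rightarrow> complex \<Rightarrow> complex" where
  "F_null m a n \<nu> \<tau> = (if Im \<tau> > 0 then value_at (\<lambda>z. F_fun m a 0 n \<nu> \<tau> z) 0 else 0)"

global_interpretation complex_fun: vector_space "\<lambda>(c::complex) (f::complex \<Rightarrow> complex) \<tau>. c * f \<tau>"
  defines complex_span = complex_fun.span
  by unfold_locales (auto simp: fun_eq_iff algebra_simps)

definition V_space :: "int \<Rightarrow> (complex \<Rightarrow> complex) set" where
  "V_space m = complex_span
     {F_null m a n \<nu> | a n \<nu>. 0 \<le> a \<and> a < 2 * m \<and> 0 \<le> n \<and> n < 2 * m \<and> 0 \<le> \<nu> \<and> \<nu> \<le> 2 * m}"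

end

theory Submission
  imports Defs
begin

text \<open>
  Put \<open>\<Psi>\<^sub>\<nu>(\<tau>, z) = \<theta>\<^sup>(\<^sup>-\<^sup>)(\<tau>, z) A(\<tau>, z/2)\<close>, where \<open>\<theta>\<^sup>(\<^sup>-\<^sup>)\<close> has indices
  \<open>\<nu> + 1/2\<close> and \<open>m + 1/2\<close> and \<open>A(w) = \<Sum>\<^sub>r (-1)\<^sup>r q\<^bsup>r(r+1)/2\<^esup> y\<^bsup>1/2\<^esup> / (1 - y q\<^sup>r)\<close> with
  \<open>y = e\<^bsup>2\<pi>iw\<^esup>\<close>. In the strip \<open>0 < Im w < Im \<tau>\<close> all geometric series can be expanded, and comparing
  Fourier coefficients shows that \<open>(-1)\<^sup>\<nu> G\<^sub>n\<^sub>,\<^sub>\<nu>\<close> is the part of \<open>\<Psi>\<^sub>\<nu>\<close> with exponents congruent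
  to \<open>n\<close> modulo \<open>2m\<close>: the indefinite theta series and the coefficients of \<open>\<Psi>\<^sub>\<nu>\<close> differ by
  finitely many rows of the double series, and these are the coefficients of \<open>h\<^sub>n\<^sub>,\<^sub>\<nu>\<close>. The same
  comparison with \<open>m = \<nu> = 0\<close> shows that \<open>A\<close> is a multiple of the inverse of the odd Jacobi theta
  function. So \<open>\<Psi>\<^sub>\<nu>\<close> is a quotient of theta functions, hence a vector-valued meromorphic Jacobi form
  of index \<open>m\<close>, and the span in question is the span of the constant terms of \<open>\<Psi>\<^sub>\<nu>\<close> at the
  points \<open>(a\<tau> + b)/m\<close>, on which the modular group acts through \<open>(a, b)\<close> and \<open>\<nu>\<close>.

  The transformation of the theta function under \<open>\<tau> \<mapsto> -1/\<tau>\<close> is obtained without Poisson summation: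
  by Liouville's theorem it holds up to a factor depending on \<open>\<tau>\<close>, and the distribution relation over
  the \<open>N\<close>-torsion points determines how this factor changes under \<open>\<tau> \<mapsto> N\<^sup>2\<tau>\<close>.
\<close>


section \<open>Exponentials and absolutely convergent series\<close>


text \<open>In the coefficient of index N of the product, the sign region is cut at j <= floor((N -
  nu - 1)/(2m + 1)), while g needs a cut that does not match. The two fit because, for fixed j, the
  summand is odd under a reflection of r: a complete sum over r is zero, so the cut in j is free.
  Only moving the cut in r costs something. For each r that changes sides, the sum over j is a
  shifted theta series, and this produces the null value of theta in front of h.

  The expansions live in an open strip, but for a = 0 the constant term is taken at z = 0, on the
  boundary and possibly at a pole. Hence the polar summand is split off and the identities are
  continued across the real line.

  Translating z by b/m multiplies G by a 2m-th root of unity depending on n, so n is recovered by a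
  finite Fourier transform in b; this is why the two spans agree. The inverse theta function is
  normalised by the derivative of theta at 0, whose transformation follows from the chain rule. It
  contributes weight 1 and the theta function weight 1/2, together 3/2.\<close>

definition ee :: "complex \<Rightarrow> complex" where
  "ee x = exp (2 * of_real pi * \<i> * x)"

lemma ee_add: "ee (x + y) = ee x * ee y"
  by (simp add: ee_def distrib_left exp_add)

lemma ee_0 [simp]: "ee 0 = 1"
  by (simp add: ee_def)

lemma ee_nonzero [simp]: "ee x \<noteq> 0"
  by (simp add: ee_def)

lemma ee_minus: "ee (- x) = inverse (ee x)"
  by (simp add: ee_def exp_minus)

lemma ee_eq_1_iff: "ee x = 1 \<longleftrightarrow> (\<exists>k::int. x = of_int k)"
proof -
  have "2 * pi * Re x = of_int (2 * k) * pi \<longleftrightarrow> Re x = of_int k" for k :: int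
    by simp
  then show ?thesis
    unfolding ee_def exp_eq_1 by (auto simp: complex_eq_iff)
qed

lemma ee_of_int [simp]: "ee (of_int k) = 1"
  using ee_eq_1_iff by blast

lemma ee_cong:
  assumes "x - y = of_int k"
  shows "ee x = ee y"
proof -
  have "ee x = ee (of_int k + y)" using assms by (simp add: algebra_simps)
  then show ?thesis by (simp add: ee_add)
qed

lemma norm_ee: "norm (ee x) = exp (- (2 * pi * Im x))"
  by (simp add: ee_def)

lemma ee_half: "ee (1 / 2) = - 1"
  by (simp add: ee_def exp_pi_i)

lemma ee_half_int: "ee (of_int k / 2) = (- 1) powi k"
proof (cases "even k")
  case True
  then obtain l where "k = 2 * l" by blast
  then show ?thesis by (simp add: power_int_mult)
next
  case False
  then obtain l where l: "k = 2 * l + 1" by (blast elim: oddE)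
  have "ee (of_int k / 2) = ee (1 / 2)"
    by (rule ee_cong[where k = l]) (simp add: l field_simps)
  then show ?thesis by (simp add: l power_int_add power_int_mult ee_half)
qed

lemma ee_power_int: "ee (of_int k * x) = ee x powi k"
  by (simp add: ee_def exp_power_int algebra_simps)

lemma qpow_eq_ee: "qpow \<tau> x = ee (\<tau> * of_real x)"
  by (simp add: qpow_def ee_def mult.assoc)

lemma holomorphic_ee [holomorphic_intros]:
  "f holomorphic_on S \<Longrightarrow> (\<lambda>z. ee (f z)) holomorphic_on S"
  unfolding ee_def by (intro holomorphic_intros)

lemma ee_has_field_derivative:
  "(ee has_field_derivative 2 * of_real pi * \<i> * ee x) (at x)"
  unfolding ee_def by (auto intro!: derivative_eq_intros)

lemma summable_on_geometric_int:
  fixes x :: real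
  assumes "0 < x" "x < 1"
  shows "(\<lambda>k::int. x ^ nat \<bar>k\<bar>) summable_on UNIV"
proof -
  have *: "(\<lambda>n::nat. x ^ n) summable_on UNIV"
    using assms by (intro norm_summable_imp_summable_on) simp
  have 1: "(\<lambda>k::int. x ^ nat \<bar>k\<bar>) summable_on range int"
    using * by (subst summable_on_reindex) (auto simp: o_def)
  have 2: "(\<lambda>k::int. x ^ nat \<bar>k\<bar>) summable_on range (\<lambda>n. - int n)"
    using * by (subst summable_on_reindex) (auto simp: o_def inj_on_def)
  have "k \<in> range int \<union> range (\<lambda>n. - int n)" for k :: int
  proof (cases "k \<ge> 0")
    case True
    then have "k = int (nat k)" by simp
    then show ?thesis by (metis UnI1 rangeI)
  next
    case False
    then have "k = - int (nat (- k))" by simp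
    then show ?thesis by (metis UnI2 rangeI)
  qed
  then have "range int \<union> range (\<lambda>n. - int n) = UNIV" by blast
  then show ?thesis using summable_on_union[OF 1 2] by simp
qed

lemma summable_on_gauss:
  fixes a b c :: real
  assumes "a > 0"
  shows "(\<lambda>k::int. exp (- a * of_int k ^ 2 + b * of_int k + c)) summable_on UNIV"
proof (rule summable_on_comparison_test)
  \<comment> \<open>Completing the square bounds (|b| + 1) x - a x^2 by (|b| + 1)^2 / (4 a); the
    additional 1 leaves the geometric factor exp (- |k|).\<close>
  define B where "B = (\<bar>b\<bar> + 1)\<^sup>2 / (4 * a) + c"
  show "(\<lambda>k::int. exp B * exp (- 1 :: real) ^ nat \<bar>k\<bar>) summable_on UNIV"
    by (intro summable_on_cmult_right summable_on_geometric_int) auto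
  fix k :: int
  define x where "x = \<bar>real_of_int k\<bar>"
  have x: "x\<^sup>2 = (real_of_int k)\<^sup>2" "real (nat \<bar>k\<bar>) = x" by (simp_all add: x_def)
  have "b * of_int k \<le> \<bar>b\<bar> * x"
    unfolding x_def by (rule order_trans[OF abs_ge_self]) (simp add: abs_mult)
  moreover have "(\<bar>b\<bar> + 1) * x \<le> a * x\<^sup>2 + (\<bar>b\<bar> + 1)\<^sup>2 / (4 * a)"
  proof -
    have "4 * a * ((\<bar>b\<bar> + 1) * x) \<le> 4 * a * (a * x\<^sup>2) + (\<bar>b\<bar> + 1)\<^sup>2"
      using zero_le_power2[of "2 * a * x - (\<bar>b\<bar> + 1)"] by (simp add: power2_eq_square algebra_simps)
    then have "(\<bar>b\<bar> + 1) * x \<le> (4 * a * (a * x\<^sup>2) + (\<bar>b\<bar> + 1)\<^sup>2) / (4 * a)"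
      using assms by (simp add: pos_le_divide_eq mult.commute)
    also have "\<dots> = a * x\<^sup>2 + (\<bar>b\<bar> + 1)\<^sup>2 / (4 * a)"
      using assms by (simp add: add_divide_distrib)
    finally show ?thesis .
  qed
  ultimately have "- a * of_int k ^ 2 + b * of_int k + c \<le> B + - real (nat \<bar>k\<bar>)"
    unfolding B_def x(2) x(1)[symmetric] by (simp add: algebra_simps)
  moreover have "exp (- 1 :: real) ^ nat \<bar>k\<bar> = exp (- real (nat \<bar>k\<bar>))"
    using exp_of_nat_mult[of "nat \<bar>k\<bar>" "- 1 :: real"] by (simp del: of_nat_nat)
  ultimately show "exp (- a * of_int k ^ 2 + b * of_int k + c) \<le> exp B * exp (- 1 :: real) ^ nat \<bar>k\<bar>"
    by (simp only: exp_add[symmetric] exp_le_cancel_iff)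
qed auto

lemma summable_on_norm_le:
  fixes f :: "'a \<Rightarrow> complex"
  assumes "\<And>x. x \<in> A \<Longrightarrow> norm (f x) \<le> g x" "g summable_on A"
  shows "f summable_on A"
proof (rule abs_summable_summable)
  show "(\<lambda>x. norm (f x)) summable_on A"
    using assms(2) by (rule summable_on_comparison_test) (auto intro: assms(1))
qed

lemma summable_on_norm_complex:
  "(f :: 'a \<Rightarrow> complex) summable_on A \<Longrightarrow> (\<lambda>x. norm (f x)) summable_on A"
  by (simp add: summable_on_iff_abs_summable_on_complex)

lemma norm_ee_gauss:
  "norm (ee (\<tau> * of_real a * of_int k ^ 2 + of_int k * u + v)) =
     exp (- (2 * pi * Im \<tau> * a) * of_int k ^ 2 + (- 2 * pi * Im u) * of_int k + (- 2 * pi * Im v))"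
proof -
  have "Im (\<tau> * of_real a * of_int k ^ 2 + of_int k * u + v) = Im \<tau> * a * of_int k ^ 2 + of_int k * Im u + Im v"
    by (simp add: power2_eq_square)
  then show ?thesis unfolding norm_ee by (simp add: algebra_simps)
qed

lemma summable_on_ee_gauss:
  assumes "Im \<tau> > 0" "a > 0"
  shows "(\<lambda>k::int. ee (\<tau> * of_real a * of_int k ^ 2 + of_int k * u + v)) summable_on UNIV"
proof (rule summable_on_norm_le)
  show "(\<lambda>k::int. exp (- (2 * pi * Im \<tau> * a) * of_int k ^ 2 + (- 2 * pi * Im u) * of_int k
      + (- 2 * pi * Im v))) summable_on UNIV"
    using assms by (intro summable_on_gauss) simp
qed (simp only: norm_ee_gauss order_refl)

text \<open>The M-test gives uniform convergence along the filter of finite subsets, so the sum is a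
  locally uniform limit of finite holomorphic sums, for any index set.\<close>

lemma holomorphic_on_infsum:
  fixes f :: "'a \<Rightarrow> complex \<Rightarrow> complex"
  assumes S: "open S"
    and hol: "\<And>i. i \<in> I \<Longrightarrow> f i holomorphic_on S"
    and le: "\<And>i z. i \<in> I \<Longrightarrow> z \<in> S \<Longrightarrow> norm (f i z) \<le> B i"
    and B: "B summable_on I"
  shows "(\<lambda>z. \<Sum>\<^sub>\<infinity>i\<in>I. f i z) holomorphic_on S"
proof -
  define F where "F = finite_subsets_at_top I"
  have [simp]: "F \<noteq> bot" by (simp add: F_def)
  have ul: "uniform_limit S (\<lambda>X z. \<Sum>i\<in>X. f i z) (\<lambda>z. \<Sum>\<^sub>\<infinity>i\<in>I. f i z) F"
    unfolding F_def using le B by (rule Weierstrass_m_test_general)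
  have ball: "(\<lambda>z. \<Sum>\<^sub>\<infinity>i\<in>I. f i z) holomorphic_on ball z0 r"
    if zr: "cball z0 r \<subseteq> S" for z0 r
  proof (rule holomorphic_uniform_limit)
    have "(\<lambda>z. \<Sum>i\<in>X. f i z) holomorphic_on cball z0 r" if "X \<subseteq> I" for X
      using hol zr that by (intro holomorphic_on_sum) (meson holomorphic_on_subset subset_iff)
    then have "continuous_on (cball z0 r) (\<lambda>z. \<Sum>i\<in>X. f i z) \<and>
        (\<lambda>z. \<Sum>i\<in>X. f i z) holomorphic_on ball z0 r" if "X \<subseteq> I" for X
      using that holomorphic_on_imp_continuous_on holomorphic_on_subset[OF _ ball_subset_cball] by metis
    then show "\<forall>\<^sub>F X in F. continuous_on (cball z0 r) (\<lambda>z. \<Sum>i\<in>X. f i z) \<and>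
        (\<lambda>z. \<Sum>i\<in>X. f i z) holomorphic_on ball z0 r"
      unfolding F_def by (intro eventually_finite_subsets_at_top_weakI)
    show "uniform_limit (cball z0 r) (\<lambda>X z. \<Sum>i\<in>X. f i z) (\<lambda>z. \<Sum>\<^sub>\<infinity>i\<in>I. f i z) F"
      using ul zr by (rule uniform_limit_on_subset)
    show "F \<noteq> bot" by fact
  qed
  have "\<exists>\<epsilon>>0. (\<lambda>z. \<Sum>\<^sub>\<infinity>i\<in>I. f i z) holomorphic_on ball z0 \<epsilon>" if "z0 \<in> S" for z0
  proof -
    obtain e where "e > 0" "cball z0 e \<subseteq> S" using S \<open>z0 \<in> S\<close> open_contains_cball by metis
    then show ?thesis using ball by (intro exI[of _ e]) simp
  qed
  then have "(\<lambda>z. \<Sum>\<^sub>\<infinity>i\<in>I. f i z) analytic_on S"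
    by (simp add: analytic_on_def)
  then show ?thesis by (rule analytic_imp_holomorphic)
qed


text \<open>This is (sg i + sg t) / 2, where sg is 1 on nonnegative and -1 on negative integers: the
  usual weight of Hecke type indefinite sums. Both regions of summation become one sum over all
  pairs.\<close>

definition qsign :: "int \<Rightarrow> int \<Rightarrow> complex" where
  "qsign i t = (if 0 \<le> i \<and> 0 \<le> t then 1 else if i < 0 \<and> t < 0 then - 1 else 0)"

lemma summable_on_product_real:
  fixes f :: "'a \<Rightarrow> real" and g :: "'b \<Rightarrow> real"
  assumes "f summable_on UNIV" "g summable_on UNIV" "\<And>i. f i \<ge> 0" "\<And>i. g i \<ge> 0"
  shows "(\<lambda>(i, t). f i * g t) summable_on UNIV"
proof -
  have "(\<lambda>(i, t). f i * g t) summable_on Sigma UNIV (\<lambda>_. UNIV)"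
  proof (rule summable_on_SigmaI[where g = "\<lambda>i. f i * infsum g UNIV"])
    show "((\<lambda>y. case (x, y) of (i, t) \<Rightarrow> f i * g t) has_sum f x * infsum g UNIV) UNIV" for x
      using assms(2) by (simp add: has_sum_cmult_right)
    show "(\<lambda>i. f i * infsum g UNIV) summable_on UNIV"
      using assms(1) by (rule summable_on_cmult_left)
  qed (use assms in auto)
  then show ?thesis by simp
qed

lemma summable_on_product_complex:
  fixes f :: "'a \<Rightarrow> complex" and g :: "'b \<Rightarrow> complex"
  assumes "f summable_on UNIV" "g summable_on UNIV"
  shows "(\<lambda>(i, t). f i * g t) summable_on UNIV"
proof (rule summable_on_norm_le)
  show "(\<lambda>(i, t). norm (f i) * norm (g t)) summable_on UNIV"
    using assms by (intro summable_on_product_real summable_on_norm_complex) auto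
qed (auto simp: norm_mult)

lemma has_sum_product_complex:
  fixes f :: "'a \<Rightarrow> complex" and g :: "'b \<Rightarrow> complex"
  assumes "(f has_sum a) UNIV" "(g has_sum b) UNIV"
  shows "((\<lambda>(i, t). f i * g t) has_sum a * b) UNIV"
proof -
  have s: "(\<lambda>(i, t). f i * g t) summable_on UNIV"
    using assms[THEN has_sum_imp_summable] by (rule summable_on_product_complex)
  have "infsum (\<lambda>(i, t). f i * g t) (Sigma UNIV (\<lambda>_. UNIV)) = (\<Sum>\<^sub>\<infinity>i. \<Sum>\<^sub>\<infinity>t. f i * g t)"
    using s by (intro infsum_Sigma'_banach[symmetric]) simp
  also have "\<dots> = a * b"
    using assms by (simp add: infsum_cmult_right' infsum_cmult_left' infsumI)
  finally show ?thesis using s by (simp add: has_sum_iff)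
qed

lemma infsum_residue_classes:
  fixes F :: "int \<Rightarrow> complex"
  assumes "F summable_on UNIV" and N: "N > 0"
  shows "(\<Sum>i\<in>{0..<N}. \<Sum>\<^sub>\<infinity>k. F (N * k + i)) = infsum F UNIV"
proof -
  have inv: "(N * k + i) mod N = i" "(N * k + i) div N = k" if "i \<in> {0..<N}" for k i
    using that by auto
  have "((\<lambda>(i, k). F (N * k + i)) has_sum infsum F UNIV) (Sigma {0..<N} (\<lambda>_. UNIV))
      \<longleftrightarrow> (F has_sum infsum F UNIV) UNIV"
    by (rule has_sum_reindex_bij_witness[where j = "\<lambda>(i, k). N * k + i" and i = "\<lambda>K. (K mod N, K div N)"])
      (use N inv in auto)
  then have *: "((\<lambda>(i, k). F (N * k + i)) has_sum infsum F UNIV) (Sigma {0..<N} (\<lambda>_. UNIV))"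
    using assms by simp
  then have "(\<Sum>\<^sub>\<infinity>i\<in>{0..<N}. \<Sum>\<^sub>\<infinity>k. F (N * k + i)) = infsum F UNIV"
    by (subst infsum_Sigma'_banach) (auto simp: has_sum_iff)
  then show ?thesis by simp
qed

text \<open>The quadratic form may be indefinite, but \<open>qsign\<close> forces i * t to be
  nonnegative. There the cross term only shrinks the summand, and the product of two Gaussian series
  is a majorant.\<close>

lemma summable_on_qsign_gauss:
  assumes \<tau>: "Im \<tau> > 0" and a: "a > 0" and b: "b > 0" and c: "c \<ge> 0"
  shows "(\<lambda>(i, t). qsign i t * ee (\<tau> * (of_real a * of_int i ^ 2 + of_real b * of_int t ^ 2
           + of_real c * of_int i * of_int t) + of_int i * d + of_int t * e + f)) summable_on UNIV"
proof (rule summable_on_norm_le)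
  let ?f = "\<lambda>i::int. ee (\<tau> * of_real a * of_int i ^ 2 + of_int i * d + f)"
  let ?g = "\<lambda>t::int. ee (\<tau> * of_real b * of_int t ^ 2 + of_int t * e + 0)"
  show "(\<lambda>(i, t). norm (?f i) * norm (?g t)) summable_on UNIV"
    using \<tau> a b by (intro summable_on_product_real summable_on_norm_complex summable_on_ee_gauss) auto
  fix x :: "int \<times> int"
  obtain i t where x: "x = (i, t)" by fastforce
  have "norm (qsign i t * ee (\<tau> * (of_real a * of_int i ^ 2 + of_real b * of_int t ^ 2
           + of_real c * of_int i * of_int t) + of_int i * d + of_int t * e + f))
       = norm (qsign i t) * norm (ee (of_int (i * t) * (of_real c * \<tau>))) * (norm (?f i) * norm (?g t))"
    unfolding norm_mult[symmetric] mult.assoc ee_add[symmetric] by (simp add: algebra_simps)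
  moreover have "norm (qsign i t) * norm (ee (of_int (i * t) * (of_real c * \<tau>))) \<le> 1"
  proof (cases "qsign i t = 0")
    case False
    then have "i * t \<ge> 0" by (auto simp: qsign_def mult_nonneg_nonneg mult_nonpos_nonpos split: if_splits)
    then have "real_of_int (i * t) \<ge> 0" by (simp only: of_int_0_le_iff)
    then have "real_of_int (i * t) * (c * Im \<tau>) \<ge> 0"
      using c \<tau> by (meson less_imp_le mult_nonneg_nonneg)
    moreover have "Im (of_int (i * t) * (of_real c * \<tau>)) = real_of_int (i * t) * (c * Im \<tau>)"
      by simp
    ultimately show ?thesis by (auto simp: qsign_def norm_ee simp del: of_int_mult)
  qed simp
  ultimately show "norm (case x of (i, t) \<Rightarrow> qsign i t * ee (\<tau> * (of_real a * of_int i ^ 2 + of_real b * of_int t ^ 2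
           + of_real c * of_int i * of_int t) + of_int i * d + of_int t * e + f)) \<le>
         (case x of (i, t) \<Rightarrow> norm (?f i) * norm (?g t))"
    unfolding x case_prod_conv by (simp only:) (rule mult_left_le_one_le, auto)
qed

lemma has_sum_qsign_geometric_nonneg:
  assumes "norm x < 1" "i \<ge> 0" "x \<noteq> 0"
  shows "((\<lambda>t. qsign i t * x powi t) has_sum 1 / (1 - x)) UNIV"
proof -
  have "((\<lambda>n::nat. x ^ n) has_sum (1 / (1 - x))) UNIV"
    using assms by (intro norm_summable_imp_has_sum geometric_sums) (auto simp: norm_power)
  also have "?this \<longleftrightarrow> ((\<lambda>t. x powi t) has_sum (1 / (1 - x))) (range int)"
    by (subst has_sum_reindex) (auto simp: o_def)
  also have "\<dots> \<longleftrightarrow> ((\<lambda>t. qsign i t * x powi t) has_sum 1 / (1 - x)) UNIV"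
    using assms by (intro has_sum_cong_neutral) (auto simp: qsign_def elim: nonneg_int_cases)
  finally show ?thesis .
qed

lemma has_sum_qsign_geometric_neg:
  assumes "norm x > 1" "i < 0"
  shows "((\<lambda>t. qsign i t * x powi t) has_sum 1 / (1 - x)) UNIV"
proof -
  have x: "x \<noteq> 0" using assms by auto
  have "((\<lambda>n::nat. inverse x ^ n) has_sum (1 / (1 - inverse x))) UNIV"
    using assms by (intro norm_summable_imp_has_sum geometric_sums)
      (auto simp: norm_power norm_inverse inverse_less_1_iff)
  then have "((\<lambda>n::nat. - inverse x * inverse x ^ n) has_sum (- inverse x * (1 / (1 - inverse x)))) UNIV"
    by (rule has_sum_cmult_right)
  also have "- inverse x * (1 / (1 - inverse x)) = 1 / (1 - x)"
    using x assms by (auto simp: divide_simps)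
  also have "(\<lambda>n::nat. - inverse x * inverse x ^ n) = (\<lambda>t. - (x powi t)) \<circ> (\<lambda>n. - 1 - int n)"
    using x by (auto simp: fun_eq_iff power_int_diff power_int_minus field_simps)
  also have "(\<dots> has_sum (1 / (1 - x))) UNIV \<longleftrightarrow> ((\<lambda>t. - (x powi t)) has_sum (1 / (1 - x))) (range (\<lambda>n. - 1 - int n))"
    by (subst has_sum_reindex) (auto simp: inj_on_def)
  also have "\<dots> \<longleftrightarrow> ((\<lambda>t. qsign i t * x powi t) has_sum 1 / (1 - x)) UNIV"
  proof (rule has_sum_cong_neutral)
    fix t assume "t \<in> UNIV - range (\<lambda>n. - 1 - int n)"
    then have "t \<ge> 0" by (cases t rule: int_cases) (auto simp: image_iff)
    then show "qsign i t * x powi t = 0" using assms by (simp add: qsign_def)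
  qed (use assms in \<open>auto simp: qsign_def\<close>)
  finally show ?thesis .
qed

text \<open>In the strip, omega + i sigma lies above the real line exactly when i is nonnegative.
  Accordingly 1 / (1 - x) is expanded in powers of x or of its inverse, and \<open>qsign\<close>
  records which.\<close>

lemma has_sum_qsign_geometric:
  assumes "0 < Im \<omega>" "Im \<omega> < Im \<sigma>"
  shows "((\<lambda>t. qsign i t * ee (of_int t * \<omega> + of_int (i * t) * \<sigma>)) has_sum 1 / (1 - ee (\<omega> + of_int i * \<sigma>))) UNIV"
proof -
  have eq: "ee (of_int t * \<omega> + of_int (i * t) * \<sigma>) = ee (\<omega> + of_int i * \<sigma>) powi t" for t
    unfolding ee_power_int[symmetric] by (simp add: algebra_simps)
  have \<sigma>: "Im \<sigma> > 0" using assms by linarith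
  show ?thesis
  proof (cases "i \<ge> 0")
    case True
    then have "Im \<omega> + real_of_int i * Im \<sigma> > 0" using assms \<sigma> by (intro add_pos_nonneg mult_nonneg_nonneg) auto
    then have "norm (ee (\<omega> + of_int i * \<sigma>)) < 1" by (simp add: norm_ee)
    then show ?thesis unfolding eq using True by (intro has_sum_qsign_geometric_nonneg) auto
  next
    case False
    then have "real_of_int i * Im \<sigma> \<le> - 1 * Im \<sigma>" using \<sigma> by (intro mult_right_mono) auto
    then have "norm (ee (\<omega> + of_int i * \<sigma>)) > 1"
      using assms by (simp add: norm_ee) (simp add: mult_pos_neg)
    then show ?thesis unfolding eq using False by (intro has_sum_qsign_geometric_neg) auto
  qed
qed

lemma summable_on_qsign_geometric:
  assumes \<omega>: "0 < Im \<omega>" "Im \<omega> < Im \<sigma>" and c: "c summable_on UNIV"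
  shows "(\<lambda>(i, t). qsign i t * c i * ee (of_int t * \<omega> + of_int (i * t) * \<sigma>)) summable_on UNIV"
proof (rule summable_on_norm_le)
  \<comment> \<open>The distance of Im omega to the ends of the strip. If t is negative then so is
    i, hence i * t >= |t|, which replaces Im omega by Im sigma - Im omega in the decay rate.\<close>
  define \<delta> where "\<delta> = min (Im \<omega>) (Im \<sigma> - Im \<omega>)"
  have \<delta>: "\<delta> > 0" "\<delta> \<le> Im \<omega>" "\<delta> \<le> Im \<sigma> - Im \<omega>" using \<omega> by (auto simp: \<delta>_def)
  show "(\<lambda>(i, t). norm (c i) * exp (- (2 * pi * \<delta>)) ^ nat \<bar>t\<bar>) summable_on UNIV"
    using \<delta> c by (intro summable_on_product_real summable_on_norm_complex summable_on_geometric_int) auto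
  fix x :: "int \<times> int"
  obtain i t where x: "x = (i, t)" by fastforce
  have "norm (qsign i t) * norm (ee (of_int t * \<omega> + of_int (i * t) * \<sigma>)) \<le> exp (- (2 * pi * \<delta>)) ^ nat \<bar>t\<bar>"
  proof (cases "qsign i t = 0")
    case False
    have "real_of_int \<bar>t\<bar> * \<delta> \<le> real_of_int t * Im \<omega> + real_of_int (i * t) * Im \<sigma>"
    proof (cases "t \<ge> 0")
      case True
      then have "i \<ge> 0" using False by (auto simp: qsign_def split: if_splits)
      then have "real_of_int (i * t) * Im \<sigma> \<ge> 0" using True \<omega> by (intro mult_nonneg_nonneg) auto
      moreover have "real_of_int \<bar>t\<bar> * \<delta> \<le> real_of_int t * Im \<omega>"
        using True \<delta> by (intro mult_mono) auto
      ultimately show ?thesis by linarith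
    next
      case f: False
      then have "i < 0" using False by (auto simp: qsign_def split: if_splits)
      then have "\<bar>t\<bar> \<le> i * t" using f mult_right_mono_neg[of i "- 1" t] by simp
      then have "real_of_int \<bar>t\<bar> * Im \<sigma> \<le> real_of_int (i * t) * Im \<sigma>"
        using \<omega> by (intro mult_right_mono) linarith+
      moreover have "real_of_int \<bar>t\<bar> * \<delta> \<le> real_of_int \<bar>t\<bar> * (Im \<sigma> - Im \<omega>)"
        using \<delta> by (intro mult_left_mono) auto
      moreover have "real_of_int \<bar>t\<bar> = - real_of_int t" using f by simp
      ultimately show ?thesis by (simp add: algebra_simps)
    qed
    then have "(2 * pi) * (real_of_int \<bar>t\<bar> * \<delta>) \<le> (2 * pi) * (real_of_int t * Im \<omega> + real_of_int (i * t) * Im \<sigma>)"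
      by (intro mult_left_mono) auto
    moreover have "exp (- (2 * pi * \<delta>)) ^ nat \<bar>t\<bar> = exp (- (2 * pi * (real_of_int \<bar>t\<bar> * \<delta>)))"
      using exp_of_nat_mult[of "nat \<bar>t\<bar>" "- (2 * pi * \<delta>)"] by (simp add: algebra_simps)
    moreover have "Im (of_int t * \<omega> + of_int (i * t) * \<sigma>) = real_of_int t * Im \<omega> + real_of_int (i * t) * Im \<sigma>"
      by simp
    moreover have "norm (qsign i t) = 1" using False by (simp add: qsign_def split: if_splits)
    ultimately show ?thesis by (simp add: norm_ee del: of_int_mult)
  qed simp
  then have "norm (c i) * (norm (qsign i t) * norm (ee (of_int t * \<omega> + of_int (i * t) * \<sigma>))) \<le> norm (c i) * exp (- (2 * pi * \<delta>)) ^ nat \<bar>t\<bar>"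
    by (rule mult_left_mono) simp
  then show "norm (case x of (i, t) \<Rightarrow> qsign i t * c i * ee (of_int t * \<omega> + of_int (i * t) * \<sigma>)) \<le>
      (case x of (i, t) \<Rightarrow> norm (c i) * exp (- (2 * pi * \<delta>)) ^ nat \<bar>t\<bar>)"
    unfolding x case_prod_conv norm_mult by (simp only: ac_simps)
qed

section \<open>Coefficients of the generating function\<close>


text \<open>The square (M x + nu + 1/2)^2 / (2 M) with M = 2 m + 1, multiplied out. The denominator
  then occurs only in the constant term, which \<open>quadE_form\<close> hides from arithmetic
  simplification.\<close>

definition quadE :: "int \<Rightarrow> int \<Rightarrow> complex \<Rightarrow> complex" where
  "quadE m \<nu> x = of_int (2 * m + 1) / 2 * x\<^sup>2 + x * (of_int \<nu> + 1 / 2)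
     + (of_int \<nu> + 1 / 2)\<^sup>2 / (2 * of_int (2 * m + 1))"

lemma quadE_form:
  obtains \<kappa> where "\<And>x. quadE m \<nu> x = (of_int m + 1 / 2) * x\<^sup>2 + x * (of_int \<nu> + 1 / 2) + \<kappa>"
proof
  show "quadE m \<nu> x = (of_int m + 1 / 2) * x\<^sup>2 + x * (of_int \<nu> + 1 / 2)
      + (of_int \<nu> + 1 / 2)\<^sup>2 / (2 * of_int (2 * m + 1))" for x
    unfolding quadE_def by (simp add: add_divide_distrib)
qed

abbreviation vth_term :: "int \<Rightarrow> int \<Rightarrow> complex \<Rightarrow> complex \<Rightarrow> int \<Rightarrow> complex" where
  "vth_term m \<nu> \<tau> w j \<equiv> ee (of_int j / 2 + \<tau> * quadE m \<nu> (of_int j) + (of_int ((2 * m + 1) * j + \<nu>) + 1 / 2) * w)"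

definition vth :: "int \<Rightarrow> int \<Rightarrow> complex \<Rightarrow> complex \<Rightarrow> complex" where
  "vth m \<nu> \<tau> w = (\<Sum>\<^sub>\<infinity>j::int. vth_term m \<nu> \<tau> w j)"

text \<open>One contribution to the coefficient of e^(2 pi i N w) in theta times Appell sum: j
  indexes the theta series, r the Appell summand, and the geometric exponent is forced to be s = N -
  nu - 1 - (2 m + 1) j (see \<open>psi_term_alt\<close>). Written in terms of j - r, it is a shifted
  theta term for each fixed r.\<close>

definition psi_term :: "int \<Rightarrow> int \<Rightarrow> complex \<Rightarrow> int \<Rightarrow> int \<Rightarrow> int \<Rightarrow> complex" where
  "psi_term m \<nu> \<tau> N j r = ee (of_int (j + r) / 2
     + \<tau> * (quadE m \<nu> (of_int (j - r)) - of_int m * (of_int r)\<^sup>2 + of_int r * of_int N))"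

text \<open>The cuts \<open>\<rho>\<close> and \<open>j0\<close> are parameters because the product
  of series produces a cut in j that depends on N, whereas \<open>g_fun\<close> corresponds to a
  different pair.\<close>

definition psi_coeff :: "int \<Rightarrow> int \<Rightarrow> complex \<Rightarrow> int \<Rightarrow> int \<Rightarrow> int \<Rightarrow> complex" where
  "psi_coeff m \<nu> \<tau> \<rho> j0 N = (\<Sum>\<^sub>\<infinity>(j, r). qsign (r - \<rho>) (j0 - j) * psi_term m \<nu> \<tau> N j r)"

lemma summable_on_vth:
  assumes "Im \<tau> > 0" "m \<ge> 0"
  shows "(\<lambda>j::int. vth_term m \<nu> \<tau> w j) summable_on UNIV"
proof -
  have "(\<lambda>j::int. ee (\<tau> * of_real (of_int (2 * m + 1) / 2) * of_int j ^ 2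
        + of_int j * (1 / 2 + \<tau> * (of_int \<nu> + 1 / 2) + of_int (2 * m + 1) * w)
        + (\<tau> * ((of_int \<nu> + 1 / 2)\<^sup>2 / (2 * of_int (2 * m + 1))) + (of_int \<nu> + 1 / 2) * w))) summable_on UNIV"
    using assms by (intro summable_on_ee_gauss) auto
  then show ?thesis
    by (rule summable_on_cong[THEN iffD1, rotated]) (simp add: quadE_def algebra_simps)
qed

text \<open>In the coordinates i = r - rho and t = j0 - j the quadratic form is i^2 / 2 + (2 m + 1)
  t^2 / 2 + (2 m + 1) i t, whose cross coefficient has the sign required by
  \<open>summable_on_qsign_gauss\<close>.\<close>

lemma summable_on_qsign_psi_term:
  assumes "Im \<tau> > 0" "m \<ge> 0"
  shows "(\<lambda>(j, r). qsign (r - \<rho>) (j0 - j) * psi_term m \<nu> \<tau> N j r) summable_on UNIV"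
proof -
  define x0 :: complex where "x0 = of_int (j0 - \<rho>)"
  define M :: complex where "M = of_int (2 * m + 1)"
  define d where "d = 1 / 2 + \<tau> * (- M * x0 - (of_int \<nu> + 1 / 2) - 2 * of_int m * of_int \<rho> + of_int N)"
  define e where "e = - 1 / 2 + \<tau> * (- M * x0 - (of_int \<nu> + 1 / 2))"
  define f where "f = of_int (j0 + \<rho>) / 2 + \<tau> * (quadE m \<nu> x0 - of_int m * (of_int \<rho>)\<^sup>2 + of_int \<rho> * of_int N)"
  have "(\<lambda>(i, t). qsign i t * ee (\<tau> * (of_real (1 / 2) * of_int i ^ 2 + of_real (of_int (2 * m + 1) / 2) * of_int t ^ 2
           + of_real (of_int (2 * m + 1)) * of_int i * of_int t) + of_int i * d + of_int t * e + f)) summable_on UNIV"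
    using assms by (intro summable_on_qsign_gauss) auto
  also have "?this \<longleftrightarrow> (\<lambda>(i, t). qsign i t * psi_term m \<nu> \<tau> N (j0 - t) (i + \<rho>)) summable_on UNIV"
  proof (intro summable_on_cong, clarify)
    fix i t :: int
    obtain \<kappa> where \<kappa>: "\<And>x. quadE m \<nu> x = (of_int m + 1 / 2) * x\<^sup>2 + x * (of_int \<nu> + 1 / 2) + \<kappa>"
      using quadE_form by blast
    have "\<tau> * (of_real (1 / 2) * of_int i ^ 2 + of_real (of_int (2 * m + 1) / 2) * of_int t ^ 2
           + of_real (of_int (2 * m + 1)) * of_int i * of_int t) + of_int i * d + of_int t * e + f
        = of_int ((j0 - t) + (i + \<rho>)) / 2 + \<tau> * (quadE m \<nu> (of_int ((j0 - t) - (i + \<rho>)))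
            - of_int m * (of_int (i + \<rho>))\<^sup>2 + of_int (i + \<rho>) * of_int N)"
      unfolding d_def e_def f_def M_def \<kappa> x0_def
      by (simp add: power2_eq_square field_simps)
    then show "qsign i t * ee (\<tau> * (of_real (1 / 2) * of_int i ^ 2 + of_real (of_int (2 * m + 1) / 2) * of_int t ^ 2
           + of_real (of_int (2 * m + 1)) * of_int i * of_int t) + of_int i * d + of_int t * e + f)
        = qsign i t * psi_term m \<nu> \<tau> N (j0 - t) (i + \<rho>)"
      by (simp only: psi_term_def)
  qed
  also have "\<dots> \<longleftrightarrow> ?thesis"
    by (rule summable_on_reindex_bij_witness[where i = "\<lambda>(j, r). (r - \<rho>, j0 - j)" and j = "\<lambda>(i, t). (j0 - t, i + \<rho>)"])
      auto
  finally show ?thesis .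
qed

lemma psi_term_alt:
  "psi_term m \<nu> \<tau> N j r = ee (of_int (j + r) / 2 + \<tau> * (quadE m \<nu> (of_int j)
     + of_int r * (of_int r + 1) / 2 + of_int r * of_int (N - \<nu> - 1 - (2 * m + 1) * j)))"
proof -
  obtain \<kappa> where \<kappa>: "\<And>x. quadE m \<nu> x = (of_int m + 1 / 2) * x\<^sup>2 + x * (of_int \<nu> + 1 / 2) + \<kappa>"
    using quadE_form by blast
  have "quadE m \<nu> (of_int (j - r)) - of_int m * (of_int r)\<^sup>2 + of_int r * of_int N
      = quadE m \<nu> (of_int j) + of_int r * (of_int r + 1) / 2 + of_int r * of_int (N - \<nu> - 1 - (2 * m + 1) * j)"
    unfolding \<kappa> by (simp add: power2_eq_square field_simps)
  then show ?thesis by (simp only: psi_term_def)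
qed

lemma summable_on_psi_term_r:
  assumes "Im \<tau> > 0"
  shows "(\<lambda>r. psi_term m \<nu> \<tau> N j r) summable_on UNIV"
proof -
  have "(\<lambda>r::int. ee (\<tau> * of_real (1 / 2) * of_int r ^ 2
        + of_int r * (1 / 2 + \<tau> * (1 / 2 + of_int (N - \<nu> - 1 - (2 * m + 1) * j)))
        + (of_int j / 2 + \<tau> * quadE m \<nu> (of_int j)))) summable_on UNIV"
    using assms by (intro summable_on_ee_gauss) auto
  then show ?thesis
    by (rule summable_on_cong[THEN iffD1, rotated]) (simp add: psi_term_alt power2_eq_square field_simps)
qed

text \<open>With s = N - nu - 1 - (2 m + 1) j, the exponent r (r + 1) / 2 + r s is symmetric about
  -1/2 - s, and the reflection changes the parity of r, hence the sign.\<close>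

lemma psi_term_reflect:
  "psi_term m \<nu> \<tau> N j (- 1 - 2 * (N - \<nu> - 1 - (2 * m + 1) * j) - r) = - psi_term m \<nu> \<tau> N j r"
proof -
  define s where "s = N - \<nu> - 1 - (2 * m + 1) * j"
  have "ee (of_int (j + (- 1 - 2 * s - r)) / 2 + \<tau> * (quadE m \<nu> (of_int j)
     + of_int (- 1 - 2 * s - r) * (of_int (- 1 - 2 * s - r) + 1) / 2 + of_int (- 1 - 2 * s - r) * of_int s))
    = ee (1 / 2 + (of_int (j + r) / 2 + \<tau> * (quadE m \<nu> (of_int j)
     + of_int r * (of_int r + 1) / 2 + of_int r * of_int s)))"
    by (rule ee_cong[where k = "- 1 - s - r"]) (simp add: field_simps)
  then show ?thesis
    unfolding psi_term_alt s_def[symmetric] by (simp only: ee_add ee_half) simp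
qed

lemma infsum_psi_term_r: "(\<Sum>\<^sub>\<infinity>r. psi_term m \<nu> \<tau> N j r) = 0"
proof -
  let ?h = "\<lambda>r. - 1 - 2 * (N - \<nu> - 1 - (2 * m + 1) * j) - r"
  have "(\<Sum>\<^sub>\<infinity>r. psi_term m \<nu> \<tau> N j r) = (\<Sum>\<^sub>\<infinity>r. - psi_term m \<nu> \<tau> N j r)"
    by (rule infsum_reindex_bij_witness[where i = ?h and j = ?h])
      (simp only: psi_term_reflect minus_minus | simp)+
  then show ?thesis by (simp add: infsum_uminus)
qed

lemma infsum_diff:
  fixes f g :: "'a \<Rightarrow> complex"
  assumes "f summable_on A" "g summable_on A"
  shows "(\<Sum>\<^sub>\<infinity>x\<in>A. f x - g x) = infsum f A - infsum g A"
  using infsum_add[OF assms(1) summable_on_uminus[THEN iffD2, OF assms(2)]]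
  by (simp add: infsum_uminus)

definition psi_half :: "int \<Rightarrow> int \<Rightarrow> complex \<Rightarrow> int \<Rightarrow> int \<Rightarrow> int \<Rightarrow> complex" where
  "psi_half m \<nu> \<tau> \<rho> N j = (\<Sum>\<^sub>\<infinity>r. if r \<ge> \<rho> then psi_term m \<nu> \<tau> N j r else 0)"

lemma summable_on_if:
  fixes f :: "'a \<Rightarrow> complex"
  assumes "f summable_on UNIV"
  shows "(\<lambda>r. if P r then f r else 0) summable_on UNIV"
proof -
  have "f summable_on {r. P r}" using assms by (rule summable_on_subset_banach) auto
  also have "?this \<longleftrightarrow> ?thesis" by (intro summable_on_cong_neutral) auto
  finally show ?thesis .
qed

text \<open>Since a full row sums to zero, a half row may be summed over either half; hence the cut \<open>j0\<close>
  does not influence \<^term>\<open>psi_coeff m \<nu> \<tau> \<rho> j0 N\<close>.\<close>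

lemma infsum_qsign_psi_term_r:
  assumes "Im \<tau> > 0"
  shows "(\<Sum>\<^sub>\<infinity>r. qsign (r - \<rho>) (j0 - j) * psi_term m \<nu> \<tau> N j r) = psi_half m \<nu> \<tau> \<rho> N j"
proof (cases "j0 - j \<ge> 0")
  case True
  then show ?thesis unfolding psi_half_def by (intro infsum_cong) (auto simp: qsign_def)
next
  case False
  have "(\<Sum>\<^sub>\<infinity>r. qsign (r - \<rho>) (j0 - j) * psi_term m \<nu> \<tau> N j r)
     = (\<Sum>\<^sub>\<infinity>r. (if r \<ge> \<rho> then psi_term m \<nu> \<tau> N j r else 0) - psi_term m \<nu> \<tau> N j r)"
    using False by (intro infsum_cong) (auto simp: qsign_def)
  also have "\<dots> = psi_half m \<nu> \<tau> \<rho> N j - (\<Sum>\<^sub>\<infinity>r. psi_term m \<nu> \<tau> N j r)"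
    unfolding psi_half_def using assms by (intro infsum_diff summable_on_if summable_on_psi_term_r)
  finally show ?thesis by (simp add: infsum_psi_term_r)
qed

lemma
  assumes "Im \<tau> > 0" "m \<ge> 0"
  shows psi_coeff_eq_psi_half: "psi_coeff m \<nu> \<tau> \<rho> j0 N = (\<Sum>\<^sub>\<infinity>j. psi_half m \<nu> \<tau> \<rho> N j)"
    and summable_on_psi_half: "(\<lambda>j. psi_half m \<nu> \<tau> \<rho> N j) summable_on UNIV"
proof -
  have s: "(\<lambda>(j, r). qsign (r - \<rho>) (j0 - j) * psi_term m \<nu> \<tau> N j r) summable_on Sigma UNIV (\<lambda>_. UNIV)" for j0
    using summable_on_qsign_psi_term[OF assms] by simp
  show "psi_coeff m \<nu> \<tau> \<rho> j0 N = (\<Sum>\<^sub>\<infinity>j. psi_half m \<nu> \<tau> \<rho> N j)"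
    using infsum_Sigma'_banach[OF s[of j0]] unfolding psi_coeff_def infsum_qsign_psi_term_r[OF assms(1)] by simp
  show "(\<lambda>j. psi_half m \<nu> \<tau> \<rho> N j) summable_on UNIV"
    using summable_on_Sigma_banach[OF s[of 0]] unfolding infsum_qsign_psi_term_r[OF assms(1)] by simp
qed

lemma infsum_sum_finite:
  fixes f :: "'a \<Rightarrow> 'b \<Rightarrow> complex"
  assumes "finite A" "\<And>a. a \<in> A \<Longrightarrow> f a summable_on B"
  shows "(\<Sum>\<^sub>\<infinity>b\<in>B. \<Sum>a\<in>A. f a b) = (\<Sum>a\<in>A. \<Sum>\<^sub>\<infinity>b\<in>B. f a b)"
    and "(\<lambda>b. \<Sum>a\<in>A. f a b) summable_on B"
proof -
  have "((\<lambda>b. \<Sum>a\<in>A. f a b) has_sum (\<Sum>a\<in>A. \<Sum>\<^sub>\<infinity>b\<in>B. f a b)) B"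
    using assms
  proof (induction A rule: finite_induct)
    case (insert a A)
    then have "((\<lambda>b. f a b + (\<Sum>a\<in>A. f a b)) has_sum (infsum (f a) B + (\<Sum>a\<in>A. \<Sum>\<^sub>\<infinity>b\<in>B. f a b))) B"
      by (intro has_sum_add has_sum_infsum) simp_all
    with insert.hyps show ?case by simp
  qed simp
  then show "(\<Sum>\<^sub>\<infinity>b\<in>B. \<Sum>a\<in>A. f a b) = (\<Sum>a\<in>A. \<Sum>\<^sub>\<infinity>b\<in>B. f a b)"
    and "(\<lambda>b. \<Sum>a\<in>A. f a b) summable_on B"
    by (auto simp: has_sum_iff)
qed

abbreviation row_term :: "int \<Rightarrow> complex \<Rightarrow> int \<Rightarrow> int \<Rightarrow> complex" where
  "row_term m \<tau> N i \<equiv> ee (\<tau> * (of_int i * of_int N - of_int m * (of_int i)\<^sup>2))"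

text \<open>Apart from a monomial in q the summand depends on j - r only, since j + r and j - r have
  the same parity; shifting j by r leaves the null value of theta.\<close>

lemma
  assumes "Im \<tau> > 0" "m \<ge> 0"
  shows infsum_psi_term_j: "(\<Sum>\<^sub>\<infinity>j. psi_term m \<nu> \<tau> N j r)
       = row_term m \<tau> N r * vth m \<nu> \<tau> 0"
    and summable_on_psi_term_j: "(\<lambda>j. psi_term m \<nu> \<tau> N j r) summable_on UNIV"
proof -
  let ?f = "\<lambda>j::int. vth_term m \<nu> \<tau> 0 j"
  let ?c = "row_term m \<tau> N r"
  have eq: "?c * ?f (j - r) = psi_term m \<nu> \<tau> N j r" for j
    unfolding psi_term_def ee_add[symmetric]
    by (rule ee_cong[where k = "- r"]) (simp add: field_simps)
  have "(?f has_sum vth m \<nu> \<tau> 0) UNIV"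
    unfolding vth_def using assms by (intro has_sum_infsum summable_on_vth)
  then have "((\<lambda>j. ?c * ?f j) has_sum (?c * vth m \<nu> \<tau> 0)) UNIV"
    by (rule has_sum_cmult_right)
  also have "?this \<longleftrightarrow> ((\<lambda>j. psi_term m \<nu> \<tau> N j r) has_sum (?c * vth m \<nu> \<tau> 0)) UNIV"
    by (rule has_sum_reindex_bij_witness[where i = "\<lambda>j. j - r" and j = "\<lambda>j. j + r"]) (auto simp: eq[symmetric])
  finally show "(\<Sum>\<^sub>\<infinity>j. psi_term m \<nu> \<tau> N j r) = ?c * vth m \<nu> \<tau> 0" "(\<lambda>j. psi_term m \<nu> \<tau> N j r) summable_on UNIV"
    by (auto simp: has_sum_iff)
qed

text \<open>The indicator of r >= 0 minus the indicator of r >= rho.\<close>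

definition isign :: "int \<Rightarrow> int \<Rightarrow> complex" where
  "isign \<rho> r = (if 0 \<le> r \<and> r < \<rho> then 1 else if \<rho> \<le> r \<and> r < 0 then - 1 else 0)"

text \<open>Each r between the two cuts contributes a complete sum over j, while \<open>j0\<close>
  and \<open>j1\<close> leave no trace. For a suitable \<open>\<rho>\<close> the finite sum on the
  right is a Fourier coefficient of \<open>h_fun\<close>.\<close>

lemma psi_coeff_diff:
  assumes "Im \<tau> > 0" "m \<ge> 0"
  shows "psi_coeff m \<nu> \<tau> 0 j0 N - psi_coeff m \<nu> \<tau> \<rho> j1 N
     = vth m \<nu> \<tau> 0 * (\<Sum>r\<in>{min 0 \<rho>..<max 0 \<rho>}. isign \<rho> r * row_term m \<tau> N r)"
proof -
  let ?R = "{min 0 \<rho>..<max 0 \<rho>}"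
  have "psi_half m \<nu> \<tau> 0 N j - psi_half m \<nu> \<tau> \<rho> N j = (\<Sum>r\<in>?R. isign \<rho> r * psi_term m \<nu> \<tau> N j r)" for j
  proof -
    have "psi_half m \<nu> \<tau> 0 N j - psi_half m \<nu> \<tau> \<rho> N j
        = (\<Sum>\<^sub>\<infinity>r. (if r \<ge> 0 then psi_term m \<nu> \<tau> N j r else 0) - (if r \<ge> \<rho> then psi_term m \<nu> \<tau> N j r else 0))"
      unfolding psi_half_def using assms
      by (intro infsum_diff[symmetric] summable_on_if summable_on_psi_term_r)
    also have "\<dots> = (\<Sum>\<^sub>\<infinity>r\<in>?R. isign \<rho> r * psi_term m \<nu> \<tau> N j r)"
      by (intro infsum_cong_neutral) (auto simp: isign_def)
    finally show ?thesis by simp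
  qed
  note diff = this
  have "psi_coeff m \<nu> \<tau> 0 j0 N - psi_coeff m \<nu> \<tau> \<rho> j1 N
      = (\<Sum>\<^sub>\<infinity>j. psi_half m \<nu> \<tau> 0 N j - psi_half m \<nu> \<tau> \<rho> N j)"
    unfolding psi_coeff_eq_psi_half[OF assms] by (rule infsum_diff[symmetric]) (rule summable_on_psi_half[OF assms])+
  also have "\<dots> = (\<Sum>\<^sub>\<infinity>j. \<Sum>r\<in>?R. isign \<rho> r * psi_term m \<nu> \<tau> N j r)"
    unfolding diff ..
  also have "\<dots> = (\<Sum>r\<in>?R. \<Sum>\<^sub>\<infinity>j. isign \<rho> r * psi_term m \<nu> \<tau> N j r)"
    by (rule infsum_sum_finite) (simp, intro summable_on_cmult_right summable_on_psi_term_j assms)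
  also have "\<dots> = (\<Sum>r\<in>?R. isign \<rho> r * (row_term m \<tau> N r * vth m \<nu> \<tau> 0))"
    by (simp only: infsum_cmult_right' infsum_psi_term_j[OF assms])
  finally show ?thesis
    by (simp only: sum_distrib_left mult.assoc mult.commute mult.left_commute)
qed

section \<open>The Jacobi theta function\<close>


abbreviation jtheta_term :: "complex \<Rightarrow> complex \<Rightarrow> int \<Rightarrow> complex" where
  "jtheta_term \<tau> u k \<equiv> ee (\<tau> * of_int k ^ 2 / 2 + of_int k * u)"

definition jtheta :: "complex \<Rightarrow> complex \<Rightarrow> complex" where
  "jtheta \<tau> u = (\<Sum>\<^sub>\<infinity>k::int. jtheta_term \<tau> u k)"

lemma summable_on_jtheta:
  assumes "Im \<tau> > 0"
  shows "(\<lambda>k::int. jtheta_term \<tau> u k) summable_on UNIV"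
proof -
  have "(\<lambda>k::int. ee (\<tau> * of_real (1 / 2) * of_int k ^ 2 + of_int k * u + 0)) summable_on UNIV"
    using assms by (intro summable_on_ee_gauss) auto
  then show ?thesis by simp
qed

lemma norm_ee_jtheta:
  "norm (jtheta_term \<tau> u k) = exp (- pi * (Im \<tau> * of_int k ^ 2 + 2 * of_int k * Im u))"
  by (simp add: norm_ee power2_eq_square algebra_simps)

definition band :: "real \<Rightarrow> complex set" where
  "band R = {w. \<bar>Im w\<bar> < R}"

lemma mem_band [simp]: "w \<in> band R \<longleftrightarrow> \<bar>Im w\<bar> < R"
  by (simp add: band_def)

lemma open_band: "open (band R)"
proof -
  have "band R = {u. Im u < R} \<inter> {u. Im u > - R}" by auto
  then show ?thesis
    by (simp add: open_Int open_halfspace_Im_lt open_halfspace_Im_gt)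
qed

lemma connected_band: "connected (band R)"
proof -
  have "band R = {u. Im u < R} \<inter> {u. Im u > - R}" by auto
  then show ?thesis
    by (simp add: convex_connected convex_Int convex_halfspace_Im_lt convex_halfspace_Im_gt)
qed

text \<open>For fixed x the modulus is monotone in Im z, so one end of the band dominates. Adding
  both ends gives a bound that depends neither on z nor on the sign of x.\<close>

lemma norm_ee_le_sum:
  assumes "\<bar>Im z\<bar> \<le> R"
  shows "norm (ee (u + of_int x * z)) \<le> norm (ee (u + of_int x * (\<i> * of_real R))) + norm (ee (u + of_int x * (- (\<i> * of_real R))))"
proof -
  have le: "\<bar>of_int x * Im z\<bar> \<le> \<bar>of_int x\<bar> * R"
    unfolding abs_mult using assms by (intro mult_left_mono) auto
  have "- (of_int x * Im z) \<le> of_int x * R \<or> - (of_int x * Im z) \<le> - (of_int x * R)"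
  proof (cases "x \<ge> 0")
    case True
    then have "\<bar>of_int x\<bar> * R = of_int x * R" by simp
    with le show ?thesis by linarith
  next
    case False
    then have "\<bar>of_int x\<bar> * R = - (of_int x * R)" by simp
    with le show ?thesis by linarith
  qed
  then have "exp (2 * pi * (- (of_int x * Im z))) \<le> exp (2 * pi * - (of_int x * R)) + exp (2 * pi * (of_int x * R))"
  proof
    assume "- (of_int x * Im z) \<le> of_int x * R"
    then have "exp (2 * pi * (- (of_int x * Im z))) \<le> exp (2 * pi * (of_int x * R))"
      unfolding exp_le_cancel_iff by (intro mult_left_mono) auto
    then show ?thesis by (simp only: add_increasing exp_ge_zero)
  next
    assume "- (of_int x * Im z) \<le> - (of_int x * R)"
    then have "exp (2 * pi * (- (of_int x * Im z))) \<le> exp (2 * pi * - (of_int x * R))"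
      unfolding exp_le_cancel_iff by (intro mult_left_mono) auto
    then show ?thesis by (simp only: add_increasing2 exp_ge_zero)
  qed
  moreover have "norm (ee (of_int x * z)) = exp (2 * pi * (- (of_int x * Im z)))"
    "norm (ee (of_int x * (\<i> * of_real R))) = exp (2 * pi * - (of_int x * R))"
    "norm (ee (of_int x * (- (\<i> * of_real R)))) = exp (2 * pi * (of_int x * R))"
    by (simp_all add: norm_ee)
  ultimately have "norm (ee (of_int x * z)) \<le> norm (ee (of_int x * (\<i> * of_real R))) + norm (ee (of_int x * (- (\<i> * of_real R))))"
    by (simp only:)
  then have "norm (ee u) * norm (ee (of_int x * z)) \<le> norm (ee u) * (norm (ee (of_int x * (\<i> * of_real R))) + norm (ee (of_int x * (- (\<i> * of_real R)))))"
    by (rule mult_left_mono) simp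
  then show ?thesis unfolding ee_add norm_mult distrib_left .
qed

lemma holomorphic_jtheta:
  assumes "Im \<tau> > 0"
  shows "(\<lambda>u. jtheta \<tau> u) holomorphic_on UNIV"
proof -
  have "(\<lambda>u. jtheta \<tau> u) holomorphic_on band R" for R
    unfolding jtheta_def
  proof (rule holomorphic_on_infsum[OF open_band])
    show "(\<lambda>u. jtheta_term \<tau> u k) holomorphic_on band R" for k
      by (intro holomorphic_intros)
    show "(\<lambda>k::int. norm (jtheta_term \<tau> (\<i> * of_real R) k)
            + norm (jtheta_term \<tau> (- (\<i> * of_real R)) k)) summable_on UNIV"
      using assms by (intro summable_on_add summable_on_norm_complex summable_on_jtheta)
  qed (rule norm_ee_le_sum, simp)
  then have "(\<lambda>u. jtheta \<tau> u) holomorphic_on (\<Union>n::nat. band (real n))"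
    by (intro holomorphic_on_UN_open open_band)
  also have "(\<Union>n::nat. band (real n)) = UNIV"
    using reals_Archimedean2 by auto
  finally show ?thesis .
qed

lemma holomorphic_jtheta_tau: "(\<lambda>\<tau>. jtheta \<tau> u) holomorphic_on {\<tau>. Im \<tau> > 0}"
proof -
  have "(\<lambda>\<tau>. jtheta \<tau> u) holomorphic_on {\<tau>. Im \<tau> > \<epsilon>}" if \<epsilon>: "\<epsilon> > 0" for \<epsilon>
    unfolding jtheta_def
  proof (rule holomorphic_on_infsum)
    show "open {\<tau>. Im \<tau> > \<epsilon>}" by (rule open_halfspace_Im_gt)
    show "(\<lambda>\<tau>. jtheta_term \<tau> u k) holomorphic_on {\<tau>. Im \<tau> > \<epsilon>}" for k
      by (intro holomorphic_intros) auto
    show "(\<lambda>k::int. norm (ee (\<i> * of_real \<epsilon> * of_int k ^ 2 / 2 + of_int k * u))) summable_on UNIV"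
      using \<epsilon> by (intro summable_on_norm_complex summable_on_jtheta) simp
    fix k :: int and \<tau> assume "\<tau> \<in> {\<tau>. Im \<tau> > \<epsilon>}"
    then have "\<epsilon> * (of_int k)\<^sup>2 \<le> Im \<tau> * (of_int k)\<^sup>2" by (intro mult_right_mono) auto
    then show "norm (jtheta_term \<tau> u k) \<le> norm (ee (\<i> * of_real \<epsilon> * of_int k ^ 2 / 2 + of_int k * u))"
      unfolding norm_ee_jtheta by (simp add: mult_left_mono)
  qed
  then have "(\<lambda>\<tau>. jtheta \<tau> u) holomorphic_on (\<Union>\<epsilon>\<in>{0<..}. {\<tau>. Im \<tau> > \<epsilon>})"
    by (intro holomorphic_on_UN_open) (auto simp: open_halfspace_Im_gt)
  also have "(\<Union>\<epsilon>\<in>{0<..}. {\<tau>. Im \<tau> > \<epsilon>}) = {\<tau>. Im \<tau> > 0}"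
  proof safe
    fix \<tau> :: complex assume "Im \<tau> > 0"
    then have "Im \<tau> / 2 > 0" "Im \<tau> > Im \<tau> / 2" by simp_all
    then show "\<tau> \<in> (\<Union>\<epsilon>\<in>{0<..}. {\<tau>. Im \<tau> > \<epsilon>})" by blast
  qed auto
  finally show ?thesis .
qed

lemma jtheta_plus_1: "jtheta \<tau> (u + 1) = jtheta \<tau> u"
  unfolding jtheta_def by (intro infsum_cong ee_cong[where k = k for k]) (simp add: algebra_simps)

lemma jtheta_minus: "jtheta \<tau> (- u) = jtheta \<tau> u"
  unfolding jtheta_def by (rule infsum_reindex_bij_witness[where i = uminus and j = uminus]) auto

lemma jtheta_plus_tau: "jtheta \<tau> (u + \<tau>) = ee (- \<tau> / 2 - u) * jtheta \<tau> u"
  unfolding jtheta_def infsum_cmult_right'[symmetric] ee_add[symmetric]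
  by (rule infsum_reindex_bij_witness[where i = "\<lambda>k. k - 1" and j = "\<lambda>k. k + 1"])
    (auto simp: power2_eq_square field_simps intro!: arg_cong[of _ _ ee])

text \<open>Evenness followed by the translations by tau and 1 returns to the same point with
  multiplier e(1/2) = -1.\<close>

lemma jtheta_zero: "jtheta \<tau> ((1 + \<tau>) / 2) = 0"
proof -
  have "jtheta \<tau> ((1 + \<tau>) / 2) = jtheta \<tau> ((- ((1 + \<tau>) / 2) + \<tau>) + 1)" by (simp add: field_simps)
  also have "\<dots> = ee (- \<tau> / 2 + (1 + \<tau>) / 2) * jtheta \<tau> ((1 + \<tau>) / 2)"
    unfolding jtheta_plus_1 jtheta_plus_tau jtheta_minus by simp
  also have "- \<tau> / 2 + (1 + \<tau>) / 2 = 1 / 2" by (simp add: field_simps)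
  finally show ?thesis by (simp add: ee_half)
qed

section \<open>Distribution relation over torsion points, and nonvanishing of theta\<close>

lemma sum_ee_roots:
  assumes "N > 0"
  shows "(\<Sum>i\<in>{0..<N}. ee (of_int k * (of_int i / of_int N))) = (if N dvd k then of_int N else 0)"
proof -
  define x where "x = ee (of_int k / of_int N)"
  have x: "x ^ nat N = 1"
    using assms ee_power_int[of N "of_int k / of_int N"] by (simp add: x_def power_int_def)
  have "(\<Sum>i\<in>{0..<N}. ee (of_int k * (of_int i / of_int N))) = (\<Sum>i\<in>{0..<N}. x powi i)"
    by (intro sum.cong) (auto simp: x_def ee_power_int[symmetric] mult.commute)
  also have "\<dots> = (\<Sum>i<nat N. x ^ i)"
    by (rule sum.reindex_bij_witness[where i = int and j = nat]) (auto simp: power_int_def)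
  also have "\<dots> = (if N dvd k then of_int N else 0)"
  proof (cases "N dvd k")
    case True
    then obtain l where "k = N * l" by (elim dvdE)
    then have "x = 1" using assms by (simp add: x_def)
    with True assms show ?thesis by simp
  next
    case False
    have "x \<noteq> 1"
    proof
      assume "x = 1"
      then obtain l :: int where "of_int k / of_int N = (of_int l :: complex)" unfolding x_def ee_eq_1_iff by blast
      then have "(of_int k :: complex) = of_int (l * N)" using assms by (simp add: field_simps)
      then have "k = l * N" by (simp only: of_int_eq_iff)
      with False show False by simp
    qed
    with False show ?thesis by (simp add: sum_gp_strict x)
  qed
  finally show ?thesis .
qed

lemma Im_square_times_pos:
  assumes "Im \<tau> > 0" "N > 0"
  shows "Im (of_int N ^ 2 * \<tau>) > 0"
  using assms by (simp add: power2_eq_square)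

text \<open>Summing over the points i / N keeps only the frequencies divisible by N, which replaces
  tau by N^2 tau.\<close>

lemma sum_jtheta:
  assumes \<tau>: "Im \<tau> > 0" and N: "N > 0"
  shows "(\<Sum>i\<in>{0..<N}. jtheta \<tau> (of_int i / of_int N)) = of_int N * jtheta (of_int N ^ 2 * \<tau>) 0"
proof -
  have "(\<Sum>i\<in>{0..<N}. jtheta \<tau> (of_int i / of_int N))
      = (\<Sum>\<^sub>\<infinity>k. \<Sum>i\<in>{0..<N}. ee (\<tau> * of_int k ^ 2 / 2 + of_int k * (of_int i / of_int N)))"
    unfolding jtheta_def by (rule infsum_sum_finite(1)[symmetric]) (simp, rule summable_on_jtheta[OF \<tau>])
  also have "\<dots> = (\<Sum>\<^sub>\<infinity>k. ee (\<tau> * of_int k ^ 2 / 2) * (if N dvd k then of_int N else 0))"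
    unfolding ee_add sum_distrib_left[symmetric] sum_ee_roots[OF N] ..
  also have "\<dots> = (\<Sum>\<^sub>\<infinity>k\<in>range (\<lambda>l. N * l). ee (\<tau> * of_int k ^ 2 / 2) * of_int N)"
    by (rule infsum_cong_neutral) auto
  also have "\<dots> = (\<Sum>\<^sub>\<infinity>l. ee (\<tau> * of_int (N * l) ^ 2 / 2) * of_int N)"
    using N by (subst infsum_reindex) (auto simp: inj_on_def o_def)
  also have "\<dots> = of_int N * jtheta (of_int N ^ 2 * \<tau>) 0"
    unfolding jtheta_def infsum_cmult_right'[symmetric] by (simp add: power_mult_distrib ac_simps)
  finally show ?thesis .
qed

text \<open>If theta vanished identically, \<open>sum_jtheta\<close> would give theta(N^2 tau, 0) =
  0 for every positive N, whereas this value tends to 1 as N grows.\<close>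

lemma jtheta_not_identically_0:
  assumes \<tau>: "Im \<tau> > 0"
  shows "\<exists>u. jtheta \<tau> u \<noteq> 0"
proof (rule ccontr)
  assume "\<not> ?thesis"
  then have 0: "jtheta \<tau> u = 0" for u by blast
  define c where "c = pi * Im \<tau>"
  have c: "c > 0" using \<tau> by (simp add: c_def)
  define S where "S = (\<Sum>\<^sub>\<infinity>k::int. norm (jtheta_term \<tau> 0 k))"
  \<comment> \<open>N is so large that S <= c (N^2 - 1). The tail estimate will give exp (c X) <= S
    with X = N^2 - 1, against 1 + x <= e^x.\<close>
  define N where "N = 1 + \<lceil>S / c\<rceil>"
  have "S \<ge> 0" unfolding S_def by (intro infsum_nonneg) simp
  then have "0 \<le> S / c" using c by simp
  then have N: "N \<ge> 1" unfolding N_def by linarith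
  define X where "X = real_of_int N ^ 2 - 1"
  have "S / c \<le> real_of_int N - 1" by (simp add: N_def)
  also have "\<dots> \<le> X" using N mult_mono[of 1 "real_of_int N" "real_of_int N" "real_of_int N"]
    by (simp add: X_def power2_eq_square)
  finally have SX: "S \<le> c * X" using c by (simp add: field_simps)
  have X0: "X \<ge> 0" using N by (simp add: X_def one_le_power)
  let ?\<sigma> = "of_int N ^ 2 * \<tau>"
  have Im_\<sigma>: "Im ?\<sigma> = of_int N ^ 2 * Im \<tau>" by (simp add: power2_eq_square)
  then have \<sigma>: "Im ?\<sigma> > 0" using N \<tau> by simp
  have "jtheta ?\<sigma> 0 = 0" using sum_jtheta[OF \<tau>, of N] N by (simp add: 0)
  moreover have "jtheta ?\<sigma> 0 = 1 + (\<Sum>\<^sub>\<infinity>k\<in>UNIV - {0::int}. jtheta_term ?\<sigma> 0 k)"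
    unfolding jtheta_def using infsum_insert[of "\<lambda>k::int. jtheta_term ?\<sigma> 0 k" "UNIV - {0}" 0]
      summable_on_subset_banach[OF summable_on_jtheta[OF \<sigma>, of 0], of "UNIV - {0}"]
    by (simp add: insert_UNIV)
  ultimately have "1 = norm (\<Sum>\<^sub>\<infinity>k\<in>UNIV - {0::int}. jtheta_term ?\<sigma> 0 k)"
    by (simp add: eq_neg_iff_add_eq_0[symmetric] add.commute[of 1])
  also have "\<dots> \<le> (\<Sum>\<^sub>\<infinity>k\<in>UNIV - {0::int}. norm (jtheta_term ?\<sigma> 0 k))"
    using summable_on_subset_banach[OF summable_on_jtheta[OF \<sigma>, of 0], of "UNIV - {0}"]
    by (intro norm_infsum_bound summable_on_norm_complex) auto
  also have "\<dots> \<le> (\<Sum>\<^sub>\<infinity>k\<in>UNIV. exp (- (c * X)) * norm (jtheta_term \<tau> 0 k))"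
  proof (rule infsum_mono_neutral)
    show "(\<lambda>k. norm (jtheta_term ?\<sigma> 0 k)) summable_on UNIV - {0::int}"
      using summable_on_subset_banach[OF summable_on_jtheta[OF \<sigma>, of 0], of "UNIV - {0}"]
      by (intro summable_on_norm_complex) auto
    show "(\<lambda>k::int. exp (- (c * X)) * norm (jtheta_term \<tau> 0 k)) summable_on UNIV"
      using summable_on_jtheta[OF \<tau>] by (intro summable_on_cmult_right summable_on_norm_complex)
    fix k :: int assume "k \<in> (UNIV - {0}) \<inter> UNIV"
    then have "real_of_int \<bar>k\<bar> \<ge> 1" by auto
    then have "1\<^sup>2 \<le> \<bar>real_of_int k\<bar>\<^sup>2" by (intro power_mono) auto
    then have "(real_of_int k)\<^sup>2 - 1 \<ge> 0" by simp
    \<comment> \<open>Equivalently N^2 k^2 >= (N^2 - 1) + k^2 for nonzero k: a factor exp (- c X)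
      splits off and the series at tau remains.\<close>
    then have "X * ((real_of_int k)\<^sup>2 - 1) \<ge> 0" using X0 by (intro mult_nonneg_nonneg)
    then have "c * (X + (real_of_int k)\<^sup>2) \<le> c * ((of_int N)\<^sup>2 * (real_of_int k)\<^sup>2)"
      using c unfolding X_def by (intro mult_left_mono) (auto simp: algebra_simps)
    then show "norm (jtheta_term ?\<sigma> 0 k) \<le> exp (- (c * X)) * norm (jtheta_term \<tau> 0 k)"
      unfolding norm_ee_jtheta Im_\<sigma> exp_add[symmetric] exp_le_cancel_iff by (simp add: c_def algebra_simps)
  qed auto
  also have "\<dots> = exp (- (c * X)) * S"
    unfolding S_def by (rule infsum_cmult_right')
  finally have "exp (c * X) \<le> S" by (simp add: exp_minus field_simps)
  moreover have "1 + c * X \<le> exp (c * X)" by (rule exp_ge_add_one_self)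
  ultimately show False using SX by linarith
qed

section \<open>The Appell sum and its Fourier expansion\<close>


lemma vth_eq_jtheta:
  "vth m \<nu> \<tau> w = ee (\<tau> * ((of_int \<nu> + 1 / 2)\<^sup>2 / (2 * of_int (2 * m + 1))) + (of_int \<nu> + 1 / 2) * w)
     * jtheta (of_int (2 * m + 1) * \<tau>) (of_int (2 * m + 1) * w + (of_int \<nu> + 1 / 2) * \<tau> + 1 / 2)"
proof -
  define \<kappa> :: complex where "\<kappa> = (of_int \<nu> + 1 / 2)\<^sup>2 / (2 * of_int (2 * m + 1))"
  show ?thesis
    unfolding vth_def jtheta_def infsum_cmult_right'[symmetric] ee_add[symmetric] quadE_def \<kappa>_def[symmetric]
    by (intro infsum_cong arg_cong[of _ _ ee]) (simp add: field_simps)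
qed

lemma holomorphic_vth [holomorphic_intros]:
  assumes "Im \<tau> > 0" "m \<ge> 0" "f holomorphic_on S"
  shows "(\<lambda>z. vth m \<nu> \<tau> (f z)) holomorphic_on S"
proof -
  have "Im (of_int (2 * m + 1) * \<tau>) = of_int (2 * m + 1) * Im \<tau>" by simp
  also have "\<dots> > 0" using assms by (intro mult_pos_pos) auto
  finally have "jtheta (of_int (2 * m + 1) * \<tau>) holomorphic_on UNIV"
    by (rule holomorphic_jtheta)
  then have "jtheta (of_int (2 * m + 1) * \<tau>) \<circ> (\<lambda>w. of_int (2 * m + 1) * w + (of_int \<nu> + 1 / 2) * \<tau> + 1 / 2) holomorphic_on UNIV"
    by (intro holomorphic_on_compose holomorphic_intros) (auto intro: holomorphic_on_subset)
  then have "(\<lambda>w. vth m \<nu> \<tau> w) holomorphic_on UNIV"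
    unfolding vth_eq_jtheta o_def by (intro holomorphic_intros)
  then have "(\<lambda>w. vth m \<nu> \<tau> w) \<circ> f holomorphic_on S"
    using assms(3) by (intro holomorphic_on_compose) (auto intro: holomorphic_on_subset)
  then show ?thesis by (simp add: o_def)
qed

lemma holomorphic_vth_0_0: "Im \<tau> > 0 \<Longrightarrow> vth 0 0 \<tau> holomorphic_on S"
  by (intro holomorphic_vth[where f = "\<lambda>x. x"] holomorphic_on_ident) auto

lemma vth_plus_1: "vth m \<nu> \<tau> (w + 1) = - vth m \<nu> \<tau> w"
proof -
  have "ee (of_int j / 2 + \<tau> * quadE m \<nu> (of_int j) + (of_int ((2 * m + 1) * j + \<nu>) + 1 / 2) * (w + 1))
     = ee (1 / 2) * vth_term m \<nu> \<tau> w j" for j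
    unfolding ee_add[symmetric]
    by (rule ee_cong[where k = "(2 * m + 1) * j + \<nu>"]) (simp add: algebra_simps)
  then show ?thesis
    unfolding vth_def by (simp only: infsum_cmult_right' ee_half) simp
qed

lemma vth_plus_tau:
  "vth m \<nu> \<tau> (w + \<tau>) = - (ee (- of_int (2 * m + 1) * (\<tau> / 2 + w)) * vth m \<nu> \<tau> w)"
proof -
  obtain \<kappa> where \<kappa>: "\<And>x. quadE m \<nu> x = (of_int m + 1 / 2) * x\<^sup>2 + x * (of_int \<nu> + 1 / 2) + \<kappa>"
    using quadE_form by blast
  let ?c = "1 / 2 - of_int (2 * m + 1) * (\<tau> / 2 + w)"
  have "vth m \<nu> \<tau> (w + \<tau>) = ee ?c * vth m \<nu> \<tau> w"
    unfolding vth_def infsum_cmult_right'[symmetric] ee_add[symmetric]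
  proof (rule infsum_reindex_bij_witness[where i = "\<lambda>j. j - 1" and j = "\<lambda>j. j + 1"])
    fix j :: int
    show "ee (?c + (of_int (j + 1) / 2 + \<tau> * quadE m \<nu> (of_int (j + 1)) + (of_int ((2 * m + 1) * (j + 1) + \<nu>) + 1 / 2) * w))
      = ee (of_int j / 2 + \<tau> * quadE m \<nu> (of_int j) + (of_int ((2 * m + 1) * j + \<nu>) + 1 / 2) * (w + \<tau>))"
      unfolding \<kappa> by (rule ee_cong[where k = 1]) (simp add: power2_eq_square field_simps)
  qed auto
  also have "ee ?c = ee (1 / 2) * ee (- of_int (2 * m + 1) * (\<tau> / 2 + w))"
    unfolding ee_add[symmetric] by (simp add: algebra_simps)
  finally show ?thesis by (simp add: ee_half)
qed

lemma vth_0_0_at_0: "vth 0 0 \<tau> 0 = 0"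
proof -
  have "vth 0 0 \<tau> 0 = ee (1 / 2) * vth 0 0 \<tau> 0"
    unfolding vth_def infsum_cmult_right'[symmetric] ee_add[symmetric]
  proof (rule infsum_reindex_bij_witness[where i = "\<lambda>j. - 1 - j" and j = "\<lambda>j. - 1 - j"])
    fix j :: int
    show "ee (1 / 2 + (of_int (- 1 - j) / 2 + \<tau> * quadE 0 0 (of_int (- 1 - j)) + (of_int ((2 * 0 + 1) * (- 1 - j) + 0) + 1 / 2) * 0))
      = ee (of_int j / 2 + \<tau> * quadE 0 0 (of_int j) + (of_int ((2 * 0 + 1) * j + 0) + 1 / 2) * 0)"
      unfolding quadE_def by (rule ee_cong[where k = "- j"]) (simp add: power2_eq_square field_simps)
  qed auto
  then show ?thesis by (simp add: ee_half)
qed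

abbreviation appell_coeff :: "complex \<Rightarrow> complex \<Rightarrow> int \<Rightarrow> complex" where
  "appell_coeff \<tau> w r \<equiv> ee (of_int r / 2 + \<tau> * (of_int r * (of_int r + 1) / 2) + w / 2)"

definition appell :: "complex \<Rightarrow> complex \<Rightarrow> complex" where
  "appell \<tau> w = (\<Sum>\<^sub>\<infinity>r::int. appell_coeff \<tau> w r / (1 - ee (w + of_int r * \<tau>)))"

lemma summable_on_appell_coeff:
  assumes "Im \<tau> > 0"
  shows "(\<lambda>r::int. appell_coeff \<tau> w r) summable_on UNIV"
proof -
  have "(\<lambda>r::int. ee (\<tau> * of_real (1 / 2) * of_int r ^ 2 + of_int r * (1 / 2 + \<tau> / 2) + w / 2)) summable_on UNIV"
    using assms by (intro summable_on_ee_gauss) auto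
  then show ?thesis
    by (rule summable_on_cong[THEN iffD1, rotated])
      (rule arg_cong[of _ _ ee], simp add: power2_eq_square field_simps)
qed

lemma appell_has_sum:
  assumes "0 < Im w" "Im w < Im \<tau>"
  shows "((\<lambda>(r, s). qsign r s * appell_coeff \<tau> w r
            * ee (of_int s * w + of_int (r * s) * \<tau>)) has_sum appell \<tau> w) UNIV"
proof -
  have \<tau>: "Im \<tau> > 0" using assms by linarith
  let ?c = "\<lambda>r::int. appell_coeff \<tau> w r"
  have s: "(\<lambda>(r, s). qsign r s * ?c r * ee (of_int s * w + of_int (r * s) * \<tau>)) summable_on UNIV"
    by (rule summable_on_qsign_geometric[OF assms summable_on_appell_coeff[OF \<tau>]])
  have "infsum (\<lambda>(r, s). qsign r s * ?c r * ee (of_int s * w + of_int (r * s) * \<tau>)) (Sigma UNIV (\<lambda>_. UNIV))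
     = (\<Sum>\<^sub>\<infinity>r. \<Sum>\<^sub>\<infinity>s. qsign r s * ?c r * ee (of_int s * w + of_int (r * s) * \<tau>))"
    using s by (intro infsum_Sigma'_banach[symmetric]) simp
  also have "\<dots> = (\<Sum>\<^sub>\<infinity>r. ?c r * (\<Sum>\<^sub>\<infinity>s. qsign r s * ee (of_int s * w + of_int (r * s) * \<tau>)))"
    unfolding infsum_cmult_right'[symmetric] by (simp only: ac_simps)
  also have "\<dots> = appell \<tau> w"
    unfolding infsumI[OF has_sum_qsign_geometric[OF assms]] appell_def by simp
  finally show ?thesis using s by (simp add: has_sum_iff)
qed

text \<open>The two expansions are multiplied and collected by N = (2 m + 1) j + nu + 1 + s. The
  condition s >= 0 becomes j <= \<open>j0 N\<close>; because the cut in j is free, the coefficient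
  can be stated with the cut 0 for all N.\<close>

lemma vth_appell_has_sum:
  assumes w: "0 < Im w" "Im w < Im \<tau>" and m: "m \<ge> 0"
  shows "((\<lambda>N. ee (of_int N * w) * psi_coeff m \<nu> \<tau> 0 0 N) has_sum vth m \<nu> \<tau> w * appell \<tau> w) UNIV"
proof -
  have \<tau>: "Im \<tau> > 0" using w by linarith
  let ?f = "\<lambda>j::int. vth_term m \<nu> \<tau> w j"
  let ?g = "\<lambda>(r, s). qsign r s * appell_coeff \<tau> w r
            * ee (of_int s * w + of_int (r * s) * \<tau>)"
  define j0 where "j0 = (\<lambda>N. (N - \<nu> - 1) div (2 * m + 1))"
  let ?h = "\<lambda>N (j, r). ee (of_int N * w) * (qsign (r - 0) (j0 N - j) * psi_term m \<nu> \<tau> N j r)"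
  have "(?f has_sum vth m \<nu> \<tau> w) UNIV"
    unfolding vth_def by (rule has_sum_infsum[OF summable_on_vth[OF \<tau> m]])
  from has_sum_product_complex[OF this appell_has_sum[OF w]]
  have "((\<lambda>(j, rs). ?f j * ?g rs) has_sum vth m \<nu> \<tau> w * appell \<tau> w) UNIV" .
  also have "?this \<longleftrightarrow> ((\<lambda>(N, jr). ?h N jr) has_sum vth m \<nu> \<tau> w * appell \<tau> w) UNIV"
  proof (rule has_sum_reindex_bij_witness[where i = "\<lambda>(N, j, r). (j, r, N - \<nu> - 1 - (2 * m + 1) * j)"
        and j = "\<lambda>(j, r, s). ((2 * m + 1) * j + \<nu> + 1 + s, j, r)"])
    fix a :: "int \<times> int \<times> int"
    obtain j r s where a: "a = (j, r, s)" by (cases a)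
    define N where "N = (2 * m + 1) * j + \<nu> + 1 + s"
    have s: "s = N - \<nu> - 1 - (2 * m + 1) * j" by (simp add: N_def)
    have "j0 N = j + s div (2 * m + 1)"
      using m unfolding j0_def N_def by (simp add: algebra_simps flip: div_mult_self2)
    then have "qsign (r - 0) (j0 N - j) = qsign r s"
      using m by (simp add: qsign_def pos_imp_zdiv_nonneg_iff pos_imp_zdiv_neg_iff)
    moreover have "ee (of_int N * w) * (qsign r s * psi_term m \<nu> \<tau> N j r) = ?f j * ?g (r, s)"
    proof -
      have "vth_term m \<nu> \<tau> w j
          * appell_coeff \<tau> w r * ee (of_int s * w + of_int (r * s) * \<tau>)
          = ee (of_int N * w) * psi_term m \<nu> \<tau> N j r"
        unfolding psi_term_alt s[symmetric] ee_add[symmetric]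
        by (rule arg_cong[of _ _ ee]) (simp add: N_def field_simps)
      then show ?thesis by (simp add: ac_simps)
    qed
    ultimately show "(case case a of (j, r, s) \<Rightarrow> ((2 * m + 1) * j + \<nu> + 1 + s, j, r) of (N, jr) \<Rightarrow> ?h N jr)
        = (case a of (j, rs) \<Rightarrow> ?f j * ?g rs)"
      unfolding a prod.case N_def[symmetric] by (simp only: prod.case)
  qed auto
  finally have hs: "((\<lambda>(N, jr). ?h N jr) has_sum vth m \<nu> \<tau> w * appell \<tau> w) (Sigma UNIV (\<lambda>_. UNIV))" by simp
  then have sm: "(\<lambda>(N, jr). ?h N jr) summable_on Sigma UNIV (\<lambda>_. UNIV)" by (rule has_sum_imp_summable)
  have in_eq: "infsum (?h N) UNIV = ee (of_int N * w) * psi_coeff m \<nu> \<tau> 0 0 N" for N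
  proof -
    have "infsum (?h N) UNIV = ee (of_int N * w) * psi_coeff m \<nu> \<tau> 0 (j0 N) N"
      unfolding psi_coeff_def infsum_cmult_right'[symmetric] by (intro infsum_cong) auto
    then show ?thesis by (simp only: psi_coeff_eq_psi_half[OF \<tau> m])
  qed
  have "(\<Sum>\<^sub>\<infinity>N. infsum (?h N) UNIV) = vth m \<nu> \<tau> w * appell \<tau> w"
    using infsum_Sigma'_banach[OF sm] infsumI[OF hs] by (simp only:)
  moreover have "(\<lambda>N. infsum (?h N) UNIV) summable_on UNIV"
    by (rule summable_on_Sigma_banach[OF sm])
  ultimately show ?thesis unfolding in_eq by (simp add: has_sum_iff)
qed

text \<open>Since \<open>vth 0 0 \<tau> 0\<close> vanishes, the cut in r is free as well. Moving
  both cuts by one amounts to shifting (j, r) by (1, 1), which multiplies the coefficient by q^N, a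
  number different from 1.\<close>

lemma psi_coeff_0_0_eq_0:
  assumes \<tau>: "Im \<tau> > 0" and N: "N \<noteq> 0"
  shows "psi_coeff 0 0 \<tau> 0 0 N = 0"
proof -
  have "psi_coeff 0 0 \<tau> 0 0 N = psi_coeff 0 0 \<tau> 1 1 N"
    using psi_coeff_diff[OF \<tau>, of 0 0 0 N 1 1] by (simp add: vth_0_0_at_0)
  also have "\<dots> = ee (\<tau> * of_int N) * psi_coeff 0 0 \<tau> 0 0 N"
    unfolding psi_coeff_def infsum_cmult_right'[symmetric]
  proof (rule infsum_reindex_bij_witness[where i = "\<lambda>(j, r). (j + 1, r + 1)" and j = "\<lambda>(j, r). (j - 1, r - 1)"])
    fix a :: "int \<times> int"
    obtain j r where a: "a = (j, r)" by (cases a)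
    have "ee (\<tau> * of_int N) * psi_term 0 0 \<tau> N (j - 1) (r - 1) = psi_term 0 0 \<tau> N j r"
      unfolding psi_term_def ee_add[symmetric]
      by (rule ee_cong[where k = "- 1"]) (simp add: field_simps)
    then show "ee (\<tau> * of_int N) * (case case a of (j, r) \<Rightarrow> (j - 1, r - 1) of (j, r) \<Rightarrow> qsign (r - 0) (0 - j) * psi_term 0 0 \<tau> N j r)
       = (case a of (j, r) \<Rightarrow> qsign (r - 1) (1 - j) * psi_term 0 0 \<tau> N j r)"
      by (simp add: a)
  qed auto
  finally have "(1 - ee (\<tau> * of_int N)) * psi_coeff 0 0 \<tau> 0 0 N = 0" by (simp add: algebra_simps)
  moreover have "ee (\<tau> * of_int N) \<noteq> 1"
  proof
    assume "ee (\<tau> * of_int N) = 1"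
    then obtain k :: int where "\<tau> * of_int N = of_int k" unfolding ee_eq_1_iff by blast
    then have "Im (\<tau> * of_int N) = 0" by simp
    with \<tau> N show False by simp
  qed
  ultimately show ?thesis by simp
qed

lemma vth_0_0_appell:
  assumes w: "0 < Im w" "Im w < Im \<tau>"
  shows "vth 0 0 \<tau> w * appell \<tau> w = psi_coeff 0 0 \<tau> 0 0 0"
proof -
  have \<tau>: "Im \<tau> > 0" using w by linarith
  have "((\<lambda>N::int. ee (of_int N * w) * psi_coeff 0 0 \<tau> 0 0 N) has_sum psi_coeff 0 0 \<tau> 0 0 0) UNIV"
    by (rule has_sum_finite_neutralI[where B = "{0}"]) (auto simp: psi_coeff_0_0_eq_0[OF \<tau>])
  with vth_appell_has_sum[OF w, of 0 0] show ?thesis by (auto intro: has_sum_unique)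
qed

section \<open>Zeros of the odd theta function\<close>


text \<open>For nonzero r the point omega + r sigma stays at distance at least Im sigma - delta from
  the real line. Hence only the summand r = 0 of a Lerch type sum can have poles in the
  band.\<close>

lemma norm_1_minus_ee_ge:
  assumes "\<bar>Im \<omega>\<bar> \<le> \<delta>" "\<delta> < Im \<sigma>" "r \<noteq> (0::int)"
  shows "norm (1 - ee (\<omega> + of_int r * \<sigma>)) \<ge> 1 - exp (- (2 * pi * (Im \<sigma> - \<delta>)))"
proof -
  define d where "d = Im \<sigma> - \<delta>"
  have d: "d > 0" using assms by (simp add: d_def)
  have \<sigma>: "Im \<sigma> > 0" using assms by linarith
  define e where "e = exp (- (2 * pi * d))"
  have e: "e > 0" "e < 1" using d by (auto simp: e_def)
  show ?thesis
  proof (cases "r > 0")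
    case True
    then have "1 * Im \<sigma> \<le> real_of_int r * Im \<sigma>" using \<sigma> by (intro mult_right_mono) auto
    then have "d \<le> Im (\<omega> + of_int r * \<sigma>)" using assms by (simp add: d_def)
    then have "norm (ee (\<omega> + of_int r * \<sigma>)) \<le> e" by (simp add: norm_ee e_def)
    moreover have "norm (1::complex) - norm (ee (\<omega> + of_int r * \<sigma>)) \<le> norm (1 - ee (\<omega> + of_int r * \<sigma>))"
      by (rule norm_triangle_ineq2)
    ultimately show ?thesis by (simp add: e_def d_def)
  next
    case False
    then have "real_of_int r * Im \<sigma> \<le> - 1 * Im \<sigma>" using \<sigma> assms by (intro mult_right_mono) auto
    then have "d \<le> - Im (\<omega> + of_int r * \<sigma>)" using assms by (simp add: d_def)
    then have "2 * pi * d \<le> 2 * pi * (- Im (\<omega> + of_int r * \<sigma>))" by (intro mult_left_mono) auto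
    then have "norm (ee (\<omega> + of_int r * \<sigma>)) \<ge> exp (2 * pi * d)" unfolding norm_ee by (simp del: plus_complex.sel)
    moreover have "exp (2 * pi * d) = 1 / e" by (simp add: e_def exp_minus field_simps)
    moreover have "1 / e - 1 \<ge> 1 - e"
    proof -
      have "(1 - e) * (1 - e) \<ge> 0" by simp
      then show ?thesis using e by (simp add: field_simps)
    qed
    moreover have "norm (ee (\<omega> + of_int r * \<sigma>)) - norm (1::complex) \<le> norm (ee (\<omega> + of_int r * \<sigma>) - 1)"
      by (rule norm_triangle_ineq2)
    ultimately show ?thesis by (simp add: e_def d_def norm_minus_commute)
  qed
qed

lemma norm_lerch_term_le:
  assumes "\<bar>Im \<omega>\<bar> \<le> \<delta>" "\<delta> < Im \<sigma>" "r \<noteq> (0::int)" "norm c \<le> B"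
  shows "norm (c / (1 - ee (\<omega> + of_int r * \<sigma>))) \<le> B * (1 / (1 - exp (- (2 * pi * (Im \<sigma> - \<delta>)))))"
proof -
  have e: "0 < 1 - exp (- (2 * pi * (Im \<sigma> - \<delta>)))" using assms by simp
  have "norm c / norm (1 - ee (\<omega> + of_int r * \<sigma>)) \<le> B / (1 - exp (- (2 * pi * (Im \<sigma> - \<delta>))))"
    using assms e norm_1_minus_ee_ge[OF assms(1-3)] norm_ge_zero[of c] by (intro frac_le) linarith+
  then show ?thesis by (simp add: norm_divide)
qed

lemma ee_neq_1_off_real:
  assumes "\<bar>Im \<omega>\<bar> \<le> \<delta>" "\<delta> < Im \<sigma>" "r \<noteq> (0::int)"
  shows "1 - ee (\<omega> + of_int r * \<sigma>) \<noteq> 0"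
proof -
  have "0 < 1 - exp (- (2 * pi * (Im \<sigma> - \<delta>)))" using assms by simp
  then show ?thesis using norm_1_minus_ee_ge[OF assms] by auto
qed

lemma holomorphic_lerch:
  assumes S: "open S" and \<omega>: "\<omega> holomorphic_on S" "\<And>z. z \<in> S \<Longrightarrow> \<bar>Im (\<omega> z)\<bar> \<le> \<delta>" "\<delta> < Im \<sigma>"
    and f: "\<And>r. f r holomorphic_on S" "\<And>r z. z \<in> S \<Longrightarrow> norm (f r z) \<le> B r" and B: "B summable_on UNIV"
  shows "(\<lambda>z. \<Sum>\<^sub>\<infinity>r\<in>UNIV - {0::int}. f r z / (1 - ee (\<omega> z + of_int r * \<sigma>))) holomorphic_on S"
proof (rule holomorphic_on_infsum[OF S])
  show "(\<lambda>r. B r * (1 / (1 - exp (- (2 * pi * (Im \<sigma> - \<delta>)))))) summable_on UNIV - {0}"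
    by (rule summable_on_cmult_left, rule summable_on_subset_banach[OF B]) simp
  fix r :: int assume "r \<in> UNIV - {0}"
  then have r: "r \<noteq> 0" by simp
  show "(\<lambda>z. f r z / (1 - ee (\<omega> z + of_int r * \<sigma>))) holomorphic_on S"
    using ee_neq_1_off_real[OF \<omega>(2,3) r] by (intro holomorphic_intros f \<omega>) auto
  show "norm (f r z / (1 - ee (\<omega> z + of_int r * \<sigma>))) \<le> B r * (1 / (1 - exp (- (2 * pi * (Im \<sigma> - \<delta>)))))"
    if "z \<in> S" for z
    by (rule norm_lerch_term_le[OF \<omega>(2)[OF that] \<omega>(3) r f(2)[OF that]])
qed

lemma lerch_split:
  fixes c :: "int \<Rightarrow> complex"
  assumes "\<bar>Im \<omega>\<bar> < Im \<sigma>" "c summable_on UNIV"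
  shows "(\<Sum>\<^sub>\<infinity>r. c r / (1 - ee (\<omega> + of_int r * \<sigma>)))
    = c 0 / (1 - ee \<omega>) + (\<Sum>\<^sub>\<infinity>r\<in>UNIV - {0::int}. c r / (1 - ee (\<omega> + of_int r * \<sigma>)))"
proof -
  have "(\<lambda>r. c r / (1 - ee (\<omega> + of_int r * \<sigma>))) summable_on UNIV - {0}"
  proof (rule summable_on_norm_le)
    show "(\<lambda>r. norm (c r) * (1 / (1 - exp (- (2 * pi * (Im \<sigma> - \<bar>Im \<omega>\<bar>)))))) summable_on UNIV - {0}"
      by (rule summable_on_cmult_left, rule summable_on_norm_complex, rule summable_on_subset_banach[OF assms(2)]) simp
    show "norm (c r / (1 - ee (\<omega> + of_int r * \<sigma>))) \<le> norm (c r) * (1 / (1 - exp (- (2 * pi * (Im \<sigma> - \<bar>Im \<omega>\<bar>)))))"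
      if "r \<in> UNIV - {0}" for r
      using that assms by (intro norm_lerch_term_le) auto
  qed
  from infsum_insert[OF this, of 0] show ?thesis by (simp add: insert_UNIV)
qed

section \<open>Continuation of the product formula across the real line\<close>

definition appell_reg :: "complex \<Rightarrow> complex \<Rightarrow> complex" where
  "appell_reg \<tau> w = (\<Sum>\<^sub>\<infinity>r\<in>UNIV - {0::int}. appell_coeff \<tau> w r / (1 - ee (w + of_int r * \<tau>)))"

lemma appell_split:
  assumes "\<bar>Im w\<bar> < Im \<tau>"
  shows "appell \<tau> w = ee (w / 2) / (1 - ee w) + appell_reg \<tau> w"
proof -
  have "Im \<tau> > 0" using assms by linarith
  from lerch_split[OF assms summable_on_appell_coeff[OF this, of w]] show ?thesis
    by (simp add: appell_def appell_reg_def)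
qed

lemma holomorphic_appell_reg:
  assumes \<tau>: "Im \<tau> > 0"
  shows "appell_reg \<tau> holomorphic_on band (Im \<tau> / 2)"
  unfolding appell_reg_def
proof (rule holomorphic_lerch[where \<delta> = "Im \<tau> / 2"])
  let ?c = "\<lambda>r::int. norm (ee (of_int r / 2 + \<tau> * (of_int r * (of_int r + 1) / 2) + 0 / 2))"
  show "(\<lambda>r. ?c r * exp (pi * Im \<tau>)) summable_on UNIV"
    by (rule summable_on_cmult_left, rule summable_on_norm_complex, rule summable_on_appell_coeff[OF \<tau>])
  fix r :: int and w assume "w \<in> band (Im \<tau> / 2)"
  then have "- Im w \<le> Im \<tau>" using \<tau> unfolding mem_band by linarith
  then have "pi * (- Im w) \<le> pi * Im \<tau>" by (intro mult_left_mono) auto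
  then have "norm (ee (w / 2)) \<le> exp (pi * Im \<tau>)"
    by (simp add: norm_ee)
  then have "?c r * norm (ee (w / 2)) \<le> ?c r * exp (pi * Im \<tau>)" by (rule mult_left_mono) simp
  then show "norm (appell_coeff \<tau> w r) \<le> ?c r * exp (pi * Im \<tau>)"
    by (simp add: ee_add norm_mult)
qed (use \<tau> in \<open>auto intro!: holomorphic_intros intro: open_band\<close>)

text \<open>The product formula was obtained only above the real line. Multiplication by 1 - e(w)
  clears the poles at the integers, so both sides continue to a symmetric band, which contains the
  zero w = 0 of theta.\<close>

lemma vth_0_0_band:
  assumes "\<bar>Im w\<bar> < Im \<tau> / 2"
  shows "(ee (w / 2) + (1 - ee w) * appell_reg \<tau> w) * vth 0 0 \<tau> w = psi_coeff 0 0 \<tau> 0 0 0 * (1 - ee w)"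
proof -
  have \<tau>: "Im \<tau> > 0" using assms by linarith
  let ?S = "band (Im \<tau> / 2)" and ?U = "band (Im \<tau> / 2) \<inter> {w. Im w > 0}"
  show ?thesis
  proof (rule analytic_continuation_open[of ?U ?S "\<lambda>w. (ee (w / 2) + (1 - ee w) * appell_reg \<tau> w) * vth 0 0 \<tau> w"
        "\<lambda>w. psi_coeff 0 0 \<tau> 0 0 0 * (1 - ee w)"])
    show "open ?U" by (intro open_Int open_band open_halfspace_Im_gt)
    have "\<i> * of_real (Im \<tau> / 4) \<in> ?U" using \<tau> by simp
    then show "?U \<noteq> {}" by blast
    fix w assume w: "w \<in> ?U"
    then have w': "0 < Im w" "Im w < Im \<tau>" "\<bar>Im w\<bar> < Im \<tau>" by auto
    have "1 - ee w \<noteq> 0"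
    proof
      assume "1 - ee w = 0"
      then have "ee w = 1" by simp
      then obtain k :: int where "w = of_int k" unfolding ee_eq_1_iff by blast
      with w' show False by simp
    qed
    then have "(1 - ee w) * (ee (w / 2) / (1 - ee w) + appell_reg \<tau> w) = ee (w / 2) + (1 - ee w) * appell_reg \<tau> w"
      by (simp add: distrib_left)
    then have "ee (w / 2) + (1 - ee w) * appell_reg \<tau> w = (1 - ee w) * appell \<tau> w"
      by (simp only: appell_split[OF w'(3)])
    then show "(ee (w / 2) + (1 - ee w) * appell_reg \<tau> w) * vth 0 0 \<tau> w = psi_coeff 0 0 \<tau> 0 0 0 * (1 - ee w)"
      using vth_0_0_appell[OF w'(1,2)] by (simp add: ac_simps)
  next
    show "(\<lambda>w. (ee (w / 2) + (1 - ee w) * appell_reg \<tau> w) * vth 0 0 \<tau> w) holomorphic_on ?S"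
      using \<tau> by (intro holomorphic_intros holomorphic_appell_reg) auto
    show "(\<lambda>w. psi_coeff 0 0 \<tau> 0 0 0 * (1 - ee w)) holomorphic_on ?S"
      by (intro holomorphic_intros)
    show "?U \<subseteq> ?S" by (rule Int_lower1)
    show "w \<in> ?S" using assms by simp
  qed (rule open_band connected_band)+
qed

text \<open>At w = 0 the cofactor of theta in \<open>vth_0_0_band\<close> equals 1, so a zero
  constant would make theta vanish near 0 and then everywhere.\<close>

lemma psi_coeff_0_0_nonzero:
  assumes \<tau>: "Im \<tau> > 0"
  shows "psi_coeff 0 0 \<tau> 0 0 0 \<noteq> 0"
proof
  assume K: "psi_coeff 0 0 \<tau> 0 0 0 = 0"
  let ?S = "band (Im \<tau> / 2)"
  let ?P = "\<lambda>w. ee (w / 2) + (1 - ee w) * appell_reg \<tau> w"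
  have "?P holomorphic_on ?S" using \<tau> by (intro holomorphic_intros holomorphic_appell_reg) auto
  then have "continuous_on ?S ?P" by (rule holomorphic_on_imp_continuous_on)
  then have op: "open (?S \<inter> ?P -` (- {0}))" using continuous_open_preimage[OF _ open_band] by blast
  have in0: "0 \<in> ?S \<inter> ?P -` (- {0})" using \<tau> by simp
  have *: "vth 0 0 \<tau> w = 0" for w
  proof (rule analytic_continuation_open[of "?S \<inter> ?P -` (- {0})" UNIV "vth 0 0 \<tau>" "\<lambda>_. 0"])
    show "vth 0 0 \<tau> z = 0" if "z \<in> ?S \<inter> ?P -` (- {0})" for z
      using vth_0_0_band[of z \<tau>] that K by auto
    show "vth 0 0 \<tau> holomorphic_on UNIV" by (rule holomorphic_vth_0_0[OF \<tau>])
    show "?S \<inter> ?P -` (- {0}) \<noteq> {}" using in0 by blast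
  qed (use op in auto)
  have "jtheta \<tau> u = 0" for u
    using *[of "u - \<tau> / 2 - 1 / 2"] unfolding vth_eq_jtheta by simp
  then show False using jtheta_not_identically_0[OF \<tau>] by simp
qed

definition dvth0 :: "complex \<Rightarrow> complex" where
  "dvth0 \<tau> = deriv (vth 0 0 \<tau>) 0"

lemma vth_0_0_has_field_derivative:
  assumes \<tau>: "Im \<tau> > 0"
  shows "(vth 0 0 \<tau> has_field_derivative dvth0 \<tau>) (at 0)"
proof -
  have "vth 0 0 \<tau> holomorphic_on UNIV" by (rule holomorphic_vth_0_0[OF \<tau>])
  then show ?thesis unfolding dvth0_def by (rule holomorphic_derivI) auto
qed

text \<open>Both sides of \<open>vth_0_0_band\<close> are differentiated at 0; on the left only the
  derivative of theta survives, because theta is 0 there and its cofactor is 1.\<close>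

lemma dvth0_eq:
  assumes \<tau>: "Im \<tau> > 0"
  shows "dvth0 \<tau> = - (2 * of_real pi * \<i> * psi_coeff 0 0 \<tau> 0 0 0)"
proof -
  let ?S = "band (Im \<tau> / 2)"
  let ?P = "\<lambda>w. ee (w / 2) + (1 - ee w) * appell_reg \<tau> w"
  have "?P holomorphic_on ?S" using \<tau> by (intro holomorphic_intros holomorphic_appell_reg) auto
  then have p: "(?P has_field_derivative deriv ?P 0) (at 0)"
    by (rule holomorphic_derivI[OF _ open_band]) (use \<tau> in simp)
  have "((\<lambda>w. ?P w * vth 0 0 \<tau> w) has_field_derivative deriv ?P 0 * vth 0 0 \<tau> 0 + dvth0 \<tau> * ?P 0) (at 0)"
    by (rule DERIV_mult[OF p vth_0_0_has_field_derivative[OF \<tau>]])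
  then have d1: "((\<lambda>w. ?P w * vth 0 0 \<tau> w) has_field_derivative dvth0 \<tau>) (at 0)"
    by (simp add: vth_0_0_at_0)
  have d2: "((\<lambda>w. psi_coeff 0 0 \<tau> 0 0 0 * (1 - ee w)) has_field_derivative
      psi_coeff 0 0 \<tau> 0 0 0 * (0 - 2 * of_real pi * \<i> * ee 0)) (at 0)"
    by (intro DERIV_cmult DERIV_diff DERIV_const ee_has_field_derivative)
  have "((\<lambda>w. ?P w * vth 0 0 \<tau> w) has_field_derivative
      psi_coeff 0 0 \<tau> 0 0 0 * (0 - 2 * of_real pi * \<i> * ee 0)) (at 0)"
  proof (rule has_field_derivative_transform_within_open[OF d2 open_band[of "Im \<tau> / 2"]])
    show "0 \<in> ?S" using \<tau> by simp
    show "psi_coeff 0 0 \<tau> 0 0 0 * (1 - ee w) = ?P w * vth 0 0 \<tau> w" if "w \<in> ?S" for w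
      using vth_0_0_band[of w \<tau>] that by simp
  qed
  from DERIV_unique[OF d1 this] show ?thesis by (simp add: algebra_simps)
qed

lemma dvth0_nonzero: "Im \<tau> > 0 \<Longrightarrow> dvth0 \<tau> \<noteq> 0"
  by (simp add: dvth0_eq psi_coeff_0_0_nonzero)

text \<open>The meromorphic continuation of \<open>appell\<close> from the strip to the plane. Its
  constant is expressed by the derivative of theta at 0 because that quantity has an evident
  behaviour under modular substitutions.\<close>

definition vth_quot :: "complex \<Rightarrow> complex \<Rightarrow> complex" where
  "vth_quot \<tau> w = - (dvth0 \<tau> / (2 * of_real pi * \<i> * vth 0 0 \<tau> w))"

lemma appell_eq_vth_quot:
  assumes w: "0 < Im w" "Im w < Im \<tau>"
  shows "appell \<tau> w = vth_quot \<tau> w"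
proof -
  have \<tau>: "Im \<tau> > 0" using w by linarith
  have "vth 0 0 \<tau> w \<noteq> 0" using vth_0_0_appell[OF w] psi_coeff_0_0_nonzero[OF \<tau>] by auto
  then show ?thesis using vth_0_0_appell[OF w] by (simp add: vth_quot_def dvth0_eq[OF \<tau>] field_simps)
qed

lemma vth_0_0_plus_lattice:
  "vth 0 0 \<tau> (w + of_int a * \<tau> + of_int b) = 0 \<longleftrightarrow> vth 0 0 \<tau> w = 0"
proof -
  have 1: "vth 0 0 \<tau> (w + of_int b) = 0 \<longleftrightarrow> vth 0 0 \<tau> w = 0" for b w
  proof (induction b rule: int_induct[where k = 0])
    case (step1 i)
    then show ?case using vth_plus_1[of 0 0 \<tau> "w + of_int i"] by (simp add: ac_simps)
  next
    case (step2 i)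
    then show ?case using vth_plus_1[of 0 0 \<tau> "w + of_int (i - 1)"] by (simp add: ac_simps)
  qed simp
  have 2: "vth 0 0 \<tau> (w + of_int a * \<tau>) = 0 \<longleftrightarrow> vth 0 0 \<tau> w = 0" for a w
  proof (induction a rule: int_induct[where k = 0])
    case (step1 i)
    have "w + of_int (i + 1) * \<tau> = w + of_int i * \<tau> + \<tau>" by (simp add: algebra_simps)
    with step1 show ?case using vth_plus_tau[of 0 0 \<tau> "w + of_int i * \<tau>"] by (simp only:) simp
  next
    case (step2 i)
    have "w + of_int i * \<tau> = w + of_int (i - 1) * \<tau> + \<tau>" by (simp add: algebra_simps)
    with step2 show ?case using vth_plus_tau[of 0 0 \<tau> "w + of_int (i - 1) * \<tau>"] by (simp only:) simp
  qed simp
  show ?thesis by (simp only: 1 2)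
qed

text \<open>A translation brings Im w into [0, Im tau). Inside the strip the product with
  \<open>appell\<close> is a nonzero constant, which excludes zeros; on the real line
  \<open>vth_0_0_band\<close> leaves only e(v) = 1.\<close>

lemma vth_0_0_eq_0_iff:
  assumes \<tau>: "Im \<tau> > 0"
  shows "vth 0 0 \<tau> w = 0 \<longleftrightarrow> (\<exists>a b. w = of_int a * \<tau> + of_int b)"
proof
  assume "\<exists>a b. w = of_int a * \<tau> + of_int b"
  then obtain a b :: int where "w = 0 + of_int a * \<tau> + of_int b" by (metis add_0)
  then show "vth 0 0 \<tau> w = 0" by (simp only: vth_0_0_plus_lattice vth_0_0_at_0)
next
  assume 0: "vth 0 0 \<tau> w = 0"
  define a where "a = \<lfloor>Im w / Im \<tau>\<rfloor>"
  define v where "v = w + of_int (- a) * \<tau> + of_int 0"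
  have v0: "vth 0 0 \<tau> v = 0" unfolding v_def vth_0_0_plus_lattice by (rule 0)
  have Imv: "Im v = (Im w / Im \<tau> - of_int a) * Im \<tau>" using \<tau> by (simp add: v_def field_simps)
  have "0 \<le> Im w / Im \<tau> - of_int a" "Im w / Im \<tau> - of_int a < 1" unfolding a_def by linarith+
  then have v: "0 \<le> Im v" "Im v < Im \<tau>"
    unfolding Imv using \<tau> mult_strict_right_mono[of "Im w / Im \<tau> - of_int a" 1 "Im \<tau>"] by auto
  have "Im v = 0"
  proof (rule ccontr)
    assume "Im v \<noteq> 0"
    then have "0 < Im v" using v by simp
    from vth_0_0_appell[OF this v(2)] v0 psi_coeff_0_0_nonzero[OF \<tau>] show False by simp
  qed
  then have "psi_coeff 0 0 \<tau> 0 0 0 * (1 - ee v) = 0" using vth_0_0_band[of v \<tau>] v0 \<tau> by simp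
  then have "ee v = 1" using psi_coeff_0_0_nonzero[OF \<tau>] by simp
  then obtain b :: int where "v = of_int b" unfolding ee_eq_1_iff by blast
  then have "w = of_int a * \<tau> + of_int b" by (simp add: v_def diff_eq_eq add.commute)
  then show "\<exists>a b. w = of_int a * \<tau> + of_int b" by (intro exI)
qed

section \<open>Modular transformation of the Jacobi theta function\<close>


lemma periodic_plus_of_int:
  fixes Q :: "complex \<Rightarrow> 'a"
  assumes "\<And>z. Q (z + \<omega>) = Q z"
  shows "Q (z + of_int k * \<omega>) = Q z"
proof (induction k rule: int_induct[where k = 0])
  case (step1 i)
  have "z + of_int (i + 1) * \<omega> = (z + of_int i * \<omega>) + \<omega>" by (simp add: algebra_simps)
  with step1 show ?case using assms[of "z + of_int i * \<omega>"] by (simp only:)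
next
  case (step2 i)
  have "z + of_int i * \<omega> = (z + of_int (i - 1) * \<omega>) + \<omega>" by (simp add: algebra_simps)
  with step2 show ?case using assms[of "z + of_int (i - 1) * \<omega>"] by (simp only:)
qed simp

lemma doubly_periodic_entire_constant:
  assumes hol: "Q holomorphic_on UNIV" and \<tau>: "Im \<tau> > 0"
    and 1: "\<And>z. Q (z + 1) = Q z" and 2: "\<And>z. Q (z + \<tau>) = Q z"
  shows "\<exists>c. \<forall>z. Q z = c"
proof -
  let ?p = "\<lambda>(x, y). complex_of_real x + complex_of_real y * \<tau>"
  define K where "K = ?p ` ({0..1} \<times> {0..1})"
  have "compact K"
    unfolding K_def by (intro compact_continuous_image compact_Times continuous_intros)
      (auto intro!: continuous_intros simp: case_prod_unfold)
  then have "bounded (Q ` K)"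
    using hol by (intro compact_imp_bounded compact_continuous_image holomorphic_on_imp_continuous_on)
      (auto intro: holomorphic_on_subset)
  moreover have "range Q \<subseteq> Q ` K"
  proof safe
    fix z :: complex
    define y where "y = Im z / Im \<tau>"
    define x where "x = Re (z - of_real y * \<tau>)"
    have z: "z = of_real x + of_real y * \<tau>"
      using \<tau> by (auto simp: complex_eq_iff x_def y_def)
    have "Q (?p (frac x, frac y)) = Q z"
    proof -
      have "Q (?p (frac x, frac y) + of_int \<lfloor>x\<rfloor> * 1 + of_int \<lfloor>y\<rfloor> * \<tau>) = Q (?p (frac x, frac y))"
        using periodic_plus_of_int[of Q 1, OF 1] periodic_plus_of_int[of Q \<tau>, OF 2] by (simp only:)
      moreover have "?p (frac x, frac y) + of_int \<lfloor>x\<rfloor> * 1 + of_int \<lfloor>y\<rfloor> * \<tau> = z"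
        by (simp add: z frac_def algebra_simps)
      ultimately show ?thesis by simp
    qed
    moreover have "?p (frac x, frac y) \<in> K"
      unfolding K_def by (rule imageI) (auto simp: frac_ge_0 less_imp_le[OF frac_lt_1])
    ultimately show "Q z \<in> Q ` K" by (metis imageI)
  qed
  ultimately have "bounded (range Q)" by (rule bounded_subset)
  then obtain c where "\<And>z. Q z = c" using Liouville_theorem[OF hol] by (auto simp: constant_on_def)
  then show ?thesis by blast
qed

text \<open>A theta function of the type of \<^term>\<open>vth 0 0 \<tau>\<close> that also vanishes at \<open>0\<close> is a multiple of it,
  because the zeros of \<^term>\<open>vth 0 0 \<tau>\<close> are simple and lie exactly on the lattice.\<close>

lemma vth_0_0_unique:
  assumes \<tau>: "Im \<tau> > 0" and hol: "F holomorphic_on UNIV" and F0: "F 0 = 0"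
    and F1: "\<And>w. F (w + 1) = - F w" and F2: "\<And>w. F (w + \<tau>) = - (ee (- (\<tau> / 2 + w)) * F w)"
  shows "\<exists>c. \<forall>w. F w = c * vth 0 0 \<tau> w"
proof -
  let ?J = "vth 0 0 \<tau>"
  have holJ: "?J holomorphic_on UNIV" by (rule holomorphic_vth_0_0[OF \<tau>])
  have J1: "?J (w + 1) = - ?J w" for w by (rule vth_plus_1)
  have J2: "?J (w + \<tau>) = - (ee (- (\<tau> / 2 + w)) * ?J w)" for w using vth_plus_tau[of 0 0 \<tau> w] by simp
  \<comment> \<open>At lattice points the quotient receives the value of its continuation at 0, the
    ratio of the derivatives; double periodicity then carries regularity from 0 to all lattice
    points.\<close>
  define Q where "Q = (\<lambda>w. if ?J w = 0 then deriv F 0 / dvth0 \<tau> else F w / ?J w)"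
  have Q1: "Q (w + 1) = Q w" for w by (simp add: Q_def J1 F1)
  have Q2: "Q (w + \<tau>) = Q w" for w by (simp add: Q_def J2 F2)
  have an0: "Q analytic_on {0}"
  proof -
    define F' where "F' = (\<lambda>z. if z = 0 then deriv F 0 else (F z - F 0) / (z - 0))"
    define J' where "J' = (\<lambda>z. if z = 0 then deriv ?J 0 else (?J z - ?J 0) / (z - 0))"
    have F': "F' holomorphic_on UNIV" unfolding F'_def by (rule pole_lemma[OF hol]) simp
    have J': "J' holomorphic_on UNIV" unfolding J'_def by (rule pole_lemma[OF holJ]) simp
    have J'0: "J' 0 \<noteq> 0" using dvth0_nonzero[OF \<tau>] by (simp add: J'_def dvth0_def)
    have op: "open (UNIV \<inter> J' -` (- {0}))"
      using continuous_open_preimage[OF holomorphic_on_imp_continuous_on[OF J'] open_UNIV, of "- {0}"] by auto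
    have "(\<lambda>z. F' z / J' z) holomorphic_on (UNIV \<inter> J' -` (- {0}))"
      by (intro holomorphic_intros holomorphic_on_subset[OF F'] holomorphic_on_subset[OF J']) auto
    moreover have "F' z / J' z = Q z" if "z \<in> UNIV \<inter> J' -` (- {0})" for z
    proof (cases "z = 0")
      case True
      then show ?thesis by (simp add: F'_def J'_def Q_def vth_0_0_at_0 dvth0_def)
    next
      case False
      then have "?J z \<noteq> 0" using that by (auto simp: J'_def vth_0_0_at_0)
      then show ?thesis using False by (simp add: F'_def J'_def Q_def vth_0_0_at_0 F0)
    qed
    ultimately have "Q holomorphic_on (UNIV \<inter> J' -` (- {0}))"
      by (rule holomorphic_transform)
    then have "Q analytic_on (UNIV \<inter> J' -` (- {0}))" using analytic_on_open[OF op] by simp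
    then show ?thesis by (rule analytic_on_subset) (use J'0 in auto)
  qed
  have "Q analytic_on {w}" for w
  proof (cases "?J w = 0")
    case True
    then obtain a b where w: "w = of_int a * \<tau> + of_int b" using vth_0_0_eq_0_iff[OF \<tau>] by blast
    have "Q \<circ> (\<lambda>z. z - w) analytic_on {w}"
      by (rule analytic_on_compose) (auto intro!: analytic_intros simp: an0)
    moreover have "Q \<circ> (\<lambda>z. z - w) = Q"
    proof
      fix z
      have "Q ((z - w) + of_int b * 1 + of_int a * \<tau>) = Q (z - w)"
        using periodic_plus_of_int[of Q 1, OF Q1] periodic_plus_of_int[of Q \<tau>, OF Q2] by (simp only:)
      moreover have "(z - w) + of_int b * 1 + of_int a * \<tau> = z" by (simp add: w)
      ultimately show "(Q \<circ> (\<lambda>z. z - w)) z = Q z" by (simp only: o_def)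
    qed
    ultimately show ?thesis by simp
  next
    case False
    have op: "open (UNIV \<inter> ?J -` (- {0}))"
      using continuous_open_preimage[OF holomorphic_on_imp_continuous_on[OF holJ] open_UNIV, of "- {0}"] by auto
    have "(\<lambda>z. F z / ?J z) holomorphic_on (UNIV \<inter> ?J -` (- {0}))"
      by (intro holomorphic_intros holomorphic_on_subset[OF hol] holomorphic_on_subset[OF holJ]) auto
    then have "Q holomorphic_on (UNIV \<inter> ?J -` (- {0}))"
      by (rule holomorphic_transform) (auto simp: Q_def)
    then have "Q analytic_on (UNIV \<inter> ?J -` (- {0}))" using analytic_on_open[OF op] by simp
    then show ?thesis by (rule analytic_on_subset) (use False in auto)
  qed
  then have "Q analytic_on UNIV" by (subst analytic_on_analytic_at) auto
  then have "Q holomorphic_on UNIV" by (rule analytic_imp_holomorphic)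
  then obtain c where c: "Q w = c" for w
    using doubly_periodic_entire_constant[OF _ \<tau> Q1 Q2] by blast
  have "F w = c * ?J w" if "?J w \<noteq> 0" for w
    using c[of w] that by (simp add: Q_def field_simps)
  moreover have "F w = 0" if Jw: "?J w = 0" for w
  proof -
    obtain a b where w: "w = of_int a * \<tau> + of_int b" using vth_0_0_eq_0_iff[OF \<tau>] Jw by blast
    have z1: "F (w + 1) = 0 \<longleftrightarrow> F w = 0" for w by (simp add: F1)
    have z2: "F (w + \<tau>) = 0 \<longleftrightarrow> F w = 0" for w by (simp add: F2)
    have "F (0 + of_int a * \<tau> + of_int b * 1) = 0 \<longleftrightarrow> F 0 = 0"
      using periodic_plus_of_int[of "\<lambda>w. F w = 0" 1, OF z1] periodic_plus_of_int[of "\<lambda>w. F w = 0" \<tau>, OF z2] by (simp only:)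
    then show ?thesis by (simp add: w F0)
  qed
  ultimately show ?thesis by (intro exI[of _ c] allI) force
qed

text \<open>The Gaussian periodised over the integers, as on the other side of Poisson summation. Up
  to a Gaussian factor it is theta at -1/tau.\<close>

definition jgauss :: "complex \<Rightarrow> complex \<Rightarrow> complex" where
  "jgauss \<tau> u = (\<Sum>\<^sub>\<infinity>k::int. ee (- ((u + of_int k)\<^sup>2 / (2 * \<tau>))))"

lemma Im_minus_inverse_pos:
  assumes "Im \<tau> > 0"
  shows "Im (- 1 / \<tau>) > 0"
proof -
  have "\<tau> \<noteq> 0" using assms by auto
  have "Im (- 1 / \<tau>) = Im \<tau> / (norm \<tau>)\<^sup>2"
    by (simp add: Im_divide cmod_power2)
  then show ?thesis using assms \<open>\<tau> \<noteq> 0\<close> by simp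
qed

lemma jgauss_eq_jtheta:
  assumes "\<tau> \<noteq> 0"
  shows "jgauss \<tau> u = ee (- (u\<^sup>2 / (2 * \<tau>))) * jtheta (- 1 / \<tau>) (u / \<tau>)"
proof -
  have "jgauss \<tau> u = ee (- (u\<^sup>2 / (2 * \<tau>))) * jtheta (- 1 / \<tau>) (- (u / \<tau>))"
    unfolding jgauss_def jtheta_def infsum_cmult_right'[symmetric] ee_add[symmetric]
    using assms by (intro infsum_cong arg_cong[of _ _ ee]) (simp add: power2_eq_square field_simps)
  then show ?thesis by (simp only: jtheta_minus)
qed

lemma summable_on_jgauss:
  assumes "Im \<tau> > 0"
  shows "(\<lambda>k::int. ee (- ((u + of_int k)\<^sup>2 / (2 * \<tau>)))) summable_on UNIV"
proof -
  have \<tau>: "\<tau> \<noteq> 0" using assms by auto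
  have "(\<lambda>k::int. ee (- (u\<^sup>2 / (2 * \<tau>))) * ee ((- 1 / \<tau>) * of_int k ^ 2 / 2 + of_int k * (- (u / \<tau>)))) summable_on UNIV"
    by (intro summable_on_cmult_right summable_on_jtheta Im_minus_inverse_pos assms)
  then show ?thesis
    by (rule summable_on_cong[THEN iffD1, rotated])
      (unfold ee_add[symmetric], rule arg_cong[of _ _ ee], use \<tau> in \<open>simp add: power2_eq_square field_simps\<close>)
qed

lemma jgauss_plus_1: "jgauss \<tau> (u + 1) = jgauss \<tau> u"
  unfolding jgauss_def
  by (rule infsum_reindex_bij_witness[where i = "\<lambda>k. k - 1" and j = "\<lambda>k. k + 1"]) (auto simp: ac_simps)

lemma jgauss_plus_tau:
  assumes "\<tau> \<noteq> 0"
  shows "jgauss \<tau> (u + \<tau>) = ee (- \<tau> / 2 - u) * jgauss \<tau> u"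
  unfolding jgauss_def infsum_cmult_right'[symmetric] ee_add[symmetric]
  using assms by (intro infsum_cong ee_cong[where k = "- k" for k]) (simp add: power2_eq_square field_simps)

lemma jgauss_zero:
  assumes "\<tau> \<noteq> 0"
  shows "jgauss \<tau> ((1 + \<tau>) / 2) = 0"
proof -
  let ?\<sigma> = "- 1 / \<tau>"
  have "jtheta ?\<sigma> ((1 + \<tau>) / 2 / \<tau>) = jtheta ?\<sigma> (- ((1 + \<tau>) / 2 / \<tau>) + 1)"
    unfolding jtheta_plus_1 jtheta_minus ..
  also have "- ((1 + \<tau>) / 2 / \<tau>) + 1 = (1 + ?\<sigma>) / 2" using assms by (simp add: field_simps)
  finally show ?thesis by (simp only: jgauss_eq_jtheta[OF assms] jtheta_zero mult_zero_right)
qed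

lemma holomorphic_jgauss:
  assumes "Im \<tau> > 0"
  shows "jgauss \<tau> holomorphic_on UNIV"
proof -
  have \<tau>: "\<tau> \<noteq> 0" using assms by auto
  have "jtheta (- 1 / \<tau>) holomorphic_on S" for S
    by (rule holomorphic_on_subset[OF holomorphic_jtheta[OF Im_minus_inverse_pos[OF assms]]]) simp
  then have "jtheta (- 1 / \<tau>) \<circ> (\<lambda>u. u / \<tau>) holomorphic_on UNIV"
    using \<tau> by (intro holomorphic_on_compose holomorphic_intros)
  then have "(\<lambda>u. ee (- (u\<^sup>2 / (2 * \<tau>))) * jtheta (- 1 / \<tau>) (u / \<tau>)) holomorphic_on UNIV"
    unfolding o_def using \<tau> by (intro holomorphic_intros) auto
  then show ?thesis by (simp add: jgauss_eq_jtheta[OF \<tau>] cong: holomorphic_cong)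
qed

text \<open>Both functions have the same multipliers under translation by 1 and tau and share the
  zero (1 + tau) / 2. Moving that zero to the origin makes \<open>vth_0_0_unique\<close>
  applicable.\<close>

lemma jgauss_proportional:
  assumes \<tau>: "Im \<tau> > 0"
  shows "\<exists>c. \<forall>u. jgauss \<tau> u = c * jtheta \<tau> u"
proof -
  have \<tau>0: "\<tau> \<noteq> 0" using \<tau> by auto
  \<comment> \<open>The prefactor is the one that turns the shifted \<open>jtheta\<close> into
    \<open>vth 0 0 \<tau>\<close>.\<close>
  let ?F = "\<lambda>w. ee (\<tau> / 8 + w / 2) * jgauss \<tau> (w + \<tau> / 2 + 1 / 2)"
  have "\<exists>c. \<forall>w. ?F w = c * vth 0 0 \<tau> w"
  proof (rule vth_0_0_unique[OF \<tau>])
    have "jgauss \<tau> \<circ> (\<lambda>w. w + \<tau> / 2 + 1 / 2) holomorphic_on UNIV"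
      by (intro holomorphic_on_compose holomorphic_intros) (auto intro: holomorphic_on_subset[OF holomorphic_jgauss[OF \<tau>]])
    then show "?F holomorphic_on UNIV"
      unfolding o_def by (intro holomorphic_intros) auto
    have "0 + \<tau> / 2 + 1 / 2 = (1 + \<tau>) / 2" by (simp add: field_simps)
    then show "?F 0 = 0" by (simp only: jgauss_zero[OF \<tau>0]) simp
    fix w
    have "ee (\<tau> / 8 + (w + 1) / 2) = ee (1 / 2) * ee (\<tau> / 8 + w / 2)"
      unfolding ee_add[symmetric] by (simp add: field_simps)
    moreover have "w + 1 + \<tau> / 2 + 1 / 2 = (w + \<tau> / 2 + 1 / 2) + 1" by simp
    ultimately show "?F (w + 1) = - ?F w"
      by (simp only: jgauss_plus_1 ee_half) simp
    have "w + \<tau> + \<tau> / 2 + 1 / 2 = (w + \<tau> / 2 + 1 / 2) + \<tau>" by simp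
    then have "?F (w + \<tau>) = ee (\<tau> / 8 + (w + \<tau>) / 2) * (ee (- \<tau> / 2 - (w + \<tau> / 2 + 1 / 2)) * jgauss \<tau> (w + \<tau> / 2 + 1 / 2))"
      by (simp only: jgauss_plus_tau[OF \<tau>0])
    also have "ee (\<tau> / 8 + (w + \<tau>) / 2) * (ee (- \<tau> / 2 - (w + \<tau> / 2 + 1 / 2)) * jgauss \<tau> (w + \<tau> / 2 + 1 / 2))
        = (ee (1 / 2) * ee (- (\<tau> / 2 + w)) * ee (\<tau> / 8 + w / 2)) * jgauss \<tau> (w + \<tau> / 2 + 1 / 2)"
      unfolding mult.assoc[symmetric] ee_add[symmetric]
      by (rule arg_cong2[of _ _ _ _ "(*)"], rule ee_cong[where k = "- 1"]) (simp_all add: field_simps)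
    finally show "?F (w + \<tau>) = - (ee (- (\<tau> / 2 + w)) * ?F w)"
      by (simp add: ee_half)
  qed
  then obtain c where c: "\<And>w. ?F w = c * vth 0 0 \<tau> w" by blast
  have "jgauss \<tau> u = c * jtheta \<tau> u" for u
  proof -
    let ?w = "u - \<tau> / 2 - 1 / 2"
    have vth: "vth 0 0 \<tau> ?w = ee (\<tau> / 8 + ?w / 2) * jtheta \<tau> u"
      unfolding vth_eq_jtheta by (simp add: power2_eq_square)
    have "ee (\<tau> / 8 + ?w / 2) * jgauss \<tau> u = c * (ee (\<tau> / 8 + ?w / 2) * jtheta \<tau> u)"
      using c[of ?w] unfolding vth by simp
    then show ?thesis by simp
  qed
  then show ?thesis by blast
qed

lemma jtheta_0_nonzero:
  assumes \<tau>: "Im \<tau> > 0"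
  shows "jtheta \<tau> 0 \<noteq> 0"
proof
  assume "jtheta \<tau> 0 = 0"
  then have "vth 0 0 \<tau> (- \<tau> / 2 - 1 / 2) = 0" unfolding vth_eq_jtheta by simp
  then obtain a b where ab: "- \<tau> / 2 - 1 / 2 = of_int a * \<tau> + of_int b" using vth_0_0_eq_0_iff[OF \<tau>] by blast
  then have "Im (- \<tau> / 2 - 1 / 2) = Im (of_int a * \<tau> + of_int b)" by simp
  then have "(2 * real_of_int a + 1) * Im \<tau> = 0" by (simp add: field_simps)
  then have "2 * real_of_int a + 1 = 0" using \<tau> by simp
  then have "real_of_int (2 * a + 1) = 0" by simp
  then have "2 * a + 1 = 0" by (simp only: of_int_eq_0_iff)
  then show False by presburger
qed

definition jfactor :: "complex \<Rightarrow> complex" where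
  "jfactor \<tau> = jtheta (- 1 / \<tau>) 0 / jtheta \<tau> 0"

lemma jgauss_eq_jfactor:
  assumes \<tau>: "Im \<tau> > 0"
  shows "jgauss \<tau> u = jfactor \<tau> * jtheta \<tau> u"
proof -
  have \<tau>0: "\<tau> \<noteq> 0" using \<tau> by auto
  obtain c where c: "\<And>u. jgauss \<tau> u = c * jtheta \<tau> u" using jgauss_proportional[OF \<tau>] by blast
  have "c = jfactor \<tau>"
    using c[of 0] jtheta_0_nonzero[OF \<tau>] by (simp add: jgauss_eq_jtheta[OF \<tau>0] jfactor_def field_simps)
  with c show ?thesis by simp
qed

text \<open>The numbers i / N + k run once through all integer multiples of 1 / N, so in contrast to
  \<open>sum_jtheta\<close> no factor N arises.\<close>

lemma sum_jgauss:
  assumes \<tau>: "Im \<tau> > 0" and N: "N > 0"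
  shows "(\<Sum>i\<in>{0..<N}. jgauss \<tau> (of_int i / of_int N)) = jgauss (of_int N ^ 2 * \<tau>) 0"
proof -
  let ?\<sigma> = "of_int N ^ 2 * \<tau>"
  have \<sigma>: "Im ?\<sigma> > 0" by (rule Im_square_times_pos[OF \<tau> N])
  have "ee (- ((of_int i / of_int N + of_int k)\<^sup>2 / (2 * \<tau>))) = ee (- ((0 + of_int (N * k + i))\<^sup>2 / (2 * ?\<sigma>)))" for i k
  proof -
    have "(of_int i / of_int N + of_int k :: complex) = of_int (N * k + i) / of_int N"
      using N by (simp add: field_simps)
    then show ?thesis by (simp only: power_divide add_0) (simp add: ac_simps)
  qed
  then show ?thesis
    unfolding jgauss_def using infsum_residue_classes[OF summable_on_jgauss[OF \<sigma>, of 0] N] by simp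
qed

text \<open>The two distribution relations differ by the factor N; this is the homogeneity of degree
  1/2 in tau, seen on squares.\<close>

lemma jfactor_square:
  assumes \<tau>: "Im \<tau> > 0" and N: "N > 0"
  shows "jfactor (of_int N ^ 2 * \<tau>) = of_int N * jfactor \<tau>"
proof -
  let ?\<sigma> = "of_int N ^ 2 * \<tau>"
  have \<sigma>: "Im ?\<sigma> > 0" by (rule Im_square_times_pos[OF \<tau> N])
  have "jfactor ?\<sigma> * jtheta ?\<sigma> 0 = jfactor \<tau> * (of_int N * jtheta ?\<sigma> 0)"
    using sum_jgauss[OF \<tau> N]
    unfolding jgauss_eq_jfactor[OF \<tau>] jgauss_eq_jfactor[OF \<sigma>] sum_distrib_left[symmetric] sum_jtheta[OF \<tau> N] by (rule sym)
  then have "jfactor ?\<sigma> * jtheta ?\<sigma> 0 = (of_int N * jfactor \<tau>) * jtheta ?\<sigma> 0" by (simp only: ac_simps)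
  then show ?thesis using mult_right_cancel[OF jtheta_0_nonzero[OF \<sigma>]] by blast
qed

lemma holomorphic_jfactor: "jfactor holomorphic_on {\<tau>. Im \<tau> > 0}"
proof -
  have "(\<lambda>\<tau>. jtheta \<tau> 0) \<circ> (\<lambda>\<tau>. - 1 / \<tau>) holomorphic_on {\<tau>. Im \<tau> > 0}"
    using Im_minus_inverse_pos
    by (intro holomorphic_on_compose holomorphic_intros holomorphic_on_subset[OF holomorphic_jtheta_tau]) auto
  then have "(\<lambda>\<tau>. jtheta (- 1 / \<tau>) 0 / jtheta \<tau> 0) holomorphic_on {\<tau>. Im \<tau> > 0}"
    unfolding o_def using jtheta_0_nonzero by (intro holomorphic_intros holomorphic_jtheta_tau) auto
  then show ?thesis by (simp add: jfactor_def[abs_def])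
qed

text \<open>Scaling \<open>\<tau>\<close> by the square of a rational number pins down the automorphy factor on a sequence
  accumulating at \<open>\<i>\<close>, hence everywhere.\<close>

lemma jfactor_eq:
  assumes \<tau>: "Im \<tau> > 0"
  shows "jfactor \<tau> = jfactor \<i> * (- \<i> * \<tau>) powr (1 / 2)"
proof -
  let ?r = "\<lambda>n::nat. (real n + 2) / (real n + 1)"
  define U where "U = range (\<lambda>n. \<i> * of_real ((?r n)\<^sup>2))"
  let ?H = "{\<tau>. Im \<tau> > 0}"
  let ?f = "\<lambda>\<tau>. jfactor \<tau> - jfactor \<i> * (- \<i> * \<tau>) powr (1 / 2)"
  have "?f \<tau> = 0"
  proof (rule analytic_continuation[where f = ?f and S = ?H and U = U and \<xi> = \<i>])
    have "- \<i> * \<tau> \<notin> \<real>\<^sub>\<le>\<^sub>0" if "Im \<tau> > 0" for \<tau>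
      using that by (auto simp: complex_nonpos_Reals_iff)
    then show "?f holomorphic_on ?H"
      by (intro holomorphic_intros holomorphic_jfactor) auto
    show "open ?H" by (rule open_halfspace_Im_gt)
    show "connected ?H" by (intro convex_connected convex_halfspace_Im_gt)
    show "U \<subseteq> ?H" by (auto simp: U_def add_pos_pos)
    show "\<i> \<in> ?H" "\<tau> \<in> ?H" using \<tau> by auto
    show "\<i> islimpt U"
      unfolding islimpt_sequential
    proof (intro exI[of _ "\<lambda>n. \<i> * of_real ((?r n)\<^sup>2)"] conjI allI)
      fix n :: nat
      have "?r n > 1" by simp
      then have "(?r n)\<^sup>2 > 1" by (rule one_less_power) simp
      then have "(?r n)\<^sup>2 \<noteq> 1" by linarith
      then show "\<i> * of_real ((?r n)\<^sup>2) \<in> U - {\<i>}"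
        unfolding U_def by (auto simp: complex_eq_iff)
    next
      have "(\<lambda>n. ?r n) \<longlonglongrightarrow> 1"
      proof -
        have "(\<lambda>n. 1 + 1 / real (Suc n)) \<longlonglongrightarrow> 1 + 0"
          by (intro tendsto_intros LIMSEQ_Suc[OF lim_1_over_n])
        moreover have "1 + 1 / real (Suc n) = ?r n" for n
          by (simp add: field_simps)
        ultimately show ?thesis by simp
      qed
      then have "(\<lambda>n. \<i> * of_real ((?r n)\<^sup>2)) \<longlonglongrightarrow> \<i> * of_real (1\<^sup>2)"
        by (intro tendsto_intros)
      then show "(\<lambda>n. \<i> * of_real ((?r n)\<^sup>2)) \<longlonglongrightarrow> \<i>" by simp
    qed
    fix z assume "z \<in> U"
    then obtain n :: nat where z: "z = \<i> * of_real (((real n + 2) / (real n + 1))\<^sup>2)" by (auto simp: U_def)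
    define a where "a = int n + 2"
    define b where "b = int n + 1"
    have ab: "a > 0" "b > 0" by (auto simp: a_def b_def)
    \<comment> \<open>A common source of both points: scaling by a^2 gives z, scaling by b^2 gives
      the point at which the factor is normalised.\<close>
    define \<sigma> where "\<sigma> = \<i> * of_real (1 / of_int b ^ 2)"
    have \<sigma>: "Im \<sigma> > 0" using ab by (simp add: \<sigma>_def)
    have z': "z = \<i> * of_real ((of_int a / of_int b)\<^sup>2)" by (simp add: z a_def b_def)
    have "of_int a ^ 2 * \<sigma> = z" "of_int b ^ 2 * \<sigma> = \<i>"
      using ab by (simp_all add: \<sigma>_def z' power_divide)
    then have "jfactor z = of_int a * jfactor \<sigma>" "jfactor \<i> = of_int b * jfactor \<sigma>"
      using jfactor_square[OF \<sigma> ab(1)] jfactor_square[OF \<sigma> ab(2)] by simp_all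
    moreover have "(- \<i> * z) powr (1 / 2) = of_int a / of_int b"
    proof -
      define r where "r = (real n + 2) / (real n + 1)"
      have r: "r > 0" by (simp add: r_def)
      have "- \<i> * z = of_real (r\<^sup>2)" by (simp add: z r_def)
      then have "(- \<i> * z) powr (1 / 2) = of_real ((r\<^sup>2) powr (1 / 2))"
        using powr_of_real[of "r\<^sup>2" "1 / 2"] by simp
      also have "(r\<^sup>2) powr (1 / 2) = r"
        using r by (simp add: powr_half_sqrt)
      finally show ?thesis by (simp add: r_def a_def b_def)
    qed
    ultimately show "?f z = 0" using ab by simp
  qed
  then show ?thesis by simp
qed

lemma powr_half_scale:
  fixes z :: complex
  assumes "r > 0" "z \<noteq> 0"
  shows "(of_real r * z) powr (1 / 2) = of_real (sqrt r) * z powr (1 / 2)"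
proof -
  have "(of_real r * z) powr (1 / 2) = exp (1 / 2 * (of_real (ln r) + Ln z))"
    using assms by (simp add: powr_def Ln_times_of_real Ln_of_real)
  also have "\<dots> = exp (of_real (1 / 2 * ln r)) * exp (1 / 2 * Ln z)"
    by (simp add: exp_add[symmetric] field_simps)
  also have "exp (complex_of_real (1 / 2 * ln r)) = of_real (sqrt r)"
  proof -
    have "exp (1 / 2 * ln r) = sqrt r" using assms by (simp add: powr_half_sqrt[symmetric] powr_def)
    then show ?thesis by (metis exp_of_real)
  qed
  finally show ?thesis using assms by (simp add: powr_def)
qed

section \<open>Modular transformation of the generating function\<close>


lemma quadE_eq_square:
  assumes "m \<ge> 0"
  shows "quadE m \<nu> x = (of_int (2 * m + 1) * x + of_int \<nu> + 1 / 2)\<^sup>2 / (2 * of_int (2 * m + 1))"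
proof -
  define M :: complex where "M = of_int (2 * m + 1)"
  have "2 * m + 1 \<noteq> 0" using assms by simp
  then have M: "M \<noteq> 0" unfolding M_def by (simp only: of_int_eq_0_iff not_False_eq_True)
  define y :: complex where "y = of_int \<nu> + 1 / 2"
  have "M / 2 * x\<^sup>2 + x * y + y\<^sup>2 / (2 * M) = (M * x + y)\<^sup>2 / (2 * M)"
    using M by (simp add: power2_eq_square field_simps)
  then show ?thesis by (simp only: quadE_def M_def y_def add.assoc)
qed

text \<open>Completing the square absorbs the sign (-1)^k into a shift of the argument by sigma / 2,
  after which the inversion of theta applies.\<close>

lemma infsum_jgauss_sign:
  assumes \<sigma>: "Im \<sigma> > 0"
  shows "(\<Sum>\<^sub>\<infinity>k::int. ee (of_int k / 2 - (of_int k + x)\<^sup>2 / (2 * \<sigma>)))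
     = jfactor \<sigma> * (\<Sum>\<^sub>\<infinity>k::int. ee (\<sigma> * (of_int k + 1 / 2)\<^sup>2 / 2 - (of_int k + 1 / 2) * x))"
    (is "?X = _ * ?Y")
proof -
  have \<sigma>0: "\<sigma> \<noteq> 0" using \<sigma> by auto
  have "?X
      = ee (\<sigma> / 8 - x / 2) * jgauss \<sigma> (x - \<sigma> / 2)"
    unfolding jgauss_def infsum_cmult_right'[symmetric] ee_add[symmetric]
    using \<sigma>0 by (intro infsum_cong arg_cong[of _ _ ee]) (simp add: power2_eq_square field_simps)
  also have "jgauss \<sigma> (x - \<sigma> / 2) = jfactor \<sigma> * jtheta \<sigma> (\<sigma> / 2 - x)"
    unfolding jgauss_eq_jfactor[OF \<sigma>] using jtheta_minus[of \<sigma> "\<sigma> / 2 - x"] by simp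
  also have "ee (\<sigma> / 8 - x / 2) * (jfactor \<sigma> * jtheta \<sigma> (\<sigma> / 2 - x)) = jfactor \<sigma> * (ee (\<sigma> / 8 - x / 2) * jtheta \<sigma> (\<sigma> / 2 - x))"
    by (simp only: ac_simps)
  also have "ee (\<sigma> / 8 - x / 2) * jtheta \<sigma> (\<sigma> / 2 - x) = ?Y"
    unfolding jtheta_def infsum_cmult_right'[symmetric] ee_add[symmetric]
    by (intro infsum_cong arg_cong[of _ _ ee]) (simp add: power2_eq_square field_simps)
  finally show ?thesis .
qed

abbreviation S_entry :: "int \<Rightarrow> int \<Rightarrow> int \<Rightarrow> complex" where
  "S_entry m \<nu> \<mu> \<equiv> ee (- ((of_int \<mu> + 1 / 2) * (of_int \<nu> + 1 / 2) / of_int (2 * m + 1)))"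

text \<open>With M = 2 m + 1 the left side is a signed Gaussian sum with parameter tau / M. Its
  inversion is a theta series over all k + 1/2, and sorting k by its residue mu modulo M gives the M
  functions on the right.\<close>

lemma vth_S:
  assumes \<tau>: "Im \<tau> > 0" and m: "m \<ge> 0"
  shows "vth m \<nu> (- 1 / \<tau>) (w / \<tau>) = jfactor (\<tau> / of_int (2 * m + 1)) * ee (of_int (2 * m + 1) * w\<^sup>2 / (2 * \<tau>))
    * (\<Sum>\<mu>\<in>{0..<2 * m + 1}. S_entry m \<nu> \<mu> * vth m \<mu> \<tau> w)"
proof -
  define M :: complex where "M = of_int (2 * m + 1)"
  have M1: "2 * m + 1 > 0" using m by simp
  then have M: "M \<noteq> 0" unfolding M_def by (simp only: of_int_eq_0_iff)
  have \<tau>0: "\<tau> \<noteq> 0" using \<tau> by auto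
  define y :: complex where "y = of_int \<nu> + 1 / 2"
  define x where "x = y / M - w"
  define \<sigma> where "\<sigma> = \<tau> / M"
  have "Im \<sigma> = Im \<tau> / of_int (2 * m + 1)"
    using Im_divide_of_real[of \<tau> "of_int (2 * m + 1)"]
    by (simp only: of_real_of_int_eq \<sigma>_def M_def)
  also have "\<dots> > 0" using \<tau> m by simp
  finally have \<sigma>: "Im \<sigma> > 0" .
  have "vth m \<nu> (- 1 / \<tau>) (w / \<tau>) = ee (M * w\<^sup>2 / (2 * \<tau>)) * (\<Sum>\<^sub>\<infinity>k::int. ee (of_int k / 2 - (of_int k + x)\<^sup>2 / (2 * \<sigma>)))"
    unfolding vth_def infsum_cmult_right'[symmetric] ee_add[symmetric] quadE_eq_square[OF m]
  proof (intro infsum_cong arg_cong[of _ _ ee])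
    fix k :: int
    have "of_int ((2 * m + 1) * k + \<nu>) + 1 / 2 = M * of_int k + y" by (simp add: M_def y_def)
    then show "of_int k / 2 + - 1 / \<tau> * ((of_int (2 * m + 1) * of_int k + of_int \<nu> + 1 / 2)\<^sup>2 / (2 * of_int (2 * m + 1)))
         + (of_int ((2 * m + 1) * k + \<nu>) + 1 / 2) * (w / \<tau>)
       = M * w\<^sup>2 / (2 * \<tau>) + (of_int k / 2 - (of_int k + x)\<^sup>2 / (2 * \<sigma>))"
      unfolding M_def[symmetric] x_def \<sigma>_def add.assoc y_def[symmetric]
      using \<tau>0 M by (simp only:) (simp add: power2_eq_square field_simps)
  qed
  also have "(\<Sum>\<^sub>\<infinity>k::int. ee (of_int k / 2 - (of_int k + x)\<^sup>2 / (2 * \<sigma>)))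
      = jfactor \<sigma> * (\<Sum>\<^sub>\<infinity>k::int. ee (\<sigma> * (of_int k + 1 / 2)\<^sup>2 / 2 - (of_int k + 1 / 2) * x))"
    by (rule infsum_jgauss_sign[OF \<sigma>])
  also have "(\<Sum>\<^sub>\<infinity>k::int. ee (\<sigma> * (of_int k + 1 / 2)\<^sup>2 / 2 - (of_int k + 1 / 2) * x))
      = (\<Sum>\<mu>\<in>{0..<2 * m + 1}. ee (- ((of_int \<mu> + 1 / 2) * y / M)) * vth m \<mu> \<tau> w)"
  proof -
    let ?F = "\<lambda>k::int. ee (\<sigma> * (of_int k + 1 / 2)\<^sup>2 / 2 - (of_int k + 1 / 2) * x)"
    have "(\<lambda>k::int. ee (\<sigma> / 8 - x / 2) * jtheta_term \<sigma> (\<sigma> / 2 - x) k) summable_on UNIV"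
      by (intro summable_on_cmult_right summable_on_jtheta \<sigma>)
    then have F: "?F summable_on UNIV"
      by (rule summable_on_cong[THEN iffD1, rotated])
        (unfold ee_add[symmetric], rule arg_cong[of _ _ ee], simp add: power2_eq_square field_simps)
    have "(\<Sum>\<^sub>\<infinity>k. ?F ((2 * m + 1) * k + \<mu>)) = ee (- ((of_int \<mu> + 1 / 2) * y / M)) * vth m \<mu> \<tau> w" for \<mu>
      unfolding vth_def infsum_cmult_right'[symmetric] ee_add[symmetric] quadE_eq_square[OF m]
    proof (intro infsum_cong ee_cong)
      fix k :: int
      define c :: complex where "c = of_int \<mu> + 1 / 2"
      have c: "of_int ((2 * m + 1) * k + \<mu>) + 1 / 2 = M * of_int k + c" by (simp add: M_def c_def)
      have "\<sigma> * (M * of_int k + c)\<^sup>2 / 2 - (M * of_int k + c) * x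
         - (- (c * y / M) + (of_int k / 2 + \<tau> * ((M * of_int k + c)\<^sup>2 / (2 * M)) + (M * of_int k + c) * w))
         = - of_int k * y - of_int k / 2"
        unfolding x_def \<sigma>_def using M by (simp add: power2_eq_square field_simps)
      also have "\<dots> = of_int (- (k * (\<nu> + 1)))" by (simp add: y_def field_simps)
      finally show "\<sigma> * (of_int ((2 * m + 1) * k + \<mu>) + 1 / 2)\<^sup>2 / 2 - (of_int ((2 * m + 1) * k + \<mu>) + 1 / 2) * x
         - (- ((of_int \<mu> + 1 / 2) * y / M) + (of_int k / 2 + \<tau> * ((of_int (2 * m + 1) * of_int k + of_int \<mu> + 1 / 2)\<^sup>2 / (2 * of_int (2 * m + 1)))
              + (of_int ((2 * m + 1) * k + \<mu>) + 1 / 2) * w)) = of_int (- (k * (\<nu> + 1)))"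
        unfolding M_def[symmetric] c add.assoc c_def[symmetric] by (simp only: add.assoc)
    qed
    then show ?thesis using infsum_residue_classes[OF F M1] by simp
  qed
  finally show ?thesis unfolding M_def y_def \<sigma>_def by (simp only: ac_simps)
qed

abbreviation T_entry :: "int \<Rightarrow> int \<Rightarrow> complex" where
  "T_entry m \<nu> \<equiv> ee ((of_int \<nu> + 1 / 2)\<^sup>2 / (2 * of_int (2 * m + 1)))"

text \<open>Apart from the constant term, \<open>quadE\<close> takes integer values here: it is m
  j^2 + j nu + j (j + 1) / 2, and j (j + 1) is even.\<close>

lemma vth_T: "vth m \<nu> (\<tau> + 1) w = T_entry m \<nu> * vth m \<nu> \<tau> w"
proof -
  define \<kappa> :: complex where "\<kappa> = (of_int \<nu> + 1 / 2)\<^sup>2 / (2 * of_int (2 * m + 1))"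
  have q: "quadE m \<nu> x = of_int (2 * m + 1) / 2 * x\<^sup>2 + x * (of_int \<nu> + 1 / 2) + \<kappa>" for x
    by (simp only: quadE_def \<kappa>_def)
  have "ee (of_int j / 2 + (\<tau> + 1) * quadE m \<nu> (of_int j) + (of_int ((2 * m + 1) * j + \<nu>) + 1 / 2) * w)
     = ee (\<kappa> + (of_int j / 2 + \<tau> * quadE m \<nu> (of_int j) + (of_int ((2 * m + 1) * j + \<nu>) + 1 / 2) * w))" for j
  proof -
    have "even (j * (j + 1))" by simp
    then obtain l where "j * (j + 1) = 2 * l" by blast
    then have l: "(of_int j * (of_int j + 1) :: complex) = 2 * of_int l"
      by (metis of_int_1 of_int_add of_int_mult of_int_numeral)
    have "of_int j / 2 + (\<tau> + 1) * quadE m \<nu> (of_int j) + (of_int ((2 * m + 1) * j + \<nu>) + 1 / 2) * w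
      - (\<kappa> + (of_int j / 2 + \<tau> * quadE m \<nu> (of_int j) + (of_int ((2 * m + 1) * j + \<nu>) + 1 / 2) * w))
      = of_int m * (of_int j)\<^sup>2 + of_int j * of_int \<nu> + (of_int j * (of_int j + 1)) / 2"
      unfolding q by (simp add: power2_eq_square field_simps)
    also have "\<dots> = of_int (m * j\<^sup>2 + j * \<nu> + l)" unfolding l by simp
    finally show ?thesis by (rule ee_cong)
  qed
  then show ?thesis
    unfolding vth_def \<kappa>_def[symmetric] infsum_cmult_right'[symmetric] ee_add[symmetric] by simp
qed

lemma vth_quot_T:
  assumes \<tau>: "Im \<tau> > 0"
  shows "vth_quot (\<tau> + 1) w = vth_quot \<tau> w"
proof -
  define c where "c = ee ((of_int 0 + 1 / 2)\<^sup>2 / (2 * of_int (2 * 0 + 1)))"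
  have T: "vth 0 0 (\<tau> + 1) = (\<lambda>w. c * vth 0 0 \<tau> w)"
    unfolding c_def by (rule ext, rule vth_T)
  have "((\<lambda>w. c * vth 0 0 \<tau> w) has_field_derivative c * dvth0 \<tau>) (at 0)"
    by (intro DERIV_cmult vth_0_0_has_field_derivative \<tau>)
  then have "dvth0 (\<tau> + 1) = c * dvth0 \<tau>" unfolding dvth0_def[of "\<tau> + 1"] T by (rule DERIV_imp_deriv)
  then show ?thesis by (simp add: vth_quot_def T c_def)
qed

lemma jfactor_nonzero: "Im \<tau> > 0 \<Longrightarrow> jfactor \<tau> \<noteq> 0"
  using jtheta_0_nonzero[of \<tau>] jtheta_0_nonzero[OF Im_minus_inverse_pos, of \<tau>] by (simp add: jfactor_def)

text \<open>The multiplier of theta cancels between numerator and denominator. Differentiating the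
  inversion at w = 0 leaves a factor tau, the weight 1 of the quotient.\<close>

lemma vth_quot_S:
  assumes \<tau>: "Im \<tau> > 0"
  shows "vth_quot (- 1 / \<tau>) (w / \<tau>) = \<tau> * ee (- (w\<^sup>2 / (2 * \<tau>))) * vth_quot \<tau> w"
proof -
  have \<tau>0: "\<tau> \<noteq> 0" using \<tau> by auto
  let ?\<sigma> = "- 1 / \<tau>"
  define c where "c = jfactor \<tau> * ee (- 1 / 4)"
  have c: "c \<noteq> 0" using jfactor_nonzero[OF \<tau>] by (simp add: c_def)
  have S: "vth 0 0 ?\<sigma> (w / \<tau>) = c * ee (w\<^sup>2 / (2 * \<tau>)) * vth 0 0 \<tau> w" for w
  proof -
    have "{0..<2 * 0 + 1 :: int} = {0}" by auto
    then show ?thesis using vth_S[OF \<tau>, of 0 0 w] by (simp add: c_def)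
  qed
  have "((\<lambda>w. c * ee (w\<^sup>2 / (2 * \<tau>)) * vth 0 0 \<tau> w) has_field_derivative
      c * dvth0 \<tau>) (at 0)"
  proof -
    have "(\<lambda>w. c * ee (w\<^sup>2 / (2 * \<tau>))) holomorphic_on UNIV" using \<tau>0 by (intro holomorphic_intros) auto
    then have "((\<lambda>w. c * ee (w\<^sup>2 / (2 * \<tau>))) has_field_derivative deriv (\<lambda>w. c * ee (w\<^sup>2 / (2 * \<tau>))) 0) (at 0)"
      by (rule holomorphic_derivI) auto
    from DERIV_mult[OF this vth_0_0_has_field_derivative[OF \<tau>]] show ?thesis
      by (simp add: vth_0_0_at_0 mult.commute)
  qed
  moreover have "((\<lambda>w. vth 0 0 ?\<sigma> (w / \<tau>)) has_field_derivative dvth0 ?\<sigma> * (1 / \<tau>)) (at 0)"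
  proof -
    have "(vth 0 0 ?\<sigma> has_field_derivative dvth0 ?\<sigma>) (at (0 / \<tau>))"
      using vth_0_0_has_field_derivative[OF Im_minus_inverse_pos[OF \<tau>]] by simp
    moreover have "((\<lambda>w. w / \<tau>) has_field_derivative 1 / \<tau>) (at 0)"
      by (intro DERIV_cdivide DERIV_ident)
    ultimately show ?thesis by (rule DERIV_chain2)
  qed
  ultimately have "c * dvth0 \<tau> = dvth0 ?\<sigma> * (1 / \<tau>)"
    unfolding S by (rule DERIV_unique)
  then have d: "dvth0 ?\<sigma> = \<tau> * (c * dvth0 \<tau>)" using \<tau>0 by (simp add: field_simps)
  show ?thesis
    unfolding vth_quot_def S d using c by (simp add: ee_minus field_simps)
qed

section \<open>The Jacobi form and its translates by torsion points\<close>

definition Psi :: "int \<Rightarrow> int \<Rightarrow> complex \<Rightarrow> complex \<Rightarrow> complex" where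
  "Psi m \<nu> \<tau> z = vth m \<nu> \<tau> (z / 2) * vth_quot \<tau> (z / 2)"

lemma Psi_T:
  assumes \<tau>: "Im \<tau> > 0"
  shows "Psi m \<nu> (\<tau> + 1) z = T_entry m \<nu> * Psi m \<nu> \<tau> z"
  by (simp only: Psi_def vth_T vth_quot_T[OF \<tau>] mult.assoc)

text \<open>The Gaussian exponents (2 m + 1) w^2 / (2 tau) of theta and - w^2 / (2 tau) of the
  quotient add up to m w^2 / tau, where w = z / 2.\<close>

lemma Psi_S:
  assumes \<tau>: "Im \<tau> > 0" and m: "m \<ge> 0"
  shows "Psi m \<nu> (- 1 / \<tau>) (z / \<tau>) = jfactor (\<tau> / of_int (2 * m + 1)) * \<tau> * ee (of_int m * z\<^sup>2 / (4 * \<tau>))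
    * (\<Sum>\<mu>\<in>{0..<2 * m + 1}. S_entry m \<nu> \<mu> * Psi m \<mu> \<tau> z)"
proof -
  let ?s = "\<lambda>\<mu>. S_entry m \<nu> \<mu>"
  have \<tau>0: "\<tau> \<noteq> 0" using \<tau> by auto
  have "ee (of_int (2 * m + 1) * (z / 2)\<^sup>2 / (2 * \<tau>)) * ee (- ((z / 2)\<^sup>2 / (2 * \<tau>))) = ee (of_int m * z\<^sup>2 / (4 * \<tau>))"
    unfolding ee_add[symmetric] using \<tau>0 by (intro arg_cong[of _ _ ee]) (simp add: power2_eq_square field_simps)
  then have e: "ee (of_int m * z\<^sup>2 / (4 * \<tau>)) = ee (of_int (2 * m + 1) * (z / 2)\<^sup>2 / (2 * \<tau>)) * ee (- ((z / 2)\<^sup>2 / (2 * \<tau>)))" ..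
  have "Psi m \<nu> (- 1 / \<tau>) (z / \<tau>) = vth m \<nu> (- 1 / \<tau>) ((z / 2) / \<tau>) * vth_quot (- 1 / \<tau>) ((z / 2) / \<tau>)"
    by (simp add: Psi_def mult.commute)
  also have "\<dots> = jfactor (\<tau> / of_int (2 * m + 1)) * ee (of_int (2 * m + 1) * (z / 2)\<^sup>2 / (2 * \<tau>))
      * (\<Sum>\<mu>\<in>{0..<2 * m + 1}. ?s \<mu> * vth m \<mu> \<tau> (z / 2)) * (\<tau> * ee (- ((z / 2)\<^sup>2 / (2 * \<tau>))) * vth_quot \<tau> (z / 2))"
    unfolding vth_S[OF \<tau> m] vth_quot_S[OF \<tau>] ..
  also have "\<dots> = jfactor (\<tau> / of_int (2 * m + 1)) * \<tau> * ee (of_int m * z\<^sup>2 / (4 * \<tau>))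
      * ((\<Sum>\<mu>\<in>{0..<2 * m + 1}. ?s \<mu> * vth m \<mu> \<tau> (z / 2)) * vth_quot \<tau> (z / 2))"
    unfolding e by (simp only: ac_simps)
  finally show ?thesis by (simp only: Psi_def sum_distrib_right mult.assoc)
qed

lemma Psi_plus_2tau: "Psi m \<nu> \<tau> (z + 2 * \<tau>) = ee (- of_int m * (\<tau> + z)) * Psi m \<nu> \<tau> z"
proof -
  have z: "(z + 2 * \<tau>) / 2 = z / 2 + \<tau>" by (simp add: field_simps)
  have "ee (- of_int (2 * m + 1) * (\<tau> / 2 + z / 2)) = ee (- of_int (2 * 0 + 1) * (\<tau> / 2 + z / 2)) * ee (- of_int m * (\<tau> + z))"
    unfolding ee_add[symmetric] by (rule arg_cong[of _ _ ee]) (simp add: field_simps)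
  then show ?thesis
    unfolding Psi_def z vth_quot_def vth_plus_tau by (simp only:) simp
qed

text \<open>The elliptic factor is that of \<open>F_fun\<close>. The symmetric normalisation by e(a
  b / (4 m)) is absent, and this is the source of the root of unity depending on a in
  \<open>PsiT_T\<close> and of \<open>zeta_inv\<close> in \<open>PsiT_S\<close>.\<close>

definition PsiT :: "int \<Rightarrow> int \<Rightarrow> int \<Rightarrow> int \<Rightarrow> complex \<Rightarrow> complex \<Rightarrow> complex" where
  "PsiT m \<nu> a b \<tau> z = ee (of_int a * z / 2 + \<tau> * (of_int a)\<^sup>2 / (4 * of_int m)) * Psi m \<nu> \<tau> (z + (of_int a * \<tau> + of_int b) / of_int m)"

lemma PsiT_plus_a:
  assumes "m > 0"
  shows "PsiT m \<nu> (a + 2 * m) b \<tau> z = PsiT m \<nu> a b \<tau> z"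
proof -
  let ?z = "z + (of_int a * \<tau> + of_int b) / of_int m"
  have z: "z + (of_int (a + 2 * m) * \<tau> + of_int b) / of_int m = ?z + 2 * \<tau>"
    using assms by (simp add: field_simps)
  have "ee (of_int (a + 2 * m) * z / 2 + \<tau> * (of_int (a + 2 * m))\<^sup>2 / (4 * of_int m)) * ee (- of_int m * (\<tau> + ?z))
      = ee (of_int a * z / 2 + \<tau> * (of_int a)\<^sup>2 / (4 * of_int m))"
    unfolding ee_add[symmetric] using assms
    by (intro ee_cong[where k = "- b"]) (simp add: power2_eq_square field_simps)
  then show ?thesis unfolding PsiT_def z Psi_plus_2tau by (simp only: mult.assoc[symmetric])
qed

lemma PsiT_T:
  assumes \<tau>: "Im \<tau> > 0" and m: "m > 0"
  shows "PsiT m \<nu> a b (\<tau> + 1) z = T_entry m \<nu> * ee ((of_int a)\<^sup>2 / (4 * of_int m))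
    * PsiT m \<nu> a (a + b) \<tau> z"
proof -
  have z: "z + (of_int a * (\<tau> + 1) + of_int b) / of_int m = z + (of_int a * \<tau> + of_int (a + b)) / of_int m"
    by (simp add: algebra_simps)
  have "ee (of_int a * z / 2 + (\<tau> + 1) * (of_int a)\<^sup>2 / (4 * of_int m))
      = ee ((of_int a)\<^sup>2 / (4 * of_int m)) * ee (of_int a * z / 2 + \<tau> * (of_int a)\<^sup>2 / (4 * of_int m))"
    unfolding ee_add[symmetric] using m by (intro arg_cong[of _ _ ee]) (simp add: field_simps)
  then show ?thesis unfolding PsiT_def z Psi_T[OF \<tau>] by (simp only: ac_simps)
qed

abbreviation zeta_inv :: "int \<Rightarrow> int \<Rightarrow> int \<Rightarrow> complex" where
  "zeta_inv m n b \<equiv> ee (- (of_int n * of_int b / (2 * of_int m)))"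

text \<open>After rescaling z by tau the torsion point (a, b) becomes (b, -a). Expanding the
  Gaussian of \<open>Psi_S\<close> at the translated argument yields an even Gaussian in z, the
  elliptic factor for b, and a root of unity.\<close>

lemma PsiT_S:
  assumes \<tau>: "Im \<tau> > 0" and m: "m > 0"
  shows "PsiT m \<nu> a b (- 1 / \<tau>) (z / \<tau>) = jfactor (\<tau> / of_int (2 * m + 1)) * \<tau> * ee (of_int m * z\<^sup>2 / (4 * \<tau>))
    * (\<Sum>\<mu>\<in>{0..<2 * m + 1}. zeta_inv m a b
         * S_entry m \<nu> \<mu> * PsiT m \<mu> b (- a) \<tau> z)"
proof -
  have \<tau>0: "\<tau> \<noteq> 0" using \<tau> by auto
  let ?z = "z + (of_int b * \<tau> + of_int (- a)) / of_int m"
  let ?s = "\<lambda>\<mu>. S_entry m \<nu> \<mu>"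
  let ?e = "ee (of_int b * z / 2 + \<tau> * (of_int b)\<^sup>2 / (4 * of_int m))"
  have z: "z / \<tau> + (of_int a * (- 1 / \<tau>) + of_int b) / of_int m = ?z / \<tau>"
    using \<tau>0 m by (simp add: field_simps)
  have e: "ee (of_int a * (z / \<tau>) / 2 + - 1 / \<tau> * (of_int a)\<^sup>2 / (4 * of_int m)) * ee (of_int m * ?z\<^sup>2 / (4 * \<tau>))
     = ee (of_int m * z\<^sup>2 / (4 * \<tau>)) * (zeta_inv m a b * ?e)"
    unfolding ee_add[symmetric] using \<tau>0 m
    by (intro arg_cong[of _ _ ee]) (simp add: power2_eq_square field_simps)
  have "PsiT m \<nu> a b (- 1 / \<tau>) (z / \<tau>) = (ee (of_int a * (z / \<tau>) / 2 + - 1 / \<tau> * (of_int a)\<^sup>2 / (4 * of_int m)) * ee (of_int m * ?z\<^sup>2 / (4 * \<tau>)))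
     * (jfactor (\<tau> / of_int (2 * m + 1)) * \<tau> * (\<Sum>\<mu>\<in>{0..<2 * m + 1}. ?s \<mu> * Psi m \<mu> \<tau> ?z))"
    unfolding PsiT_def z using m by (subst Psi_S[OF \<tau>]) (simp_all only: ac_simps less_imp_le)
  also have "\<dots> = jfactor (\<tau> / of_int (2 * m + 1)) * \<tau> * ee (of_int m * z\<^sup>2 / (4 * \<tau>))
     * (\<Sum>\<mu>\<in>{0..<2 * m + 1}. zeta_inv m a b * ?e * (?s \<mu> * Psi m \<mu> \<tau> ?z))"
    unfolding e sum_distrib_left by (intro sum.cong refl) (simp only: ac_simps)
  also have "(\<Sum>\<mu>\<in>{0..<2 * m + 1}. zeta_inv m a b * ?e * (?s \<mu> * Psi m \<mu> \<tau> ?z))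
     = (\<Sum>\<mu>\<in>{0..<2 * m + 1}. zeta_inv m a b * ?s \<mu> * PsiT m \<mu> b (- a) \<tau> z)"
    unfolding PsiT_def by (simp only: ac_simps)
  finally show ?thesis .
qed

section \<open>Fourier expansion of the functions G\<close>


lemma theta_minus_eq_vth:
  fixes m \<nu> :: int
  assumes m: "m \<ge> 0"
  shows "theta_minus (of_int \<nu> + 1 / 2) (of_int m + 1 / 2) \<tau> z = vth m \<nu> \<tau> (z / 2)"
  unfolding theta_minus_def vth_def
proof (rule infsum_cong)
  fix k :: int
  define c :: real where "c = of_int m + 1 / 2"
  define r :: real where "r = of_int k + (of_int \<nu> + 1 / 2) / (2 * c)"
  have c: "c > 0" using m by (simp add: c_def)
  have cr: "c * r = (of_int ((2 * m + 1) * k + \<nu>) + 1 / 2) / 2"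
    using c unfolding r_def by (simp add: field_simps) (simp add: c_def algebra_simps)
  have "c * r\<^sup>2 = (c * r)\<^sup>2 / c" using c by (simp add: power2_eq_square)
  also have "\<dots> = (of_int (2 * m + 1) * of_int k + of_int \<nu> + 1 / 2)\<^sup>2 / (2 * of_int (2 * m + 1))"
    unfolding cr using m by (simp add: c_def power2_eq_square field_simps)
  finally have cr2: "of_real (c * r\<^sup>2) = quadE m \<nu> (of_int k)"
    unfolding quadE_eq_square[OF m] by simp
  have "exp (2 * of_real pi * \<i> * of_real c * of_real r * z) = ee (of_real (c * r) * z)"
    by (simp add: ee_def mult.assoc)
  then have "(- 1) powi k * exp (2 * of_real pi * \<i> * of_real c * of_real r * z) * qpow \<tau> (c * r\<^sup>2)
     = ee (of_int k / 2 + \<tau> * of_real (c * r\<^sup>2) + of_real (c * r) * z)"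
    by (simp add: ee_half_int[symmetric] qpow_eq_ee ee_add)
  also have "\<dots> = ee (of_int k / 2 + \<tau> * quadE m \<nu> (of_int k) + (of_int ((2 * m + 1) * k + \<nu>) + 1 / 2) * (z / 2))"
    unfolding cr2 cr by simp
  finally show "(- 1) powi k * exp (complex_of_real (2 * pi) * \<i> * complex_of_real (of_int m + 1 / 2) *
        complex_of_real (of_int k + (of_int \<nu> + 1 / 2) / (2 * (of_int m + 1 / 2))) * z) *
        qpow \<tau> ((of_int m + 1 / 2) * (of_int k + (of_int \<nu> + 1 / 2) / (2 * (of_int m + 1 / 2)))\<^sup>2)
     = ee (of_int k / 2 + \<tau> * quadE m \<nu> (of_int k) + (of_int ((2 * m + 1) * k + \<nu>) + 1 / 2) * (z / 2))"
    by (simp only: r_def c_def of_real_mult of_real_numeral)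
qed

lemma theta_has_sum:
  fixes m n :: int
  assumes \<tau>: "Im \<tau> > 0" and m: "m > 0"
  shows "((\<lambda>l::int. ee (of_int (n + 2 * m * l) * z / 2 + \<tau> * (of_int (n + 2 * m * l))\<^sup>2 / (4 * of_int m)))
    has_sum theta (of_int n) (of_int m) \<tau> z) UNIV"
proof -
  let ?f = "\<lambda>l::int. ee (of_int (n + 2 * m * l) * z / 2 + \<tau> * (of_int (n + 2 * m * l))\<^sup>2 / (4 * of_int m))"
  let ?k = "\<lambda>l::int. real_of_int n / (2 * real_of_int m) + real_of_int l"
  let ?g = "\<lambda>k. exp (complex_of_real (2 * pi) * \<i> * complex_of_real (real_of_int m) * complex_of_real k * z) *
      qpow \<tau> (real_of_int m * k\<^sup>2)"
  have "(\<lambda>l::int. ee (\<tau> * of_real (of_int m) * of_int l ^ 2 + of_int l * (\<tau> * of_int n + of_int m * z)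
      + (of_int n * z / 2 + \<tau> * (of_int n)\<^sup>2 / (4 * of_int m)))) summable_on UNIV"
    using \<tau> m by (intro summable_on_ee_gauss) auto
  then have s: "?f summable_on UNIV"
    by (rule summable_on_cong[THEN iffD1, rotated])
      (rule arg_cong[of _ _ ee], use m in \<open>simp add: power2_eq_square field_simps\<close>)
  have "theta (of_int n) (of_int m) \<tau> z = infsum ?f UNIV"
    unfolding theta_def
  proof (subst infsum_reindex)
    show "inj_on ?k UNIV"
      by (simp add: inj_on_def)
    show "infsum (?g \<circ> ?k) UNIV = infsum ?f UNIV"
    proof (rule infsum_cong)
      fix l :: int
      define k where "k = real_of_int n / (2 * real_of_int m) + real_of_int l"
      have k: "real_of_int m * k = of_int (n + 2 * m * l) / 2" using m by (simp add: k_def field_simps)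
      have "real_of_int m * k\<^sup>2 = (real_of_int m * k)\<^sup>2 / real_of_int m" using m by (simp add: power2_eq_square)
      also have "\<dots> = (of_int (n + 2 * m * l))\<^sup>2 / (4 * of_int m)" unfolding k by (simp add: power_divide)
      finally have k2: "real_of_int m * k\<^sup>2 = (of_int (n + 2 * m * l))\<^sup>2 / (4 * of_int m)" .
      have "exp (complex_of_real (2 * pi) * \<i> * complex_of_real (real_of_int m) * complex_of_real k * z) = ee (of_real (real_of_int m * k) * z)"
        by (simp add: ee_def mult.assoc)
      then have "exp (complex_of_real (2 * pi) * \<i> * complex_of_real (real_of_int m) * complex_of_real k * z) * qpow \<tau> (real_of_int m * k\<^sup>2)
         = ?f l"
        unfolding k k2 qpow_eq_ee by (simp only: ee_add[symmetric]) (simp add: mult.commute)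
      then show "(?g \<circ> ?k) l = ?f l"
        by (simp only: o_def k_def)
    qed
  qed
  with s show ?thesis by (simp add: has_sum_iff)
qed

lemma infsum_qsign_split:
  fixes f :: "int \<times> int \<Rightarrow> complex"
  assumes "(\<lambda>(J, p). qsign (p - 1) (J - p) * f (J, p)) summable_on UNIV"
  shows "(\<Sum>\<^sub>\<infinity>(J, p). qsign (p - 1) (J - p) * f (J, p))
     = infsum f {(J, p). 0 < p \<and> p \<le> J} - infsum f {(J, p). J < p \<and> p \<le> 0}"
proof -
  let ?g = "\<lambda>(J, p). qsign (p - 1) (J - p) * f (J, p)"
  let ?A = "{(J::int, p::int). 0 < p \<and> p \<le> J}" and ?B = "{(J::int, p::int). J < p \<and> p \<le> 0}"
  have "infsum ?g UNIV = infsum ?g (?A \<union> ?B)"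
    by (rule infsum_cong_neutral) (auto simp: qsign_def split: if_splits)
  also have "\<dots> = infsum ?g ?A + infsum ?g ?B"
    by (rule infsum_Un_disjoint) (auto intro: summable_on_subset_banach[OF assms])
  also have "infsum ?g ?A = infsum f ?A" by (rule infsum_cong) (auto simp: qsign_def)
  also have "infsum ?g ?B = infsum (\<lambda>x. - f x) ?B" by (rule infsum_cong) (auto simp: qsign_def)
  finally show ?thesis by (simp add: infsum_uminus)
qed

text \<open>Completing the square turns - m r^2 + r N into - m (r - N / (2 m))^2 + N^2 / (4 m).
  Under r = p + nu + l and j = p - J + l all dependence on l sits in N^2 / (4 m), and the cuts r >=
  nu + l + 1 and j <= l become p > 0 and p <= J.\<close>

lemma psi_coeff_eq_g_fun:
  assumes \<tau>: "Im \<tau> > 0" and m: "m > 0"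
  shows "psi_coeff m \<nu> \<tau> (\<nu> + l + 1) l (n + 2 * m * l)
    = (- 1) powi \<nu> * ee (\<tau> * (of_int (n + 2 * m * l))\<^sup>2 / (4 * of_int m)) * g_fun m n \<nu> \<tau>"
proof -
  let ?N = "n + 2 * m * l"
  let ?c = "(- 1) powi \<nu> * ee (\<tau> * (of_int ?N)\<^sup>2 / (4 * of_int m))"
  define f where "f = (\<lambda>(J, p). (- 1) powi J * qpow \<tau> (Q_form m n \<nu> J p))"
  let ?h = "\<lambda>(J, p). qsign (p - 1) (J - p) * f (J, p)"
  have c0: "?c \<noteq> 0" by simp
  have eq: "psi_term m \<nu> \<tau> ?N (p - J + l) (p + \<nu> + l) = ?c * f (J, p)" for J p
  proof -
    define y :: complex where "y = of_int (2 * m + 1) * of_int (J + \<nu>) - (of_int \<nu> + 1 / 2)"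
    have "2 * m + 1 \<noteq> 0" using m by simp
    then have M: "(of_int (2 * m + 1) :: complex) \<noteq> 0" by (simp only: of_int_eq_0_iff not_False_eq_True)
    have q: "quadE m \<nu> (of_int ((p - J + l) - (p + \<nu> + l))) = y\<^sup>2 / (2 * of_int (2 * m + 1))"
    proof -
      have "of_int (2 * m + 1) * of_int ((p - J + l) - (p + \<nu> + l)) + of_int \<nu> + 1 / 2 = - y"
        by (simp add: y_def algebra_simps)
      then show ?thesis unfolding quadE_eq_square[OF less_imp_le[OF m]] by (simp only: power2_minus)
    qed
    have "complex_of_real (Q_form m n \<nu> J p)
        = (of_int m + 1 / 2) * (of_int J + of_int \<nu> - (of_int \<nu> + 1 / 2) / (2 * of_int m + 1))\<^sup>2
          - of_int m * (of_int p + of_int \<nu> - of_int n / (2 * of_int m))\<^sup>2"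
      unfolding Q_form_def by simp
    also have "(of_int m + 1 / 2) * (of_int J + of_int \<nu> - (of_int \<nu> + 1 / 2) / (2 * of_int m + 1))\<^sup>2 = y\<^sup>2 / (2 * of_int (2 * m + 1))"
    proof -
      define M :: complex where "M = of_int (2 * m + 1)"
      have "of_int m + 1 / 2 = M / 2" "2 * of_int m + 1 = M" by (simp_all add: M_def field_simps)
      moreover have "of_int J + of_int \<nu> - (of_int \<nu> + 1 / 2) / M = y / M"
      proof -
        have "M \<noteq> 0" unfolding M_def by (rule M)
        moreover have "y = M * of_int (J + \<nu>) - (of_int \<nu> + 1 / 2)" by (simp only: y_def M_def)
        ultimately show ?thesis by (simp add: diff_divide_distrib)
      qed
      ultimately show ?thesis
        using M by (simp only: M_def[symmetric]) (simp add: power2_eq_square)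
    qed
    finally have Q: "complex_of_real (Q_form m n \<nu> J p) = y\<^sup>2 / (2 * of_int (2 * m + 1))
          - of_int m * (of_int p + of_int \<nu> - of_int n / (2 * of_int m))\<^sup>2" .
    have "?c * f (J, p) = ee (of_int \<nu> / 2 + \<tau> * (of_int ?N)\<^sup>2 / (4 * of_int m) + (of_int J / 2 + \<tau> * of_real (Q_form m n \<nu> J p)))"
      by (simp add: f_def ee_half_int[symmetric] qpow_eq_ee ee_add)
    also have "\<dots> = psi_term m \<nu> \<tau> ?N (p - J + l) (p + \<nu> + l)"
      unfolding psi_term_def q Q
    proof (rule ee_cong[where k = "J - p - l"])
      define Y where "Y = y\<^sup>2 / (2 * of_int (2 * m + 1))"
      show "of_int \<nu> / 2 + \<tau> * (of_int ?N)\<^sup>2 / (4 * of_int m) + (of_int J / 2 + \<tau> * (y\<^sup>2 / (2 * of_int (2 * m + 1))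
          - of_int m * (of_int p + of_int \<nu> - of_int n / (2 * of_int m))\<^sup>2))
        - (of_int (p - J + l + (p + \<nu> + l)) / 2 + \<tau> * (y\<^sup>2 / (2 * of_int (2 * m + 1)) - of_int m * (of_int (p + \<nu> + l))\<^sup>2
          + of_int (p + \<nu> + l) * of_int ?N)) = of_int (J - p - l)"
        unfolding Y_def[symmetric] using m by (simp add: power2_eq_square field_simps)
    qed
    finally show ?thesis ..
  qed
  have eq': "(\<lambda>(J, p). ?c * (qsign (p - 1) (J - p) * f (J, p))) =
      (\<lambda>(j, r). qsign (r - (\<nu> + l + 1)) (l - j) * psi_term m \<nu> \<tau> ?N j r) \<circ> (\<lambda>(J, p). (p - J + l, p + \<nu> + l))"
  proof (rule ext)
    fix x :: "int \<times> int"
    obtain J p where x: "x = (J, p)" by (cases x)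
    have "(p + \<nu> + l) - (\<nu> + l + 1) = p - 1" "l - (p - J + l) = J - p" by simp_all
    then show "(case x of (J, p) \<Rightarrow> ?c * (qsign (p - 1) (J - p) * f (J, p))) =
      ((\<lambda>(j, r). qsign (r - (\<nu> + l + 1)) (l - j) * psi_term m \<nu> \<tau> ?N j r) \<circ> (\<lambda>(J, p). (p - J + l, p + \<nu> + l))) x"
      unfolding x o_def prod.case eq by (simp only: ac_simps)
  qed
  have bij: "bij (\<lambda>(J::int, p::int). (p - J + l, p + \<nu> + l))"
    by (rule bij_betwI[where g = "\<lambda>(j, r). (r - \<nu> - j, r - \<nu> - l)"]) auto
  have "(\<lambda>(J, p). ?c * (qsign (p - 1) (J - p) * f (J, p))) summable_on UNIV"
    unfolding eq' o_def using summable_on_reindex_bij_betw[OF bij] summable_on_qsign_psi_term[OF \<tau> less_imp_le[OF m]] by blast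
  then have "(\<lambda>x. inverse ?c * (case x of (J, p) \<Rightarrow> ?c * (qsign (p - 1) (J - p) * f (J, p)))) summable_on UNIV"
    by (rule summable_on_cmult_right)
  also have "(\<lambda>x. inverse ?c * (case x of (J, p) \<Rightarrow> ?c * (qsign (p - 1) (J - p) * f (J, p)))) = ?h"
  proof (rule ext)
    fix x :: "int \<times> int"
    obtain J p where x: "x = (J, p)" by (cases x)
    show "inverse ?c * (case x of (J, p) \<Rightarrow> ?c * (qsign (p - 1) (J - p) * f (J, p))) = ?h x"
      unfolding x prod.case
      by (simp only: mult.assoc[symmetric, of "inverse ?c" ?c] left_inverse[OF c0] mult_1_left)
  qed
  finally have s: "?h summable_on UNIV" .
  have "psi_coeff m \<nu> \<tau> (\<nu> + l + 1) l ?N = infsum ((\<lambda>(j, r). qsign (r - (\<nu> + l + 1)) (l - j) * psi_term m \<nu> \<tau> ?N j r) \<circ> (\<lambda>(J, p). (p - J + l, p + \<nu> + l))) UNIV"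
    unfolding psi_coeff_def o_def by (rule infsum_reindex_bij_betw[OF bij, symmetric])
  also have "\<dots> = ?c * infsum ?h UNIV"
    unfolding eq'[symmetric] infsum_cmult_right'[symmetric] by (rule infsum_cong) auto
  also have "infsum ?h UNIV = g_fun m n \<nu> \<tau>"
    unfolding infsum_qsign_split[OF s] by (simp only: g_fun_def f_def)
  finally show ?thesis .
qed

text \<open>The numerator after the substitution i = j + nu, which frees the denominator from nu and
  places the possible pole at z = 0 in the summand i = 0.\<close>

definition h_coeff :: "int \<Rightarrow> int \<Rightarrow> int \<Rightarrow> complex \<Rightarrow> complex \<Rightarrow> int \<Rightarrow> complex" where
  "h_coeff m n \<nu> \<tau> z i = ee (of_int (2 * m * (i - \<nu>) + n) * z / 2 + \<tau> * of_int (m * (i - \<nu>)\<^sup>2 + n * i))"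

lemma h_fun_eq:
  "h_fun m n \<nu> \<tau> z = (\<Sum>\<^sub>\<infinity>i. h_coeff m n \<nu> \<tau> z i / (1 - ee (of_int m * z + of_int i * (2 * of_int m * \<tau>))))"
  unfolding h_fun_def
proof (rule infsum_reindex_bij_witness[where i = "\<lambda>i. i - \<nu>" and j = "\<lambda>j. j + \<nu>"])
  fix j :: int
  have 1: "exp (complex_of_real (2 * pi) * \<i> * of_int m * of_int j * z + complex_of_real pi * \<i> * of_int n * z)
      = ee (of_int (2 * m * j + n) * z / 2)"
    unfolding ee_def by (rule arg_cong[of _ _ exp]) (simp add: algebra_simps)
  have 2: "exp (complex_of_real (2 * pi) * \<i> * of_int m * z) = ee (of_int m * z)"
    unfolding ee_def by (rule arg_cong[of _ _ exp]) (simp add: algebra_simps)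
  show "h_coeff m n \<nu> \<tau> z (j + \<nu>) / (1 - ee (of_int m * z + of_int (j + \<nu>) * (2 * of_int m * \<tau>)))
     = exp (complex_of_real (2 * pi) * \<i> * of_int m * of_int j * z + complex_of_real pi * \<i> * of_int n * z)
        * qpow \<tau> (real_of_int (m * j\<^sup>2 + n * (j + \<nu>)))
       / (1 - exp (complex_of_real (2 * pi) * \<i> * of_int m * z) * qpow \<tau> (real_of_int (2 * m * (j + \<nu>))))"
    unfolding 1 2 qpow_eq_ee h_coeff_def ee_add[symmetric] of_real_of_int_eq
    by (intro arg_cong2[of _ _ _ _ "(/)"] arg_cong2[of _ _ _ _ "(-)"] arg_cong[of _ _ ee] refl) (simp_all add: algebra_simps)
qed auto

lemma summable_on_h_coeff:
  assumes \<tau>: "Im \<tau> > 0" and m: "m > 0"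
  shows "h_coeff m n \<nu> \<tau> z summable_on UNIV"
proof -
  have "(\<lambda>i::int. ee (\<tau> * of_real (of_int m) * of_int i ^ 2 + of_int i * (of_int m * z + \<tau> * (of_int n - 2 * of_int m * of_int \<nu>))
      + (of_int (n - 2 * m * \<nu>) * z / 2 + \<tau> * of_int (m * \<nu>\<^sup>2)))) summable_on UNIV"
    using \<tau> m by (intro summable_on_ee_gauss) auto
  then show ?thesis
    unfolding h_coeff_def
    by (rule summable_on_cong[THEN iffD1, rotated])
      (rule arg_cong[of _ _ ee], simp add: power2_eq_square field_simps)
qed

text \<open>Every denominator is expanded geometrically with exponent t, and terms are collected by
  l = t + i - nu. For fixed l the sign condition leaves only finitely many i, exactly those of
  \<open>psi_coeff_diff\<close> for the cut nu + l + 1.\<close>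

lemma h_fun_has_sum:
  assumes z: "0 < Im z" "Im z < 2 * Im \<tau>" and m: "m > 0"
  shows "((\<lambda>l. ee (of_int (n + 2 * m * l) * z / 2) * (\<Sum>i\<in>{min 0 (\<nu> + l + 1)..<max 0 (\<nu> + l + 1)}.
      isign (\<nu> + l + 1) i * row_term m \<tau> (n + 2 * m * l) i))
    has_sum ee (- (\<tau> * of_int (m * \<nu>\<^sup>2))) * h_fun m n \<nu> \<tau> z) UNIV"
proof -
  let ?c = "h_coeff m n \<nu> \<tau> z" and ?\<omega> = "of_int m * z" and ?\<sigma> = "2 * of_int m * \<tau>"
  let ?E = "\<lambda>i t. ee (of_int t * ?\<omega> + of_int (i * t) * ?\<sigma>)"
  let ?row = "\<lambda>l i. isign (\<nu> + l + 1) i * row_term m \<tau> (n + 2 * m * l) i"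
  let ?C = "ee (- (\<tau> * of_int (m * \<nu>\<^sup>2)))"
  have \<tau>: "Im \<tau> > 0" using z by linarith
  have "Im ?\<omega> = real_of_int m * Im z" "Im ?\<sigma> = 2 * real_of_int m * Im \<tau>" by simp_all
  then have \<omega>: "0 < Im ?\<omega>" "Im ?\<omega> < Im ?\<sigma>" using z m by simp_all
  have sm: "(\<lambda>(i, t). qsign i t * ?c i * ?E i t) summable_on UNIV"
    by (rule summable_on_qsign_geometric[OF \<omega> summable_on_h_coeff[OF \<tau> m]])
  have "infsum (\<lambda>(i, t). qsign i t * ?c i * ?E i t) (Sigma UNIV (\<lambda>_. UNIV))
     = (\<Sum>\<^sub>\<infinity>i. \<Sum>\<^sub>\<infinity>t. qsign i t * ?c i * ?E i t)"
    using sm by (intro infsum_Sigma'_banach[symmetric]) simp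
  also have "\<dots> = (\<Sum>\<^sub>\<infinity>i. ?c i * (\<Sum>\<^sub>\<infinity>t. qsign i t * ?E i t))"
    unfolding infsum_cmult_right'[symmetric] by (simp only: ac_simps)
  also have "\<dots> = h_fun m n \<nu> \<tau> z"
    unfolding infsumI[OF has_sum_qsign_geometric[OF \<omega>]] h_fun_eq by simp
  finally have "((\<lambda>(i, t). qsign i t * ?c i * ?E i t) has_sum h_fun m n \<nu> \<tau> z) UNIV"
    using sm by (simp add: has_sum_iff)
  then have "((\<lambda>x. ?C * (case x of (i, t) \<Rightarrow> qsign i t * ?c i * ?E i t)) has_sum ?C * h_fun m n \<nu> \<tau> z) UNIV"
    by (rule has_sum_cmult_right)
  also have "?this \<longleftrightarrow> ((\<lambda>(l, i). ee (of_int (n + 2 * m * l) * z / 2) * ?row l i) has_sum ?C * h_fun m n \<nu> \<tau> z) UNIV"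
  proof (rule has_sum_reindex_bij_witness[where i = "\<lambda>(l, i). (i, l + \<nu> - i)" and j = "\<lambda>(i, t). (t + i - \<nu>, i)"])
    fix a :: "int \<times> int"
    obtain i t where a: "a = (i, t)" by (cases a)
    define l where "l = t + i - \<nu>"
    have t: "t = l + \<nu> - i" by (simp add: l_def)
    have "isign (\<nu> + l + 1) i = qsign i t" by (auto simp: isign_def qsign_def l_def)
    moreover have "ee (of_int (n + 2 * m * l) * z / 2) * row_term m \<tau> (n + 2 * m * l) i
        = ?C * (?c i * ?E i t)"
      unfolding h_coeff_def ee_add[symmetric] t by (rule arg_cong[of _ _ ee]) (simp add: power2_eq_square field_simps)
    ultimately have "ee (of_int (n + 2 * m * l) * z / 2) * ?row l i = ?C * (qsign i t * ?c i * ?E i t)"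
      by (simp only: mult.assoc) (simp only: mult.left_commute)
    then show "(case case a of (i, t) \<Rightarrow> (t + i - \<nu>, i) of (l, i) \<Rightarrow> ee (of_int (n + 2 * m * l) * z / 2) * ?row l i)
      = ?C * (case a of (i, t) \<Rightarrow> qsign i t * ?c i * ?E i t)"
      unfolding a prod.case l_def .
  qed auto
  finally have hs: "((\<lambda>(l, i). ee (of_int (n + 2 * m * l) * z / 2) * ?row l i) has_sum ?C * h_fun m n \<nu> \<tau> z) (Sigma UNIV (\<lambda>_. UNIV))"
    by simp
  note sm = has_sum_imp_summable[OF hs]
  have "(\<Sum>\<^sub>\<infinity>i. ee (of_int (n + 2 * m * l) * z / 2) * ?row l i)
    = ee (of_int (n + 2 * m * l) * z / 2) * (\<Sum>i\<in>{min 0 (\<nu> + l + 1)..<max 0 (\<nu> + l + 1)}.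
      ?row l i)" for l
  proof -
    have "(\<Sum>\<^sub>\<infinity>i. ?row l i)
       = (\<Sum>\<^sub>\<infinity>i\<in>{min 0 (\<nu> + l + 1)..<max 0 (\<nu> + l + 1)}. ?row l i)"
      by (rule infsum_cong_neutral) (auto simp: isign_def)
    then show ?thesis unfolding infsum_cmult_right' by simp
  qed
  then show ?thesis
    using infsum_Sigma'_banach[OF sm] summable_on_Sigma_banach[OF sm] infsumI[OF hs]
    by (simp only: has_sum_iff)
qed

text \<open>The Fourier expansion of \<^term>\<open>G_fun\<close> consists of the coefficients of
  \<open>vth m \<nu> \<tau> (z / 2) * appell \<tau> (z / 2)\<close> whose index is congruent to \<open>n\<close> modulo \<open>2 * m\<close>.\<close>

lemma G_fun_has_sum:
  assumes z: "0 < Im z" "Im z < 2 * Im \<tau>" and m: "m > 0"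
  shows "((\<lambda>l. ee (of_int (n + 2 * m * l) * z / 2) * psi_coeff m \<nu> \<tau> 0 0 (n + 2 * m * l))
     has_sum (- 1) powi \<nu> * G_fun m n \<nu> \<tau> z) UNIV"
proof -
  have \<tau>: "Im \<tau> > 0" using z by linarith
  let ?N = "\<lambda>l. n + 2 * m * l"
  let ?W = "\<lambda>l. \<Sum>i\<in>{min 0 (\<nu> + l + 1)..<max 0 (\<nu> + l + 1)}.
      isign (\<nu> + l + 1) i * row_term m \<tau> (n + 2 * m * l) i"
  have "((\<lambda>l. (- 1) powi \<nu> * g_fun m n \<nu> \<tau> * ee (of_int (?N l) * z / 2 + \<tau> * (of_int (?N l))\<^sup>2 / (4 * of_int m))
        + vth m \<nu> \<tau> 0 * (ee (of_int (?N l) * z / 2) * ?W l))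
     has_sum (- 1) powi \<nu> * g_fun m n \<nu> \<tau> * theta (of_int n) (of_int m) \<tau> z
        + vth m \<nu> \<tau> 0 * (ee (- (\<tau> * of_int (m * \<nu>\<^sup>2))) * h_fun m n \<nu> \<tau> z)) UNIV"
    by (intro has_sum_add has_sum_cmult_right theta_has_sum[OF \<tau> m] h_fun_has_sum[OF z m])
  moreover have "(- 1) powi \<nu> * g_fun m n \<nu> \<tau> * ee (of_int (?N l) * z / 2 + \<tau> * (of_int (?N l))\<^sup>2 / (4 * of_int m))
        + vth m \<nu> \<tau> 0 * (ee (of_int (?N l) * z / 2) * ?W l) = ee (of_int (?N l) * z / 2) * psi_coeff m \<nu> \<tau> 0 0 (?N l)" for l
  proof -
    \<comment> \<open>For the cut nu + l + 1 the first summand is the coefficient of g times theta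
      and the correction is the coefficient of the h part.\<close>
    have "psi_coeff m \<nu> \<tau> 0 0 (?N l) = psi_coeff m \<nu> \<tau> (\<nu> + l + 1) l (?N l) + vth m \<nu> \<tau> 0 * ?W l"
      using psi_coeff_diff[OF \<tau> less_imp_le[OF m], of \<nu> 0 "?N l" "\<nu> + l + 1" l] by (simp only: diff_eq_eq) (simp only: ac_simps)
    then show ?thesis
      unfolding psi_coeff_eq_g_fun[OF \<tau> m] ee_add by (simp only: distrib_left ac_simps)
  qed
  moreover have "(- 1) powi \<nu> * g_fun m n \<nu> \<tau> * theta (of_int n) (of_int m) \<tau> z
        + vth m \<nu> \<tau> 0 * (ee (- (\<tau> * of_int (m * \<nu>\<^sup>2))) * h_fun m n \<nu> \<tau> z) = (- 1) powi \<nu> * G_fun m n \<nu> \<tau> z"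
  proof -
    have "theta_minus (of_int \<nu> + 1 / 2) (of_int m + 1 / 2) \<tau> 0 = vth m \<nu> \<tau> 0"
      using theta_minus_eq_vth[OF less_imp_le[OF m], of \<nu> \<tau> 0] by simp
    moreover have "qpow \<tau> (- (m * \<nu>\<^sup>2)) = ee (- (\<tau> * of_int (m * \<nu>\<^sup>2)))"
      by (simp add: qpow_eq_ee)
    moreover have "((- 1) powi \<nu> * (- 1) powi \<nu> :: complex) = 1"
      by (simp add: power_int_mult_distrib[symmetric])
    ultimately show ?thesis
      unfolding G_fun_def by (simp add: distrib_left mult.assoc[symmetric]) 
  qed
  ultimately show ?thesis by (simp only:)
qed

lemma Im_of_int_divide_of_int [simp]: "Im (of_int b / of_int m :: complex) = 0"
  by (metis Im_complex_of_real of_real_divide of_real_of_int_eq)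

abbreviation zeta :: "int \<Rightarrow> int \<Rightarrow> int \<Rightarrow> complex" where
  "zeta m n b \<equiv> ee (of_int n * of_int b / (2 * of_int m))"

text \<open>All exponents in the expansion are congruent to n modulo 2 m, so translation by b / m
  acts through a single root of unity.\<close>

lemma G_fun_plus_b:
  assumes z: "0 < Im z" "Im z < 2 * Im \<tau>" and m: "m > 0"
  shows "G_fun m n \<nu> \<tau> (z + of_int b / of_int m) = zeta m n b * G_fun m n \<nu> \<tau> z"
proof -
  let ?z = "z + of_int b / of_int m" and ?e = "zeta m n b"
  have "0 < Im ?z" "Im ?z < 2 * Im \<tau>" using z by simp_all
  note h1 = G_fun_has_sum[OF this m, of n \<nu>]
  have "((\<lambda>l. ?e * (ee (of_int (n + 2 * m * l) * z / 2) * psi_coeff m \<nu> \<tau> 0 0 (n + 2 * m * l)))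
     has_sum ?e * ((- 1) powi \<nu> * G_fun m n \<nu> \<tau> z)) UNIV"
    by (intro has_sum_cmult_right G_fun_has_sum z m)
  moreover have "?e * (ee (of_int (n + 2 * m * l) * z / 2) * psi_coeff m \<nu> \<tau> 0 0 (n + 2 * m * l))
     = ee (of_int (n + 2 * m * l) * ?z / 2) * psi_coeff m \<nu> \<tau> 0 0 (n + 2 * m * l)" for l
  proof -
    have "?e * ee (of_int (n + 2 * m * l) * z / 2) = ee (of_int (n + 2 * m * l) * ?z / 2)"
      unfolding ee_add[symmetric] using m by (intro ee_cong[where k = "- (l * b)"]) (simp add: field_simps)
    then show ?thesis by (simp only: mult.assoc[symmetric])
  qed
  ultimately have "(- 1) powi \<nu> * G_fun m n \<nu> \<tau> ?z = ?e * ((- 1) powi \<nu> * G_fun m n \<nu> \<tau> z)"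
    using has_sum_unique[OF h1] by (simp only:)
  then have "(- 1) powi \<nu> * G_fun m n \<nu> \<tau> ?z = (- 1) powi \<nu> * (?e * G_fun m n \<nu> \<tau> z)" by (simp only: ac_simps)
  then show ?thesis by simp
qed

lemma Psi_eq_sum_G:
  assumes z: "0 < Im z" "Im z < 2 * Im \<tau>" and m: "m > 0"
  shows "Psi m \<nu> \<tau> z = (\<Sum>n\<in>{0..<2 * m}. (- 1) powi \<nu> * G_fun m n \<nu> \<tau> z)"
proof -
  have z': "0 < Im (z / 2)" "Im (z / 2) < Im \<tau>" using z by simp_all
  let ?F = "\<lambda>N::int. ee (of_int N * (z / 2)) * psi_coeff m \<nu> \<tau> 0 0 N"
  have hs: "(?F has_sum Psi m \<nu> \<tau> z) UNIV"
    using vth_appell_has_sum[OF z' less_imp_le[OF m]] by (simp only: Psi_def appell_eq_vth_quot[OF z'])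
  have "(\<Sum>n\<in>{0..<2 * m}. \<Sum>\<^sub>\<infinity>l. ?F (2 * m * l + n)) = infsum ?F UNIV"
    by (rule infsum_residue_classes[OF has_sum_imp_summable[OF hs]]) (use m in simp)
  moreover have "(\<Sum>\<^sub>\<infinity>l. ?F (2 * m * l + n)) = (- 1) powi \<nu> * G_fun m n \<nu> \<tau> z" for n
    using infsumI[OF G_fun_has_sum[OF z m, of n \<nu>]] by (simp only: times_divide_eq_right add.commute)
  ultimately show ?thesis using infsumI[OF hs] by (simp only:)
qed

section \<open>Constant terms\<close>


text \<open>The constant term at a simple pole is the limit of the even part; in this form it is visibly
  unaffected by rescaling the variable and by even factors with value \<open>1\<close> at the pole.\<close>

definition even_lim :: "(complex \<Rightarrow> complex) \<Rightarrow> complex \<Rightarrow> bool" where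
  "even_lim f v \<longleftrightarrow> ((\<lambda>z. (f z + f (- z)) / 2) \<longlongrightarrow> v) (at 0)"

lemma even_lim_unique: "even_lim f v \<Longrightarrow> even_lim f w \<Longrightarrow> v = w"
  unfolding even_lim_def by (rule tendsto_unique[OF trivial_limit_at])

lemma filterlim_uminus_at_0: "filterlim (\<lambda>z::complex. - z) (at 0) (at 0)"
  by (intro filterlim_atI) (auto intro!: tendsto_eq_intros simp: eventually_at_filter)

lemma eventually_at_0_uminus:
  "\<forall>\<^sub>F z in at (0::complex). P z \<Longrightarrow> \<forall>\<^sub>F z in at 0. P (- z)"
  using filterlim_uminus_at_0 by (simp add: filterlim_iff)

lemma even_lim_cong:
  assumes "\<forall>\<^sub>F z in at 0. f z = g z" "even_lim f v"
  shows "even_lim g v"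
proof -
  have "\<forall>\<^sub>F z in at 0. (f z + f (- z)) / 2 = (g z + g (- z)) / 2"
    using assms(1) eventually_at_0_uminus[OF assms(1)] by eventually_elim simp
  with assms(2) show ?thesis unfolding even_lim_def by (rule Lim_transform_eventually)
qed

lemma even_lim_cmult:
  assumes "even_lim f v"
  shows "even_lim (\<lambda>z. c * f z) (c * v)"
proof -
  have "((\<lambda>z. c * ((f z + f (- z)) / 2)) \<longlongrightarrow> c * v) (at 0)"
    using assms unfolding even_lim_def by (rule tendsto_mult_left)
  then show ?thesis unfolding even_lim_def by (simp add: distrib_left)
qed

lemma even_lim_sum:
  assumes "\<And>i. i \<in> A \<Longrightarrow> even_lim (f i) (v i)"
  shows "even_lim (\<lambda>z. \<Sum>i\<in>A. f i z) (\<Sum>i\<in>A. v i)"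
proof -
  have "((\<lambda>z. \<Sum>i\<in>A. (f i z + f i (- z)) / 2) \<longlongrightarrow> (\<Sum>i\<in>A. v i)) (at 0)"
    using assms unfolding even_lim_def by (intro tendsto_sum)
  then show ?thesis unfolding even_lim_def by (simp add: sum.distrib sum_divide_distrib[symmetric])
qed

lemma even_lim_scale:
  assumes "even_lim f v" "c \<noteq> 0"
  shows "even_lim (\<lambda>z. f (z / c)) v"
proof -
  have "((\<lambda>z. z / c) \<longlongrightarrow> 0 / c) (at 0)" by (intro tendsto_intros assms)
  then have "filterlim (\<lambda>z. z / c) (at 0) (at 0)"
    using assms(2) by (intro filterlim_atI) (auto simp: eventually_at_filter)
  from filterlim_compose[OF assms(1)[unfolded even_lim_def] this] show ?thesis
    unfolding even_lim_def by simp
qed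

lemma even_lim_even_mult:
  assumes "even_lim f v" "\<And>z. g (- z) = g z" "(g \<longlongrightarrow> 1) (at 0)"
  shows "even_lim (\<lambda>z. g z * f z) v"
proof -
  have "((\<lambda>z. g z * ((f z + f (- z)) / 2)) \<longlongrightarrow> 1 * v) (at 0)"
    using assms unfolding even_lim_def by (intro tendsto_mult)
  then show ?thesis unfolding even_lim_def by (simp add: assms(2) distrib_left)
qed

text \<open>The polar part c / z is odd and cancels in the even part.\<close>

lemma simple_pole_even_lim:
  assumes r: "r > 0" and H: "H holomorphic_on ball 0 r"
    and f: "\<forall>z\<in>ball 0 r. z \<noteq> 0 \<longrightarrow> f z = H z + c / z"
  shows "even_lim f (H 0)"
proof -
  have "isCont H 0"
    by (rule analytic_at_imp_isCont[OF holomorphic_on_imp_analytic_at[OF H open_ball]]) (use r in simp)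
  then have H0: "(H \<longlongrightarrow> H 0) (at 0)" by (simp add: isCont_def)
  have "((\<lambda>z. H (- z)) \<longlongrightarrow> H 0) (at 0)"
    by (rule filterlim_compose[OF H0 filterlim_uminus_at_0])
  with H0 have "((\<lambda>z. (H z + H (- z)) / 2) \<longlongrightarrow> (H 0 + H 0) / 2) (at 0)"
    by (intro tendsto_intros) auto
  moreover have "\<forall>\<^sub>F z in at 0. (H z + H (- z)) / 2 = (f z + f (- z)) / 2"
    unfolding eventually_at using r by (intro exI[of _ r]) (auto simp: f dist_norm)
  ultimately show ?thesis
    unfolding even_lim_def by (auto intro: Lim_transform_eventually)
qed

text \<open>Both branches of \<open>value_at\<close> give the same number: continuity decides at a
  regular point, the Laurent coefficient at a pole. The assumptions leave \<open>f 0\<close> itself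
  free, so the value chosen by division by zero does no harm.\<close>

lemma simple_pole_value_at:
  assumes r: "r > 0" and H: "H holomorphic_on ball 0 r"
    and f: "\<forall>z\<in>ball 0 r. z \<noteq> 0 \<longrightarrow> f z = H z + c / z"
  shows "value_at f 0 = H 0"
proof (cases "f analytic_on {0}")
  case True
  then have "isCont f 0" using analytic_at_imp_isCont by blast
  then have f0: "(f \<longlongrightarrow> f 0) (at 0)" by (simp add: isCont_def)
  have "((\<lambda>z. f (- z)) \<longlongrightarrow> f 0) (at 0)"
    by (rule filterlim_compose[OF f0 filterlim_uminus_at_0])
  with f0 have "((\<lambda>z. (f z + f (- z)) / 2) \<longlongrightarrow> (f 0 + f 0) / 2) (at 0)"
    by (intro tendsto_intros) auto
  then have "even_lim f (f 0)" by (simp add: even_lim_def)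
  with simple_pole_even_lim[OF assms] have "f 0 = H 0" by (rule even_lim_unique[rotated])
  with True show ?thesis by (simp add: value_at_def)
next
  case False
  have "H analytic_on {0}"
    by (rule holomorphic_on_imp_analytic_at[OF H open_ball]) (use r in simp)
  then obtain P where P: "H has_fps_expansion P" using analytic_at_imp_has_fps_expansion_0 by blast
  have lau: "(\<lambda>z. H z + c * inverse z) has_laurent_expansion fps_to_fls P + fls_const c * fls_X_inv"
    using has_fps_expansion_to_laurent P by (intro laurent_expansion_intros) blast+
  have ev: "\<forall>\<^sub>F z in at 0. H z + c * inverse z = f z"
    unfolding eventually_at using r by (intro exI[of _ r]) (auto simp: f dist_norm divide_inverse)
  have "f has_laurent_expansion fps_to_fls P + fls_const c * fls_X_inv"
    using has_laurent_expansion_cong[OF ev refl] lau by blast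
  then have "laurent_expansion f 0 = fps_to_fls P + fls_const c * fls_X_inv"
    by (rule laurent_expansion_0_eqI)
  then have "fls_nth (laurent_expansion f 0) 0 = fps_nth P 0" by simp
  also have "\<dots> = H 0" using P has_fps_expansion_imp_0_eq_fps_nth_0 by metis
  finally show ?thesis using False by (simp add: value_at_def)
qed

text \<open>A factor z is divided out twice: D = z * D1 with D1 free of zeros, and N / D1 minus its
  value at 0 is again divisible by z.\<close>

lemma simple_zero_quotient:
  assumes r: "r > 0" and N: "N holomorphic_on ball 0 r" and D: "D holomorphic_on ball 0 r"
    and D0: "D 0 = 0" "deriv D 0 \<noteq> 0" "\<forall>z\<in>ball 0 r. z \<noteq> 0 \<longrightarrow> D z \<noteq> 0"
  shows "\<exists>H c. H holomorphic_on ball 0 r \<and> (\<forall>z\<in>ball 0 r. z \<noteq> 0 \<longrightarrow> N z / D z = H z + c / z)"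
proof -
  define D1 where "D1 = (\<lambda>z. if z = 0 then deriv D 0 else (D z - D 0) / (z - 0))"
  have D1: "D1 holomorphic_on ball 0 r" unfolding D1_def using r by (intro pole_lemma[OF D]) simp
  have D1_nz: "D1 z \<noteq> 0" if "z \<in> ball 0 r" for z
    using that D0 by (auto simp: D1_def)
  define q where "q = (\<lambda>z. N z / D1 z)"
  have q: "q holomorphic_on ball 0 r" unfolding q_def using D1_nz by (intro holomorphic_intros N D1)
  define H where "H = (\<lambda>z. if z = 0 then deriv q 0 else (q z - q 0) / (z - 0))"
  show ?thesis
  proof (intro exI[of _ H] exI[of _ "q 0"] conjI ballI impI)
    show "H holomorphic_on ball 0 r" unfolding H_def using r by (intro pole_lemma[OF q]) simp
    fix z :: complex assume z: "z \<in> ball 0 r" "z \<noteq> 0"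
    have "N z / D z = q z / z" using z D0 by (simp add: q_def D1_def)
    also have "\<dots> = H z + q 0 / z" using z by (simp add: H_def diff_divide_distrib)
    finally show "N z / D z = H z + q 0 / z" .
  qed
qed

section \<open>Local behaviour of G near the origin\<close>

lemma holomorphic_theta:
  fixes m n :: int
  assumes \<tau>: "Im \<tau> > 0" and m: "m > 0"
  shows "(\<lambda>z. theta (of_int n) (of_int m) \<tau> z) holomorphic_on UNIV"
proof -
  have \<sigma>: "Im (2 * of_int m * \<tau>) > 0" using \<tau> m by simp
  have "theta (of_int n) (of_int m) \<tau> z = ee (of_int n * z / 2 + \<tau> * (of_int n)\<^sup>2 / (4 * of_int m)) * jtheta (2 * of_int m * \<tau>) (of_int m * z + of_int n * \<tau>)" for z
    unfolding infsumI[OF theta_has_sum[OF \<tau> m], symmetric] jtheta_def infsum_cmult_right'[symmetric] ee_add[symmetric]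
    using m by (intro infsum_cong arg_cong[of _ _ ee]) (simp add: power2_eq_square field_simps)
  moreover have "jtheta (2 * of_int m * \<tau>) \<circ> (\<lambda>z. of_int m * z + of_int n * \<tau>) holomorphic_on UNIV"
    by (intro holomorphic_on_compose holomorphic_intros holomorphic_on_subset[OF holomorphic_jtheta[OF \<sigma>]]) auto
  ultimately show ?thesis
    by (simp only: o_def) (intro holomorphic_intros, use m in auto)
qed

text \<open>The bound 1 / m ensures that m z is an integer only for z = 0; the bound Im tau ensures
  that only the summand i = 0 of \<open>h_fun\<close> can be singular.\<close>

definition pole_radius :: "int \<Rightarrow> complex \<Rightarrow> real" where
  "pole_radius m \<tau> = min (1 / of_int m) (Im \<tau>)"

lemma pole_radius_pos: "m > 0 \<Longrightarrow> Im \<tau> > 0 \<Longrightarrow> pole_radius m \<tau> > 0"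
  by (simp add: pole_radius_def)

lemma mem_pole_radius_ball:
  fixes z :: complex
  assumes "z \<in> ball 0 (pole_radius m \<tau>)"
  shows "norm z < 1 / of_int m" "\<bar>Im z\<bar> < Im \<tau>"
  using assms abs_Im_le_cmod[of z] by (auto simp: pole_radius_def dist_norm)

lemma eq_0_of_lattice:
  fixes z :: complex
  assumes "z \<in> ball 0 (pole_radius m \<tau>)" "m > 0" "of_int m * z = of_int k"
  shows "z = 0"
proof (rule ccontr)
  assume z: "z \<noteq> 0"
  then have "of_int m * z \<noteq> 0" using assms(2) by simp
  then have "of_int k \<noteq> (0::complex)" using assms(3) by simp
  then have "1 \<le> \<bar>real_of_int k\<bar>" by simp
  also have "\<dots> = norm (of_int m * z)" by (simp add: assms)
  also have "\<dots> = real_of_int m * norm z" using assms(2) by (simp add: norm_mult)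
  also have "\<dots> < 1" using mem_pole_radius_ball(1)[OF assms(1)] assms(2) by (simp add: field_simps)
  finally show False by simp
qed

lemma G_fun_near_0:
  assumes \<tau>: "Im \<tau> > 0" and m: "m > 0"
  shows "\<exists>H c. H holomorphic_on ball 0 (pole_radius m \<tau>) \<and>
    (\<forall>z\<in>ball 0 (pole_radius m \<tau>). z \<noteq> 0 \<longrightarrow> G_fun m n \<nu> \<tau> z = H z + c / z)"
proof -
  let ?B = "ball 0 (pole_radius m \<tau>)"
  let ?bound = "\<lambda>i. norm (h_coeff m n \<nu> \<tau> (\<i> * of_real (Im \<tau>)) i) + norm (h_coeff m n \<nu> \<tau> (- (\<i> * of_real (Im \<tau>))) i)"
  let ?\<sigma> = "2 * of_int m * \<tau>"
  define Reg where "Reg = (\<lambda>z. \<Sum>\<^sub>\<infinity>i\<in>UNIV - {0::int}. h_coeff m n \<nu> \<tau> z i / (1 - ee (of_int m * z + of_int i * ?\<sigma>)))"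
  have bd: "\<bar>Im (of_int m * z)\<bar> \<le> of_int m * Im \<tau>" if "z \<in> ?B" for z
  proof -
    have "\<bar>Im (of_int m * z)\<bar> = of_int m * \<bar>Im z\<bar>" using m by (simp add: abs_mult)
    also have "\<dots> \<le> of_int m * Im \<tau>" using m mem_pole_radius_ball(2)[OF that] by (intro mult_left_mono) auto
    finally show ?thesis .
  qed
  have \<sigma>: "of_int m * Im \<tau> < Im ?\<sigma>" using m \<tau> by simp
  have Reg: "Reg holomorphic_on ?B"
    unfolding Reg_def
  proof (rule holomorphic_lerch[where \<delta> = "of_int m * Im \<tau>"
        and B = ?bound])
    show "?bound summable_on UNIV"
      by (intro summable_on_add summable_on_norm_complex summable_on_h_coeff \<tau> m)
    show "norm (h_coeff m n \<nu> \<tau> z i) \<le> ?bound i"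
      if "z \<in> ?B" for i z
    proof -
      have "\<bar>Im (z / 2)\<bar> \<le> Im \<tau> / 2" using mem_pole_radius_ball(2)[OF that] by simp
      from norm_ee_le_sum[OF this, of "\<tau> * of_int (m * (i - \<nu>)\<^sup>2 + n * i)" "2 * m * (i - \<nu>) + n"]
      show ?thesis by (simp add: h_coeff_def add.commute)
    qed
    show "(\<lambda>z. h_coeff m n \<nu> \<tau> z i) holomorphic_on ?B" for i
      unfolding h_coeff_def by (intro holomorphic_intros) auto
    show "(\<lambda>z. of_int m * z) holomorphic_on ?B" by (intro holomorphic_intros)
  qed (use bd \<sigma> in auto)
  have hc0: "(\<lambda>z. h_coeff m n \<nu> \<tau> z 0) holomorphic_on ?B"
    unfolding h_coeff_def by (intro holomorphic_intros) auto
  have D: "(\<lambda>z. 1 - ee (of_int m * z)) holomorphic_on ?B" by (intro holomorphic_intros)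
  have "((\<lambda>z. 1 - ee (of_int m * z)) has_field_derivative 0 - (2 * of_real pi * \<i> * ee (of_int m * 0)) * of_int m) (at 0)"
  proof (intro DERIV_diff DERIV_const)
    have "((\<lambda>z. of_int m * z) has_field_derivative of_int m) (at 0)" by (auto intro!: derivative_eq_intros)
    from DERIV_chain2[OF ee_has_field_derivative this] show "((\<lambda>z. ee (of_int m * z)) has_field_derivative (2 * of_real pi * \<i> * ee (of_int m * 0)) * of_int m) (at 0)" .
  qed
  then have D0: "1 - ee (of_int m * 0) = 0" and D': "deriv (\<lambda>z. 1 - ee (of_int m * z)) 0 \<noteq> 0" using m by (simp_all add: DERIV_imp_deriv)
  have Dnz: "\<forall>z\<in>?B. z \<noteq> 0 \<longrightarrow> 1 - ee (of_int m * z) \<noteq> 0"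
  proof (intro ballI impI notI)
    fix z :: complex assume z: "z \<in> ?B" "z \<noteq> 0"
    assume "1 - ee (of_int m * z) = 0"
    then have "ee (of_int m * z) = 1" by simp
    then obtain k :: int where "of_int m * z = of_int k" unfolding ee_eq_1_iff by blast
    then show False using eq_0_of_lattice[OF z(1) m] z(2) by blast
  qed
  obtain H c where H: "H holomorphic_on ?B"
    and Hc': "\<forall>z\<in>?B. z \<noteq> 0 \<longrightarrow> h_coeff m n \<nu> \<tau> z 0 / (1 - ee (of_int m * z)) = H z + c / z"
    using simple_zero_quotient[OF pole_radius_pos[OF m \<tau>] hc0 D D0 D' Dnz] by (elim exE conjE)
  have Hc: "h_coeff m n \<nu> \<tau> z 0 / (1 - ee (of_int m * z)) = H z + c / z" if "z \<in> ?B" "z \<noteq> 0" for z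
    using Hc' that by simp
  define C where "C = (- 1) powi \<nu> * qpow \<tau> (- (m * \<nu>\<^sup>2)) * theta_minus (\<nu> + 1 / 2) (m + 1 / 2) \<tau> 0"
  show ?thesis
  proof (intro exI[of _ "\<lambda>z. g_fun m n \<nu> \<tau> * theta n m \<tau> z + C * (H z + Reg z)"] exI[of _ "C * c"] conjI ballI impI)
    show "(\<lambda>z. g_fun m n \<nu> \<tau> * theta n m \<tau> z + C * (H z + Reg z)) holomorphic_on ?B"
      by (intro holomorphic_intros H Reg holomorphic_on_subset[OF holomorphic_theta[OF \<tau> m]]) auto
    fix z :: complex assume z: "z \<in> ?B" "z \<noteq> 0"
    have "\<bar>Im (of_int m * z)\<bar> < Im ?\<sigma>" using bd[OF z(1)] \<sigma> by (rule le_less_trans)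
    from lerch_split[OF this summable_on_h_coeff[OF \<tau> m]]
    have "h_fun m n \<nu> \<tau> z = h_coeff m n \<nu> \<tau> z 0 / (1 - ee (of_int m * z)) + Reg z"
      unfolding h_fun_eq Reg_def .
    then have h: "h_fun m n \<nu> \<tau> z = (H z + c / z) + Reg z" by (simp only: Hc[OF z])
    have "G_fun m n \<nu> \<tau> z = g_fun m n \<nu> \<tau> * theta n m \<tau> z + C * h_fun m n \<nu> \<tau> z"
      by (simp add: G_fun_def C_def)
    also have "\<dots> = (g_fun m n \<nu> \<tau> * theta n m \<tau> z + C * (H z + Reg z)) + (C * c) / z"
      unfolding h by (simp add: algebra_simps)
    finally show "G_fun m n \<nu> \<tau> z = (g_fun m n \<nu> \<tau> * theta n m \<tau> z + C * (H z + Reg z)) + (C * c) / z" .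
  qed
qed

lemma Psi_plus_eq_sum_G:
  assumes z: "0 < Im z" "Im z < 2 * Im \<tau>" and m: "m > 0"
  shows "Psi m \<nu> \<tau> (z + of_int b / of_int m)
    = (\<Sum>n\<in>{0..<2 * m}. (- 1) powi \<nu> * zeta m n b * G_fun m n \<nu> \<tau> z)"
proof -
  have "0 < Im (z + of_int b / of_int m)" "Im (z + of_int b / of_int m) < 2 * Im \<tau>" using z by simp_all
  from Psi_eq_sum_G[OF this m] show ?thesis by (simp only: G_fun_plus_b[OF z m] mult.assoc)
qed

section \<open>Separating the index n by finite Fourier inversion\<close>

lemma finite_fourier_inversion:
  fixes y :: "int \<Rightarrow> complex"
  assumes m: "m > 0" and n: "n \<in> {0..<2 * m}"
  shows "(\<Sum>b\<in>{0..<2 * m}. zeta_inv m n b * (\<Sum>k\<in>{0..<2 * m}. ee (of_int k * of_int b / (2 * of_int m)) * y k))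
    = 2 * of_int m * y n"
proof -
  have "(\<Sum>b\<in>{0..<2 * m}. zeta_inv m n b * (\<Sum>k\<in>{0..<2 * m}. ee (of_int k * of_int b / (2 * of_int m)) * y k))
     = (\<Sum>b\<in>{0..<2 * m}. \<Sum>k\<in>{0..<2 * m}. ee (of_int (k - n) * (of_int b / of_int (2 * m))) * y k)"
  proof -
    have "- (of_int n * of_int b / (2 * of_int m)) + of_int k * of_int b / (2 * of_int m)
        = of_int (k - n) * (of_int b / of_int (2 * m) :: complex)" for b k
      by (simp add: left_diff_distrib diff_divide_distrib)
    then show ?thesis
      unfolding sum_distrib_left mult.assoc[symmetric] ee_add[symmetric] by (simp only:)
  qed
  also have "\<dots> = (\<Sum>k\<in>{0..<2 * m}. (\<Sum>b\<in>{0..<2 * m}. ee (of_int (k - n) * (of_int b / of_int (2 * m)))) * y k)"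
    unfolding sum_distrib_right by (rule sum.swap)
  also have "\<dots> = (\<Sum>k\<in>{0..<2 * m}. (if 2 * m dvd k - n then of_int (2 * m) else 0) * y k)"
  proof -
    have "2 * m > 0" using m by simp
    then show ?thesis by (simp only: sum_ee_roots)
  qed
  also have "\<dots> = (\<Sum>k\<in>{0..<2 * m}. if k = n then 2 * of_int m * y n else 0)"
  proof (intro sum.cong refl)
    fix k assume k: "k \<in> {0..<2 * m}"
    have "2 * m dvd k - n \<longleftrightarrow> k = n"
    proof
      assume "2 * m dvd k - n"
      then have "k mod (2 * m) = n mod (2 * m)" by (simp add: mod_eq_dvd_iff)
      then show "k = n" using k n by simp
    qed simp
    then show "(if 2 * m dvd k - n then of_int (2 * m) else 0) * y k = (if k = n then 2 * of_int m * y n else 0)" by simp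
  qed
  also have "\<dots> = 2 * of_int m * y n" using n by (simp add: sum.delta)
  finally show ?thesis .
qed

lemma holomorphic_Psi_strip:
  assumes \<tau>: "Im \<tau> > 0" and m: "m > 0"
  shows "(\<lambda>z. Psi m \<nu> \<tau> (z + c)) holomorphic_on {z. 0 < Im (z + c) \<and> Im (z + c) < 2 * Im \<tau>}"
proof -
  have "vth 0 0 \<tau> ((z + c) / 2) \<noteq> 0" if "0 < Im (z + c) \<and> Im (z + c) < 2 * Im \<tau>" for z
    using vth_0_0_appell[of "(z + c) / 2" \<tau>] psi_coeff_0_0_nonzero[OF \<tau>] that by auto
  then show ?thesis
    unfolding Psi_def vth_quot_def using \<tau> m by (intro holomorphic_intros) auto
qed

text \<open>Inversion in b writes G as a finite combination of translates of \<open>Psi\<close>,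
  whose denominator has no zero in the strip; holomorphy is inherited from there.\<close>

lemma holomorphic_G_strip:
  assumes \<tau>: "Im \<tau> > 0" and m: "m > 0" and n: "0 \<le> n" "n < 2 * m"
  shows "G_fun m n \<nu> \<tau> holomorphic_on {z. 0 < Im z \<and> Im z < 2 * Im \<tau>}"
proof -
  let ?S = "{z. 0 < Im z \<and> Im z < 2 * Im \<tau>}"
  have "(\<lambda>z. (- 1) powi \<nu> / (2 * of_int m) * (\<Sum>b\<in>{0..<2 * m}. zeta_inv m n b * Psi m \<nu> \<tau> (z + of_int b / of_int m))) holomorphic_on ?S"
    using holomorphic_Psi_strip[OF \<tau> m, of \<nu> "of_int b / of_int m" for b]
    by (intro holomorphic_intros) auto
  moreover have "(- 1) powi \<nu> / (2 * of_int m) * (\<Sum>b\<in>{0..<2 * m}. zeta_inv m n b * Psi m \<nu> \<tau> (z + of_int b / of_int m)) = G_fun m n \<nu> \<tau> z"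
    if "z \<in> ?S" for z
  proof -
    have z: "0 < Im z" "Im z < 2 * Im \<tau>" using that by auto
    have P: "Psi m \<nu> \<tau> (z + of_int b / of_int m) = (\<Sum>k\<in>{0..<2 * m}. ee (of_int k * of_int b / (2 * of_int m)) * ((- 1) powi \<nu> * G_fun m k \<nu> \<tau> z))" for b
      unfolding Psi_plus_eq_sum_G[OF z m] by (intro sum.cong refl) (simp only: ac_simps)
    have "((- 1) powi \<nu> * (- 1) powi \<nu> :: complex) = 1"
      by (simp add: power_int_mult_distrib[symmetric])
    then show ?thesis
      unfolding P using n m by (subst finite_fourier_inversion[OF m]) (auto simp: mult.assoc[symmetric])
  qed
  ultimately show ?thesis by (rule holomorphic_transform)
qed

lemma F_fun_eq:
  "F_fun m a 0 n \<nu> \<tau> z = ee (of_int a * z / 2 + \<tau> * (of_int a)\<^sup>2 / (4 * of_int m)) * G_fun m n \<nu> \<tau> (z + of_int a * \<tau> / of_int m)"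
proof -
  have "exp (complex_of_real pi * \<i> * of_int a * z) = ee (of_int a * z / 2)"
    by (simp add: ee_def mult.assoc)
  then show ?thesis by (simp add: F_fun_def qpow_eq_ee ee_add)
qed

lemma open_strip: "open {z. l < Im z \<and> Im z < u}"
proof -
  have "{z. l < Im z \<and> Im z < u} = {z. l < Im z} \<inter> {z. Im z < u}" by auto
  then show ?thesis by (simp add: open_Int open_halfspace_Im_lt open_halfspace_Im_gt)
qed

lemma torsion_point_in_strip:
  assumes "Im \<tau> > 0" "m > 0" "0 < a" "a < 2 * m"
  shows "of_int a * \<tau> / of_int m \<in> {z. 0 < Im z \<and> Im z < 2 * Im \<tau>}"
proof -
  have "of_int a * \<tau> / of_int m = of_real (of_int a / of_int m) * \<tau>" by simp
  then have "Im (of_int a * \<tau> / of_int m) = of_int a / of_int m * Im \<tau>" by simp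
  moreover have "real_of_int a / of_int m * Im \<tau> < 2 * Im \<tau>"
    using assms by (intro mult_strict_right_mono) (auto simp: field_simps)
  ultimately show ?thesis using assms by simp
qed

text \<open>For 0 < a < 2 m the point a tau / m lies inside the strip, where G is regular. For a = 0
  it lies on the boundary, and the polar decomposition of \<open>G_fun_near_0\<close> takes
  over.\<close>

lemma even_lim_F_fun:
  assumes \<tau>: "Im \<tau> > 0" and m: "m > 0" and n: "0 \<le> n" "n < 2 * m" and a: "0 \<le> a" "a < 2 * m"
  shows "even_lim (F_fun m a 0 n \<nu> \<tau>) (F_null m a n \<nu> \<tau>)"
proof -
  have "\<exists>r H c. r > 0 \<and> H holomorphic_on ball 0 r \<and> (\<forall>z\<in>ball 0 r. z \<noteq> 0 \<longrightarrow> F_fun m a 0 n \<nu> \<tau> z = H z + c / z)"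
  proof (cases "a = 0")
    case True
    have "F_fun m a 0 n \<nu> \<tau> z = G_fun m n \<nu> \<tau> z" for z by (simp add: F_fun_eq True)
    with G_fun_near_0[OF \<tau> m, of n \<nu>] pole_radius_pos[OF m \<tau>] show ?thesis
      by (intro exI[of _ "pole_radius m \<tau>"]) simp
  next
    case False
    let ?z0 = "of_int a * \<tau> / of_int m"
    let ?S = "{z. 0 < Im z \<and> Im z < 2 * Im \<tau>}"
    have "?z0 \<in> ?S" using torsion_point_in_strip[OF \<tau> m] a False by simp
    then obtain r where r: "r > 0" "ball ?z0 r \<subseteq> ?S" by (rule openE[OF open_strip])
    have sub: "z + ?z0 \<in> ?S" if "z \<in> ball 0 r" for z
    proof -
      have "z + ?z0 \<in> ball ?z0 r" using that by (simp add: dist_norm)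
      then show ?thesis using r(2) by (rule subsetD[rotated])
    qed
    have "G_fun m n \<nu> \<tau> \<circ> (\<lambda>z. z + ?z0) holomorphic_on ball 0 r"
    proof (rule holomorphic_on_compose)
      show "G_fun m n \<nu> \<tau> holomorphic_on (\<lambda>z. z + ?z0) ` ball 0 r"
        by (rule holomorphic_on_subset[OF holomorphic_G_strip[OF \<tau> m n]]) (rule image_subsetI, rule sub)
    qed (intro holomorphic_intros)
    then have h: "(\<lambda>z. G_fun m n \<nu> \<tau> (z + ?z0)) holomorphic_on ball 0 r" by (simp only: o_def)
    have "(\<lambda>z. ee (of_int a * z / 2 + \<tau> * (of_int a)\<^sup>2 / (4 * of_int m)) * G_fun m n \<nu> \<tau> (z + ?z0)) holomorphic_on ball 0 r"
      by (rule holomorphic_on_mult[OF _ h]) (intro holomorphic_intros, use m in auto)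
    then have "F_fun m a 0 n \<nu> \<tau> holomorphic_on ball 0 r"
      by (rule holomorphic_transform) (rule F_fun_eq[symmetric])
    then show ?thesis using r(1) by (intro exI[of _ r] exI[of _ "F_fun m a 0 n \<nu> \<tau>"] exI[of _ 0] conjI ballI impI) simp_all
  qed
  then obtain r H c where *: "r > 0" "H holomorphic_on ball 0 r"
      "\<forall>z\<in>ball 0 r. z \<noteq> 0 \<longrightarrow> F_fun m a 0 n \<nu> \<tau> z = H z + c / z"
    by (elim exE conjE)
  have "value_at (F_fun m a 0 n \<nu> \<tau>) 0 = H 0"
    by (rule simple_pole_value_at[OF *])
  then have v: "F_null m a n \<nu> \<tau> = H 0" using \<tau> by (simp add: F_null_def)
  have "even_lim (F_fun m a 0 n \<nu> \<tau>) (H 0)"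
    by (rule simple_pole_even_lim[OF *])
  then show ?thesis by (simp only: v)
qed

section \<open>Invariance of the span\<close>


text \<open>The even part at 0 also samples points below the real line, outside the strip of the
  Fourier expansion. Multiplied by z and by the theta function in the denominator, both sides are
  holomorphic on the ball and agree on its upper half.\<close>

lemma Psi_plus_eq_sum_G_near_0:
  assumes \<tau>: "Im \<tau> > 0" and m: "m > 0" and z: "z \<in> ball 0 (pole_radius m \<tau>)" "z \<noteq> 0"
  shows "Psi m \<nu> \<tau> (z + of_int b / of_int m)
    = (\<Sum>n\<in>{0..<2 * m}. (- 1) powi \<nu> * zeta m n b * G_fun m n \<nu> \<tau> z)"
proof -
  let ?B = "ball 0 (pole_radius m \<tau>)" and ?U = "ball 0 (pole_radius m \<tau>) \<inter> {z. Im z > 0}"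
  let ?k = "\<lambda>n. (- 1) powi \<nu> * zeta m n b"
  let ?P = "\<lambda>z. \<Sum>n\<in>{0..<2 * m}. ?k n * G_fun m n \<nu> \<tau> z"
  let ?d = "\<lambda>z. 2 * of_real pi * \<i> * vth 0 0 \<tau> ((z + of_int b / of_int m) / 2)"
  have "\<forall>n. \<exists>H c. H holomorphic_on ?B \<and> (\<forall>z\<in>?B. z \<noteq> 0 \<longrightarrow> G_fun m n \<nu> \<tau> z = H z + c / z)"
    using G_fun_near_0[OF \<tau> m] by simp
  then obtain H c where H: "\<And>n. H n holomorphic_on ?B"
    and Hc: "\<And>n z. z \<in> ?B \<Longrightarrow> z \<noteq> 0 \<Longrightarrow> G_fun m n \<nu> \<tau> z = H n z + c n / z"
    by metis
  let ?L = "\<lambda>z. (\<Sum>n\<in>{0..<2 * m}. ?k n * (z * H n z + c n)) * ?d z"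
  let ?R = "\<lambda>z. - (z * vth m \<nu> \<tau> ((z + of_int b / of_int m) / 2) * dvth0 \<tau>)"
  have L: "?L z = z * ?P z * ?d z" if "z \<in> ?B" "z \<noteq> 0" for z
  proof -
    have "z * ?P z = (\<Sum>n\<in>{0..<2 * m}. ?k n * (z * H n z + c n))"
      unfolding sum_distrib_left
    proof (intro sum.cong refl)
      fix n
      have "z * (?k n * G_fun m n \<nu> \<tau> z) = ?k n * (z * (H n z + c n / z))"
        by (simp only: Hc[OF that] mult.left_commute)
      also have "z * (H n z + c n / z) = z * H n z + c n" using that(2) by (simp add: distrib_left)
      finally show "z * (?k n * G_fun m n \<nu> \<tau> z) = ?k n * (z * H n z + c n)" .
    qed
    then show ?thesis by (simp only:)
  qed
  have d_nz: "?d z \<noteq> 0" if zB: "z \<in> ?B" "z \<noteq> 0" for z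
  proof
    assume "?d z = 0"
    then have "vth 0 0 \<tau> ((z + of_int b / of_int m) / 2) = 0" by simp
    then obtain k l where kl: "(z + of_int b / of_int m) / 2 = of_int k * \<tau> + of_int l"
      using vth_0_0_eq_0_iff[OF \<tau>] by blast
    then have "Im ((z + of_int b / of_int m) / 2) = Im (of_int k * \<tau> + of_int l)" by simp
    then have "Im z / 2 = real_of_int k * Im \<tau>" by simp
    then have "\<bar>Im z\<bar> = 2 * \<bar>real_of_int k\<bar> * Im \<tau>" using \<tau> by (simp add: abs_mult field_simps)
    with mem_pole_radius_ball(2)[OF zB(1)] have "2 * \<bar>real_of_int k\<bar> * Im \<tau> < 1 * Im \<tau>" by simp
    then have "2 * \<bar>real_of_int k\<bar> < 1" using \<tau> by (simp only: mult_less_cancel_right_pos)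
    then have "k = 0" by linarith
    \<comment> \<open>Comparing imaginary parts has removed the multiple of tau, so m z is an
      integer and the choice of radius forces z = 0.\<close>
    then have "of_int m * z = of_int (2 * m * l - b)" using kl m by (simp add: field_simps)
    then show False using eq_0_of_lattice[OF zB(1) m] zB(2) by blast
  qed
  have R: "?R z = z * Psi m \<nu> \<tau> (z + of_int b / of_int m) * ?d z" if "?d z \<noteq> 0" for z
    using that by (simp add: Psi_def vth_quot_def)
  have "?L z = ?R z"
  proof (rule analytic_continuation_open[of ?U ?B ?L ?R])
    show "open ?U" by (intro open_Int open_ball open_halfspace_Im_gt)
    have "\<i> * of_real (pole_radius m \<tau> / 2) \<in> ?U" using pole_radius_pos[OF m \<tau>] by (simp add: norm_mult)
    then show "?U \<noteq> {}" by blast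
    show "?L holomorphic_on ?B" using \<tau> by (intro holomorphic_intros H) auto
    show "?R holomorphic_on ?B" using \<tau> m by (intro holomorphic_intros) auto
    fix z assume zU: "z \<in> ?U"
    then have zB: "z \<in> ?B" "z \<noteq> 0" by auto
    have s: "0 < Im z" "Im z < 2 * Im \<tau>" using zU mem_pole_radius_ball(2)[OF zB(1)] \<tau> by auto
    show "?L z = ?R z"
      unfolding L[OF zB] R[OF d_nz[OF zB]] Psi_plus_eq_sum_G[OF s m] ..
  qed (use z in \<open>auto intro: convex_connected\<close>)
  then have "z * ?P z * ?d z = z * Psi m \<nu> \<tau> (z + of_int b / of_int m) * ?d z"
    unfolding L[OF z] R[OF d_nz[OF z]] .
  then show ?thesis using d_nz[OF z] z(2) by simp
qed

lemma PsiT_eq_sum_F: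
  assumes \<tau>: "Im \<tau> > 0" and m: "m > 0" and a: "0 \<le> a" "a < 2 * m"
  shows "\<forall>\<^sub>F z in at 0. (\<Sum>n\<in>{0..<2 * m}. (- 1) powi \<nu> * zeta m n b * F_fun m a 0 n \<nu> \<tau> z)
    = PsiT m \<nu> a b \<tau> z"
proof -
  let ?z0 = "of_int a * \<tau> / of_int m"
  let ?E = "\<lambda>z. ee (of_int a * z / 2 + \<tau> * (of_int a)\<^sup>2 / (4 * of_int m))"
  have *: "(\<Sum>n\<in>{0..<2 * m}. (- 1) powi \<nu> * zeta m n b * F_fun m a 0 n \<nu> \<tau> z)
    = PsiT m \<nu> a b \<tau> z"
    if "Psi m \<nu> \<tau> ((z + ?z0) + of_int b / of_int m)
      = (\<Sum>n\<in>{0..<2 * m}. (- 1) powi \<nu> * zeta m n b * G_fun m n \<nu> \<tau> (z + ?z0))" for z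
  proof -
    have "z + (of_int a * \<tau> + of_int b) / of_int m = (z + ?z0) + of_int b / of_int m"
      by (simp add: add_divide_distrib)
    then have "PsiT m \<nu> a b \<tau> z = ?E z * Psi m \<nu> \<tau> ((z + ?z0) + of_int b / of_int m)"
      by (simp only: PsiT_def)
    also have "\<dots> = (\<Sum>n\<in>{0..<2 * m}. (- 1) powi \<nu> * zeta m n b * F_fun m a 0 n \<nu> \<tau> z)"
      unfolding that F_fun_eq sum_distrib_left by (intro sum.cong refl) (simp only: ac_simps)
    finally show ?thesis ..
  qed
  show ?thesis
  proof (cases "a = 0")
    case True
    have "\<forall>\<^sub>F z in at 0. z \<in> ball 0 (pole_radius m \<tau>) \<and> z \<noteq> 0"
      unfolding eventually_at using pole_radius_pos[OF m \<tau>] by (intro exI[of _ "pole_radius m \<tau>"]) (simp add: dist_commute)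
    then show ?thesis
    proof eventually_elim
      case (elim z)
      show ?case
        by (rule *) (use Psi_plus_eq_sum_G_near_0[OF \<tau> m, of z \<nu> b] elim True in simp)
    qed
  next
    case False
    let ?S = "{z. 0 < Im z \<and> Im z < 2 * Im \<tau>}"
    have S: "0 + ?z0 \<in> ?S" using torsion_point_in_strip[OF \<tau> m] a False by simp
    have "((\<lambda>z. z + ?z0) \<longlongrightarrow> 0 + ?z0) (at 0)" by (intro tendsto_intros)
    from topological_tendstoD[OF this open_strip S] have "\<forall>\<^sub>F z in at 0. z + ?z0 \<in> ?S" .
    then show ?thesis
    proof eventually_elim
      case (elim z)
      then have "0 < Im (z + ?z0)" "Im (z + ?z0) < 2 * Im \<tau>" by blast+
      then show ?case by (intro * Psi_plus_eq_sum_G m)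
    qed
  qed
qed

text \<open>The constant term of \<open>PsiT\<close> at z = 0, given through \<open>F_null\<close>
  so that membership in \<open>V_space\<close> is visible. The reduction of \<open>a\<close>
  reflects that the generators have 0 <= a < 2 m.\<close>

definition PsiV :: "int \<Rightarrow> int \<Rightarrow> int \<Rightarrow> int \<Rightarrow> complex \<Rightarrow> complex" where
  "PsiV m \<nu> a b \<tau> = (\<Sum>n\<in>{0..<2 * m}. (- 1) powi \<nu> * zeta m n b * F_null m (a mod (2 * m)) n \<nu> \<tau>)"

text \<open>Periodicity in a extends the identity from representatives to all integers, as required
  by the substitution (a, b) -> (b, -a).\<close>

lemma even_lim_PsiT:
  assumes \<tau>: "Im \<tau> > 0" and m: "m > 0"
  shows "even_lim (PsiT m \<nu> a b \<tau>) (PsiV m \<nu> a b \<tau>)"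
proof -
  define a' where "a' = a mod (2 * m)"
  have a': "0 \<le> a'" "a' < 2 * m" using m by (simp_all add: a'_def)
  have "even_lim (\<lambda>z. \<Sum>n\<in>{0..<2 * m}. (- 1) powi \<nu> * zeta m n b * F_fun m a' 0 n \<nu> \<tau> z)
     (PsiV m \<nu> a b \<tau>)"
    unfolding PsiV_def a'_def[symmetric]
    by (intro even_lim_sum even_lim_cmult even_lim_F_fun \<tau> m a') auto
  then have "even_lim (PsiT m \<nu> a' b \<tau>) (PsiV m \<nu> a b \<tau>)"
    by (rule even_lim_cong[OF PsiT_eq_sum_F[OF \<tau> m a']])
  moreover have "PsiT m \<nu> a b \<tau> = PsiT m \<nu> a' b \<tau>"
  proof -
    have shift: "PsiT m \<nu> (x + 2 * m) b \<tau> = PsiT m \<nu> x b \<tau>" for x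
      by (rule ext, rule PsiT_plus_a[OF m])
    have per: "PsiT m \<nu> (x + k * (2 * m)) b \<tau> = PsiT m \<nu> x b \<tau>" for x k
    proof (induction k rule: int_induct[where k = 0])
      case (step1 i)
      have e: "x + (i + 1) * (2 * m) = (x + i * (2 * m)) + 2 * m" by (simp add: algebra_simps)
      show ?case using step1(2) unfolding e shift .
    next
      case (step2 i)
      have e: "x + i * (2 * m) = (x + (i - 1) * (2 * m)) + 2 * m" by (simp add: algebra_simps)
      show ?case using step2(2) unfolding e shift .
    qed simp
    have "a' + (a div (2 * m)) * (2 * m) = a" by (simp only: a'_def mod_div_mult_eq)
    with per[of a' "a div (2 * m)"] show ?thesis by (simp only:)
  qed
  ultimately show ?thesis by simp
qed

lemma PsiV_T:
  assumes \<tau>: "Im \<tau> > 0" and m: "m > 0"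
  shows "PsiV m \<nu> a b (\<tau> + 1) = T_entry m \<nu> * ee ((of_int a)\<^sup>2 / (4 * of_int m))
    * PsiV m \<nu> a (a + b) \<tau>"
proof -
  have "Im (\<tau> + 1) > 0" using \<tau> by simp
  then have "even_lim (PsiT m \<nu> a b (\<tau> + 1)) (PsiV m \<nu> a b (\<tau> + 1))" by (rule even_lim_PsiT[OF _ m])
  moreover have "even_lim (PsiT m \<nu> a b (\<tau> + 1)) (T_entry m \<nu> * ee ((of_int a)\<^sup>2 / (4 * of_int m))
    * PsiV m \<nu> a (a + b) \<tau>)"
    unfolding PsiT_T[OF \<tau> m, abs_def] by (intro even_lim_cmult even_lim_PsiT \<tau> m)
  ultimately show ?thesis by (rule even_lim_unique)
qed

lemma PsiV_S:
  assumes \<tau>: "Im \<tau> > 0" and m: "m > 0"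
  shows "PsiV m \<nu> a b (- 1 / \<tau>) = jfactor (\<tau> / of_int (2 * m + 1)) * \<tau>
    * (\<Sum>\<mu>\<in>{0..<2 * m + 1}. zeta_inv m a b
         * S_entry m \<nu> \<mu> * PsiV m \<mu> b (- a) \<tau>)"
proof -
  have \<tau>0: "\<tau> \<noteq> 0" using \<tau> by auto
  let ?g = "\<lambda>z. ee (of_int m * z\<^sup>2 / (4 * \<tau>))"
  let ?C = "jfactor (\<tau> / of_int (2 * m + 1)) * \<tau>"
  let ?k = "\<lambda>\<mu>. zeta_inv m a b * S_entry m \<nu> \<mu>"
  let ?V = "?C * (\<Sum>\<mu>\<in>{0..<2 * m + 1}. ?k \<mu> * PsiV m \<mu> b (- a) \<tau>)"
  have l1: "even_lim (\<lambda>z. PsiT m \<nu> a b (- 1 / \<tau>) (z / \<tau>)) (PsiV m \<nu> a b (- 1 / \<tau>))"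
    by (rule even_lim_scale[OF even_lim_PsiT[OF Im_minus_inverse_pos[OF \<tau>] m] \<tau>0])
  have l2: "even_lim (\<lambda>z. ?g z * (?C * (\<Sum>\<mu>\<in>{0..<2 * m + 1}. ?k \<mu> * PsiT m \<mu> b (- a) \<tau> z))) ?V"
  proof (rule even_lim_even_mult)
    show "even_lim (\<lambda>z. ?C * (\<Sum>\<mu>\<in>{0..<2 * m + 1}. ?k \<mu> * PsiT m \<mu> b (- a) \<tau> z)) ?V"
      by (intro even_lim_cmult even_lim_sum even_lim_PsiT \<tau> m)
    show "?g (- z) = ?g z" for z by simp
    have "isCont ?g 0"
      unfolding ee_def using \<tau>0 by (intro continuous_intros) auto
    then show "(?g \<longlongrightarrow> 1) (at 0)" by (simp add: isCont_def)
  qed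
  have eq: "(\<lambda>z. PsiT m \<nu> a b (- 1 / \<tau>) (z / \<tau>)) = (\<lambda>z. ?g z * (?C * (\<Sum>\<mu>\<in>{0..<2 * m + 1}. ?k \<mu> * PsiT m \<mu> b (- a) \<tau> z)))"
    by (rule ext) (simp only: PsiT_S[OF \<tau> m] ac_simps)
  show ?thesis by (rule even_lim_unique[OF l1[unfolded eq] l2])
qed

text \<open>The definition of \<open>PsiV\<close> is a finite Fourier transform in n. Its inversion
  shows that the \<open>PsiV\<close> generate the same space, so invariance may be checked on
  them.\<close>

lemma F_null_eq_sum_PsiV:
  assumes m: "m > 0" and a: "0 \<le> a" "a < 2 * m" and n: "0 \<le> n" "n < 2 * m"
  shows "F_null m a n \<nu> \<tau> = (\<Sum>b\<in>{0..<2 * m}. ((- 1) powi \<nu> / (2 * of_int m) * zeta_inv m n b) * PsiV m \<nu> a b \<tau>)"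
proof -
  have X: "PsiV m \<nu> a b \<tau> = (\<Sum>k\<in>{0..<2 * m}. ee (of_int k * of_int b / (2 * of_int m)) * ((- 1) powi \<nu> * F_null m a k \<nu> \<tau>))" for b
    unfolding PsiV_def mod_pos_pos_trivial[OF a] by (intro sum.cong refl) (simp only: ac_simps)
  have s: "((- 1) powi \<nu> * (- 1) powi \<nu> :: complex) = 1"
    by (simp add: power_int_mult_distrib[symmetric])
  have "(\<Sum>b\<in>{0..<2 * m}. ((- 1) powi \<nu> / (2 * of_int m) * zeta_inv m n b) * PsiV m \<nu> a b \<tau>)
     = (- 1) powi \<nu> / (2 * of_int m) * (2 * of_int m * ((- 1) powi \<nu> * F_null m a n \<nu> \<tau>))"
    using finite_fourier_inversion[OF m, of n "\<lambda>k. (- 1) powi \<nu> * F_null m a k \<nu> \<tau>"] n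
    unfolding X mult.assoc sum_distrib_left[symmetric] by simp
  also have "\<dots> = ((- 1) powi \<nu> * (- 1) powi \<nu>) * F_null m a n \<nu> \<tau>"
    using m by simp
  finally show ?thesis unfolding s by simp
qed

lemma F_null_eq_0: "\<not> Im \<tau> > 0 \<Longrightarrow> F_null m a n \<nu> \<tau> = 0"
  by (simp add: F_null_def)

lemma PsiV_eq_0: "\<not> Im \<tau> > 0 \<Longrightarrow> PsiV m \<nu> a b \<tau> = 0"
  by (simp add: PsiV_def F_null_eq_0)

lemma V_space_sum:
  assumes "\<And>i. i \<in> A \<Longrightarrow> f i \<in> V_space m"
  shows "(\<lambda>\<tau>. \<Sum>i\<in>A. f i \<tau>) \<in> V_space m"
proof -
  have "sum f A \<in> V_space m"
    using assms unfolding V_space_def by (intro complex_fun.span_sum)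
  also have "sum f A = (\<lambda>\<tau>. \<Sum>i\<in>A. f i \<tau>)" by (induction A rule: infinite_finite_induct) (auto simp: fun_eq_iff)
  finally show ?thesis .
qed

lemma V_space_scale: "f \<in> V_space m \<Longrightarrow> (\<lambda>\<tau>. c * f \<tau>) \<in> V_space m"
  unfolding V_space_def by (rule complex_fun.span_scale)

lemma PsiV_in_V_space:
  assumes m: "m > 0" and \<nu>: "0 \<le> \<nu>" "\<nu> \<le> 2 * m"
  shows "(\<lambda>\<tau>. PsiV m \<nu> a b \<tau>) \<in> V_space m"
  unfolding PsiV_def
proof (intro V_space_sum V_space_scale)
  fix n assume n: "n \<in> {0..<2 * m}"
  have "0 \<le> a mod (2 * m)" "a mod (2 * m) < 2 * m" using m by simp_all
  with n \<nu> have "F_null m (a mod (2 * m)) n \<nu> \<in> V_space m"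
    unfolding V_space_def
    by (intro complex_fun.span_base CollectI exI[of _ "a mod (2 * m)"] exI[of _ n] exI[of _ \<nu>]) simp
  then show "(\<lambda>\<tau>. F_null m (a mod (2 * m)) n \<nu> \<tau>) \<in> V_space m" by simp
qed

lemma F_null_T_in_V_space:
  assumes m: "m > 0" and a: "0 \<le> a" "a < 2 * m" and n: "0 \<le> n" "n < 2 * m" and \<nu>: "0 \<le> \<nu>" "\<nu> \<le> 2 * m"
  shows "(\<lambda>\<tau>. F_null m a n \<nu> (\<tau> + 1)) \<in> V_space m"
proof -
  have X: "(\<lambda>\<tau>. PsiV m \<nu> a b (\<tau> + 1)) \<in> V_space m" for b
  proof -
    have "(\<lambda>\<tau>. PsiV m \<nu> a b (\<tau> + 1)) = (\<lambda>\<tau>. T_entry m \<nu> * ee ((of_int a)\<^sup>2 / (4 * of_int m))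
      * PsiV m \<nu> a (a + b) \<tau>)"
    proof
      fix \<tau> :: complex
      show "PsiV m \<nu> a b (\<tau> + 1) = T_entry m \<nu> * ee ((of_int a)\<^sup>2 / (4 * of_int m))
          * PsiV m \<nu> a (a + b) \<tau>"
        \<comment> \<open>Membership in the span concerns functions on the whole plane; off the
          upper half plane both sides are 0 by the convention in \<open>F_null\<close>.\<close>
        by (cases "Im \<tau> > 0") (rule PsiV_T[OF _ m], assumption, simp add: PsiV_eq_0)
    qed
    then show ?thesis using V_space_scale[OF PsiV_in_V_space[OF m \<nu>]] by simp
  qed
  show ?thesis
    unfolding F_null_eq_sum_PsiV[OF m a n] by (intro V_space_sum V_space_scale X)
qed

lemma F_null_S_in_V_space:
  assumes m: "m > 0" and a: "0 \<le> a" "a < 2 * m" and n: "0 \<le> n" "n < 2 * m" and \<nu>: "0 \<le> \<nu>" "\<nu> \<le> 2 * m"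
  shows "(\<lambda>\<tau>. (- \<i> * \<tau>) powr (- 3 / 2) * F_null m a n \<nu> (- 1 / \<tau>)) \<in> V_space m"
proof -
  let ?k = "\<lambda>b \<mu>. zeta_inv m a b * S_entry m \<nu> \<mu>"
  \<comment> \<open>Since tau = i (-i tau), the automorphy factor of theta and the tau of the
    quotient combine to a constant times (-i tau)^(3/2). The square root comes from evaluating
    \<open>jfactor\<close> at tau / (2 m + 1).\<close>
  define K where "K = jfactor \<i> * of_real (sqrt (1 / of_int (2 * m + 1))) * \<i>"
  have aut: "(- \<i> * \<tau>) powr (- 3 / 2) * (jfactor (\<tau> / of_int (2 * m + 1)) * \<tau>) = K" if \<tau>: "Im \<tau> > 0" for \<tau>
  proof -
    have z: "- \<i> * \<tau> \<noteq> 0" using \<tau> by auto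
    define r :: real where "r = 1 / of_int (2 * m + 1)"
    have r: "r > 0" using m by (simp add: r_def)
    have \<sigma>: "\<tau> / of_int (2 * m + 1) = of_real r * \<tau>" by (simp add: r_def)
    have "Im (of_real r * \<tau>) > 0" using r \<tau> by simp
    then have j: "jfactor (\<tau> / of_int (2 * m + 1)) = jfactor \<i> * (- \<i> * (of_real r * \<tau>)) powr (1 / 2)"
      unfolding \<sigma> by (rule jfactor_eq)
    have "- \<i> * (of_real r * \<tau>) = of_real r * (- \<i> * \<tau>)" by simp
    then have h: "(- \<i> * (of_real r * \<tau>)) powr (1 / 2) = of_real (sqrt r) * (- \<i> * \<tau>) powr (1 / 2)"
      using powr_half_scale[OF r z] by (simp only:)
    define Z where "Z = - \<i> * \<tau>"
    have "Z \<noteq> 0" unfolding Z_def by (rule z)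
    then have p: "Z powr (- 3 / 2) * Z powr (1 / 2) = inverse Z"
    proof -
      assume Z0: "Z \<noteq> 0"
      have "Z powr (- 3 / 2) * Z powr (1 / 2) = exp (- 3 / 2 * Ln Z) * exp (1 / 2 * Ln Z)"
        using Z0 by (simp add: powr_def)
      also have "\<dots> = exp (- 3 / 2 * Ln Z + 1 / 2 * Ln Z)" by (rule exp_add[symmetric])
      also have "- 3 / 2 * Ln Z + 1 / 2 * Ln Z = - Ln Z" by simp
      also have "exp (- Ln Z) = inverse Z" by (simp only: exp_minus exp_Ln[OF Z0])
      finally show ?thesis .
    qed
    have "Z powr (- 3 / 2) * (jfactor (\<tau> / of_int (2 * m + 1)) * \<tau>) = jfactor \<i> * of_real (sqrt r) * ((Z powr (- 3 / 2) * Z powr (1 / 2)) * \<tau>)"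
      unfolding j h Z_def[symmetric] by (simp only: ac_simps)
    also have "(Z powr (- 3 / 2) * Z powr (1 / 2)) * \<tau> = \<i>"
      unfolding p using \<open>Z \<noteq> 0\<close> by (simp add: Z_def field_simps)
    finally show ?thesis by (simp only: K_def r_def Z_def)
  qed
  have X: "(\<lambda>\<tau>. (- \<i> * \<tau>) powr (- 3 / 2) * PsiV m \<nu> a b (- 1 / \<tau>)) \<in> V_space m" for b
  proof -
    have "(\<lambda>\<tau>. (- \<i> * \<tau>) powr (- 3 / 2) * PsiV m \<nu> a b (- 1 / \<tau>))
       = (\<lambda>\<tau>. K * (\<Sum>\<mu>\<in>{0..<2 * m + 1}. ?k b \<mu> * PsiV m \<mu> b (- a) \<tau>))"
    proof
      fix \<tau> :: complex
      show "(- \<i> * \<tau>) powr (- 3 / 2) * PsiV m \<nu> a b (- 1 / \<tau>) = K * (\<Sum>\<mu>\<in>{0..<2 * m + 1}. ?k b \<mu> * PsiV m \<mu> b (- a) \<tau>)"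
      proof (cases "Im \<tau> > 0")
        case True
        show ?thesis unfolding PsiV_S[OF True m] aut[OF True, symmetric] by (simp only: mult.assoc)
      next
        case False
        have "Im (- 1 / \<tau>) = Im \<tau> / (norm \<tau>)\<^sup>2" by (simp add: Im_divide cmod_power2)
        then have "\<not> Im (- 1 / \<tau>) > 0" using False by (simp add: zero_less_divide_iff)
        then have "PsiV m \<nu> a b (- 1 / \<tau>) = 0" by (rule PsiV_eq_0)
        then show ?thesis
          by (simp only: PsiV_eq_0[OF False] mult_zero_right sum.neutral_const)
      qed
    qed
    moreover have "(\<lambda>\<tau>. K * (\<Sum>\<mu>\<in>{0..<2 * m + 1}. ?k b \<mu> * PsiV m \<mu> b (- a) \<tau>)) \<in> V_space m"
      by (intro V_space_scale V_space_sum PsiV_in_V_space m) auto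
    ultimately show ?thesis by (simp only:)
  qed
  have "(\<lambda>\<tau>. (- \<i> * \<tau>) powr (- 3 / 2) * F_null m a n \<nu> (- 1 / \<tau>))
     = (\<lambda>\<tau>. \<Sum>b\<in>{0..<2 * m}. ((- 1) powi \<nu> / (2 * of_int m) * zeta_inv m n b)
          * ((- \<i> * \<tau>) powr (- 3 / 2) * PsiV m \<nu> a b (- 1 / \<tau>)))"
    unfolding F_null_eq_sum_PsiV[OF m a n] sum_distrib_left by (simp only: mult.left_commute)
  moreover have "\<dots> \<in> V_space m" by (intro V_space_sum V_space_scale X)
  ultimately show ?thesis by (simp only:)
qed

theorem theorem4p1:
  fixes m :: int
  assumes "m > 0"
  shows "\<forall>f \<in> V_space m.
           (\<lambda>\<tau>. f (\<tau> + 1)) \<in> V_space m \<and>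
           (\<lambda>\<tau>. (- \<i> * \<tau>) powr (- 3 / 2) * f (- 1 / \<tau>)) \<in> V_space m"
proof
  fix f assume "f \<in> V_space m"
  let ?P = "\<lambda>f. (\<lambda>\<tau>. f (\<tau> + 1)) \<in> V_space m \<and>
     (\<lambda>\<tau>. (- \<i> * \<tau>) powr (- 3 / 2) * f (- 1 / \<tau>)) \<in> V_space m"
  have V_add: "(\<lambda>\<tau>. g \<tau> + h \<tau>) \<in> V_space m" if "g \<in> V_space m" "h \<in> V_space m" for g h
    using complex_fun.span_add[OF that[unfolded V_space_def]] unfolding V_space_def by (simp add: plus_fun_def)
  have V_0: "(\<lambda>\<tau>. 0) \<in> V_space m"
    using complex_fun.span_zero unfolding V_space_def by (simp add: zero_fun_def)
  have "f \<in> complex_span {F_null m a n \<nu> | a n \<nu>. 0 \<le> a \<and> a < 2 * m \<and> 0 \<le> n \<and> n < 2 * m \<and> 0 \<le> \<nu> \<and> \<nu> \<le> 2 * m}"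
    using \<open>f \<in> V_space m\<close> unfolding V_space_def .
  then show "?P f"
  proof (rule complex_fun.span_induct[where P = ?P])
    show "complex_fun.subspace {f. ?P f}"
    proof (rule complex_fun.subspaceI)
      show "0 \<in> {f. ?P f}" using V_0 by simp
    next
      fix g h assume "g \<in> {f. ?P f}" "h \<in> {f. ?P f}"
      then have gh: "?P g" "?P h" by (simp_all only: mem_Collect_eq)
      have "?P (g + h)"
        using V_add[OF conjunct1[OF gh(1)] conjunct1[OF gh(2)]] V_add[OF conjunct2[OF gh(1)] conjunct2[OF gh(2)]]
        by (simp only: plus_fun_apply distrib_left)
      then show "g + h \<in> {f. ?P f}" by (simp only: mem_Collect_eq)
    next
      fix c g assume "g \<in> {f. ?P f}"
      then have g: "?P g" by (simp only: mem_Collect_eq)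
      have "?P (\<lambda>\<tau>. c * g \<tau>)"
        using V_space_scale[OF conjunct1[OF g], of c] V_space_scale[OF conjunct2[OF g], of c]
        by (simp only: mult.left_commute)
      then show "(\<lambda>\<tau>. c * g \<tau>) \<in> {f. ?P f}" by (simp only: mem_Collect_eq)
    qed
    fix x assume "x \<in> {F_null m a n \<nu> | a n \<nu>. 0 \<le> a \<and> a < 2 * m \<and> 0 \<le> n \<and> n < 2 * m \<and> 0 \<le> \<nu> \<and> \<nu> \<le> 2 * m}"
    then obtain a n \<nu> where x: "x = F_null m a n \<nu>"
      and *: "0 \<le> a" "a < 2 * m" "0 \<le> n" "n < 2 * m" "0 \<le> \<nu>" "\<nu> \<le> 2 * m"
      by (elim CollectE exE conjE) (rule that)
    show "?P x"
      unfolding x using F_null_T_in_V_space[OF assms *] F_null_S_in_V_space[OF assms *] by (rule conjI)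
  qed
qed

end
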